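(* Let $f\colon M^2\to (N^3,g)$ be a front, let $p\in M^2$ be a singular point of $f$, and let $\gamma(t)$ be a singular curve consisting of non-degenerate singular points with $\gamma(0)=p$, defined on an open interval $I\subset\mathbf{R}$. (1) The Gaussian curvature $K$ of $f$ is bounded on a sufficiently small neighborhood of $\gamma(I)$ if and only if the second fundamental form of $f$ vanishes on $\gamma(I)$. (2) If the extrinsic curvature $K_{\mathrm{ext}}$ (i.e. the product of the principal curvatures) is non-negative on $U\setminus\gamma(I)$ for a neighborhood $U$ of $p$, then the singular curvature is non-positive. (3) If $K_{\mathrm{ext}}$ is bounded below by a positive constant on $U\setminus\gamma(I)$ for a neighborhood $U$ of $p$, then the singular curvature at $p$ takes a strictly negative value. (4) In particular, when $(N^3,g)$ is the Euclidean space $(\mathbf{R}^3,g_0)$, the singular curvature is non-positive if the Gaussian curvature $K$ is non-negative near the singular set.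
   Context: All objects are $C^\infty$. $M^2$ is an oriented $2$-manifold and $(N^3,g)$ an oriented Riemannian $3$-manifold with Levi-Civita connection $D$ and Riemannian volume form $\mu_g$. A smooth map $f\colon M^2\to N^3$ is a front if there is a unit vector field $\nu$ of $N^3$ along $f$ (the unit normal vector field) with $g(f_*X,\nu)=0$ for all $X\in TM^2$ and such that $(f,\nu)\colon M^2\to T_1N^3$ is an immersion. The second fundamental form is $h(X,Y)=-g(f_*X,D_Y\nu)$. In local coordinates $(u,v)$ compatible with the orientation of $M^2$, $\lambda=\mu_g(f_u,f_v,\nu)$ is the signed area density function. A point is singular if $f$ is not an immersion there (equivalently $\lambda=0$); otherwise it is regular. A singular point $p$ is non-degenerate if $d\lambda(p)\ne0$; near it the singular set is a regular curve, called the singular curve. At such points the kernel of $f_*$ is one-dimensional (the null direction; its nonzero elements are null vectors). A cuspidal edge is a singular point at which $f$ is locally diffeomorphic (by diffeomorphism germs of source and target) to $f_C(u,v)=(u^2,u^3,v)$ at $(0,0)$; it is a non-degenerate singular point at which the null direction is transversal to the singular curve. Singular curvature: along a singular curve $\gamma(t)$ consisting of cuspidal edges, choose a null vector field $\eta(t)$ along $\gamma$ with $(\gamma',\eta)$ positively oriented, put $\hat\gamma=f\circ\gamma$, $\hat\gamma''=D_t\hat\gamma'$, and $$\kappa_s(t)=\mathrm{sgn}(d\lambda(\eta))\,\frac{\mu_g(\hat\gamma',\hat\gamma'',\nu)}{|\hat\gamma'|^3}.$$ The singular curvature is thus defined at cuspidal edge points, and assertions about it refer to such points. $K$ is the Gaussian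 curvature of the first fundamental form $f^*g$ on the set of regular points, and $K_{\mathrm{ext}}$ is the extrinsic curvature there, i.e. the determinant of the shape operator. Thus $K=c_{N^3}+K_{\mathrm{ext}}$, where $c_{N^3}$ is the sectional curvature of $(N^3,g)$ on the plane $\nu^\perp$.
   Formalization: In (1), "K is bounded on a neighborhood of γ(I)" is replaced by "K is bounded on a neighborhood of γ(J) for every compact J ⊂ I"; with one bound for all of γ(I) the "if" part is false, e.g. for f(x,v) = (x, v², v³ + sin(x²)v²) with γ(t) = (t,0). *)

theory Defs
  imports "HOL-Analysis.Analysis"
begin

section \<open>Smooth functions between open subsets of normed spaces\<close>

text \<open>Meant for open \<open>S\<close> in a finite-dimensional space, where continuity of all iterated directional
  derivatives is the usual notion of class \<open>C\<^sup>k\<close>.\<close>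

primrec Ck_on :: "nat \<Rightarrow> 'a::real_normed_vector set \<Rightarrow> ('a \<Rightarrow> 'b::real_normed_vector) \<Rightarrow> bool" where
  "Ck_on 0 S F \<longleftrightarrow> continuous_on S F"
| "Ck_on (Suc k) S F \<longleftrightarrow>
     F differentiable_on S \<and> (\<forall>v. Ck_on k S (\<lambda>x. frechet_derivative F (at x) v))"

definition smooth_on :: "'a::real_normed_vector set \<Rightarrow> ('a \<Rightarrow> 'b::real_normed_vector) \<Rightarrow> bool" where
  "smooth_on S F \<longleftrightarrow> (\<forall>k. Ck_on k S F)"

definition diffeo_on ::
  "'a::real_normed_vector set \<Rightarrow> 'b::real_normed_vector set \<Rightarrow> ('a \<Rightarrow> 'b) \<Rightarrow> bool" where
  "diffeo_on S T \<phi> \<longleftrightarrow> open S \<and> open T \<and> bij_betw \<phi> S T \<and> smooth_on S \<phi> \<and> smooth_on T (inv_into S \<phi>)"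


section \<open>Manifolds, tangent vectors, smooth maps\<close>

text \<open>A chart is a pair of a domain and a coordinate map. The underlying topological space of a
  manifold is a type; the manifold structure is an atlas on it, which need not be maximal.\<close>

type_synonym ('m, 'd) chart = "'m set \<times> ('m \<Rightarrow> (real, 'd) vec)"

definition param :: "('m, 'd::finite) chart \<Rightarrow> real^'d \<Rightarrow> 'm" where
  "param c = inv_into (fst c) (snd c)"

definition transition :: "('m, 'd::finite) chart \<Rightarrow> ('m, 'd) chart \<Rightarrow> real^'d \<Rightarrow> real^'d" where
  "transition c c' = snd c' \<circ> param c"

definition smooth_atlas ::
  "('m::{t2_space,second_countable_topology}, 'd::finite) chart set \<Rightarrow> bool" where
  "smooth_atlas A \<longleftrightarrow>
     (\<Union>c\<in>A. fst c) = UNIV \<and>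
     (\<forall>c\<in>A. open (fst c) \<and> open (snd c ` fst c) \<and>
            homeomorphism (fst c) (snd c ` fst c) (snd c) (param c)) \<and>
     (\<forall>c\<in>A. \<forall>c'\<in>A. smooth_on (snd c ` (fst c \<inter> fst c')) (transition c c'))"

definition oriented_atlas ::
  "('m::{t2_space,second_countable_topology}, 'd::finite) chart set \<Rightarrow> bool" where
  "oriented_atlas A \<longleftrightarrow> smooth_atlas A \<and>
     (\<forall>c\<in>A. \<forall>c'\<in>A. \<forall>p\<in>fst c \<inter> fst c'. det (jacobian (transition c c') (at (snd c p))) > 0)"

definition chart_at :: "('m, 'd::finite) chart set \<Rightarrow> 'm \<Rightarrow> ('m, 'd) chart" where
  "chart_at A p = (SOME c. c \<in> A \<and> p \<in> fst c)"

text \<open>A tangent vector at \<open>p\<close> is the family of its component vectors in the charts around \<open>p\<close>; it is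
  normalised to \<open>0\<close> at all other charts, so that the zero vector is \<open>\<lambda>_. 0\<close>. Below, quantities which
  do not depend on the chart used to compute them are evaluated in \<open>chart_at\<close>.\<close>

type_synonym ('m, 'd) tvec = "('m, 'd) chart \<Rightarrow> (real, 'd) vec"

definition tangent_space :: "('m, 'd::finite) chart set \<Rightarrow> 'm \<Rightarrow> ('m, 'd) tvec set" where
  "tangent_space A p = {X.
     (\<forall>c. c \<notin> A \<or> p \<notin> fst c \<longrightarrow> X c = 0) \<and>
     (\<forall>c\<in>A. \<forall>c'\<in>A. p \<in> fst c \<inter> fst c' \<longrightarrow>
        X c' = jacobian (transition c c') (at (snd c p)) *v X c)}"

definition coord_vector ::
  "('m, 'd::finite) chart set \<Rightarrow> ('m, 'd) chart \<Rightarrow> 'd \<Rightarrow> 'm \<Rightarrow> ('m, 'd) tvec" where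
  "coord_vector A c i p = (\<lambda>c'. if c' \<in> A \<and> p \<in> fst c'
     then jacobian (transition c c') (at (snd c p)) *v axis i 1 else 0)"

definition smooth_map ::
  "('m::topological_space, 'd::finite) chart set \<Rightarrow> ('n::topological_space, 'e::finite) chart set
    \<Rightarrow> ('m \<Rightarrow> 'n) \<Rightarrow> bool" where
  "smooth_map A B f \<longleftrightarrow> continuous_on UNIV f \<and>
     (\<forall>c\<in>A. \<forall>d\<in>B. smooth_on (snd c ` (fst c \<inter> f -` fst d)) (snd d \<circ> f \<circ> param c))"

definition pushforward ::
  "('m, 'd::finite) chart set \<Rightarrow> ('n, 'e::finite) chart set \<Rightarrow> ('m \<Rightarrow> 'n) \<Rightarrow> 'm
    \<Rightarrow> ('m, 'd) tvec \<Rightarrow> ('n, 'e) tvec" where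
  "pushforward A B f p X = (let c = chart_at A p in
     (\<lambda>d. if d \<in> B \<and> f p \<in> fst d
        then jacobian (snd d \<circ> f \<circ> param c) (at (snd c p)) *v X c else 0))"

definition velocity ::
  "('m, 'd::finite) chart set \<Rightarrow> (real \<Rightarrow> 'm) \<Rightarrow> real \<Rightarrow> ('m, 'd) tvec" where
  "velocity A \<sigma> t = (\<lambda>c. if c \<in> A \<and> \<sigma> t \<in> fst c then vector_derivative (snd c \<circ> \<sigma>) (at t) else 0)"


section \<open>Riemannian metrics\<close>

text \<open>A metric is given by its component matrices in the charts of the atlas.\<close>

type_synonym ('m, 'd) metric = "('m, 'd) chart \<Rightarrow> 'm \<Rightarrow> ((real, 'd) vec, 'd) vec"

definition riemannian_metric ::
  "('m::topological_space, 'd::finite) chart set \<Rightarrow> ('m, 'd) metric \<Rightarrow> bool" where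
  "riemannian_metric A g \<longleftrightarrow>
     (\<forall>c\<in>A. smooth_on (snd c ` fst c) (g c \<circ> param c)) \<and>
     (\<forall>c\<in>A. \<forall>p\<in>fst c. transpose (g c p) = g c p \<and> (\<forall>v. v \<noteq> 0 \<longrightarrow> v \<bullet> (g c p *v v) > 0)) \<and>
     (\<forall>c\<in>A. \<forall>c'\<in>A. \<forall>p\<in>fst c \<inter> fst c'.
        let J = jacobian (transition c c') (at (snd c p))
        in g c p = transpose J ** g c' p ** J)"

definition ginner ::
  "('m, 'd::finite) chart set \<Rightarrow> ('m, 'd) metric \<Rightarrow> 'm \<Rightarrow> ('m, 'd) tvec \<Rightarrow> ('m, 'd) tvec \<Rightarrow> real" where
  "ginner A g p X Y = (let c = chart_at A p in X c \<bullet> (g c p *v Y c))"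

definition volume_form ::
  "('n, 3) chart set \<Rightarrow> ('n, 3) metric \<Rightarrow> 'n \<Rightarrow> ('n, 3) tvec \<Rightarrow> ('n, 3) tvec \<Rightarrow> ('n, 3) tvec \<Rightarrow> real" where
  "volume_form A g p X Y Z = (let c = chart_at A p in
     sqrt (det (g c p)) * det (vector [X c, Y c, Z c] :: real^3^3))"

text \<open>\<open>christoffel G x i j k\<close> is \<open>\<Gamma>\<^sup>k\<^bsub>ij\<^esub>\<close> of the metric with component matrix function \<open>G\<close>.\<close>

definition pderiv_at :: "'d::finite \<Rightarrow> (real^'d \<Rightarrow> real) \<Rightarrow> real^'d \<Rightarrow> real" where
  "pderiv_at i F x = frechet_derivative F (at x) (axis i 1)"

definition christoffel :: "(real^'d::finite \<Rightarrow> real^'d^'d) \<Rightarrow> real^'d \<Rightarrow> 'd \<Rightarrow> 'd \<Rightarrow> 'd \<Rightarrow> real" where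
  "christoffel G x i j k = (1/2) * (\<Sum>l\<in>UNIV. matrix_inv (G x) $ k $ l *
     (pderiv_at i (\<lambda>y. G y $ j $ l) x + pderiv_at j (\<lambda>y. G y $ i $ l) x - pderiv_at l (\<lambda>y. G y $ i $ j) x))"

text \<open>\<open>curvature G x i j k l\<close> is the \<open>l\<close>-th component of \<open>R(\<partial>\<^sub>i, \<partial>\<^sub>j) \<partial>\<^sub>k\<close> with
  \<open>R(X, Y) Z = D\<^sub>X D\<^sub>Y Z - D\<^sub>Y D\<^sub>X Z - D\<^bsub>[X,Y]\<^esub> Z\<close>.\<close>

definition curvature ::
  "(real^'d::finite \<Rightarrow> real^'d^'d) \<Rightarrow> real^'d \<Rightarrow> 'd \<Rightarrow> 'd \<Rightarrow> 'd \<Rightarrow> 'd \<Rightarrow> real" where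
  "curvature G x i j k l =
     pderiv_at i (\<lambda>y. christoffel G y j k l) x - pderiv_at j (\<lambda>y. christoffel G y i k l) x +
     (\<Sum>m\<in>UNIV. christoffel G x i m l * christoffel G x j k m - christoffel G x j m l * christoffel G x i k m)"

text \<open>\<open>\<langle>R(\<partial>\<^sub>1, \<partial>\<^sub>2) \<partial>\<^sub>2, \<partial>\<^sub>1\<rangle> / (\<langle>\<partial>\<^sub>1, \<partial>\<^sub>1\<rangle> \<langle>\<partial>\<^sub>2, \<partial>\<^sub>2\<rangle> - \<langle>\<partial>\<^sub>1, \<partial>\<^sub>2\<rangle>\<^sup>2)\<close>\<close>

definition gauss_curvature :: "(real^2 \<Rightarrow> real^2^2) \<Rightarrow> real^2 \<Rightarrow> real" where
  "gauss_curvature G x = (\<Sum>l\<in>UNIV. curvature G x 1 2 2 l * G x $ l $ 1) / det (G x)"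

text \<open>The Levi-Civita term \<open>\<Gamma>(v, w)\<close> in the chart \<open>d\<close>. Covariant derivatives along maps and curves are
  the derivative of the components plus this term.\<close>

definition conn_term ::
  "('n, 'd::finite) metric \<Rightarrow> ('n, 'd) chart \<Rightarrow> 'n \<Rightarrow> real^'d \<Rightarrow> real^'d \<Rightarrow> real^'d" where
  "conn_term g d y v w =
     (\<chi> k. \<Sum>i\<in>UNIV. \<Sum>j\<in>UNIV. christoffel (g d \<circ> param d) (snd d y) i j k * v $ i * w $ j)"

definition cov_deriv_along_map ::
  "('m, 'd::finite) chart set \<Rightarrow> ('n, 'e::finite) chart set \<Rightarrow> ('n, 'e) metric \<Rightarrow> ('m \<Rightarrow> 'n)
    \<Rightarrow> ('m \<Rightarrow> ('n, 'e) tvec) \<Rightarrow> 'm \<Rightarrow> ('m, 'd) tvec \<Rightarrow> ('n, 'e) tvec" where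
  "cov_deriv_along_map A B g f V p Y = (let c = chart_at A p in
     (\<lambda>d. if d \<in> B \<and> f p \<in> fst d
        then frechet_derivative (\<lambda>x. V (param c x) d) (at (snd c p)) (Y c)
             + conn_term g d (f p) (pushforward A B f p Y d) (V p d)
        else 0))"

definition cov_deriv_along_curve ::
  "('n, 'e::finite) chart set \<Rightarrow> ('n, 'e) metric \<Rightarrow> (real \<Rightarrow> 'n) \<Rightarrow> (real \<Rightarrow> ('n, 'e) tvec)
    \<Rightarrow> real \<Rightarrow> ('n, 'e) tvec" where
  "cov_deriv_along_curve B g \<sigma> V t =
     (\<lambda>d. if d \<in> B \<and> \<sigma> t \<in> fst d
        then vector_derivative (\<lambda>s. V s d) (at t) + conn_term g d (\<sigma> t) (velocity B \<sigma> t d) (V t d)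
        else 0)"

text \<open>Isometric to \<open>(\<real>\<^sup>3, g\<^sub>0)\<close>, with no condition on the orientation.\<close>

definition standard_atlas :: "(real^'d, 'd::finite) chart set" where
  "standard_atlas = {(UNIV, \<lambda>x. x)}"

definition euclidean_3space :: "('n::topological_space, 3) chart set \<Rightarrow> ('n, 3) metric \<Rightarrow> bool" where
  "euclidean_3space N g \<longleftrightarrow> (\<exists>\<Phi> :: 'n \<Rightarrow> real^3.
     bij \<Phi> \<and> smooth_map N standard_atlas \<Phi> \<and> smooth_map standard_atlas N (inv \<Phi>) \<and>
     (\<forall>d\<in>N. \<forall>y\<in>fst d. let J = jacobian (\<Phi> \<circ> param d) (at (snd d y)) in g d y = transpose J ** J))"


section \<open>Fronts\<close>

text \<open>The last condition says that \<open>(f, \<nu>)\<close> is an immersion, expressed in the charts of the tangent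
  bundle of the target (of which the unit tangent bundle is an embedded submanifold) that are induced
  by the charts of the target.\<close>

definition front ::
  "('m::{t2_space,second_countable_topology}, 2) chart set
    \<Rightarrow> ('n::{t2_space,second_countable_topology}, 3) chart set \<Rightarrow> ('n, 3) metric
    \<Rightarrow> ('m \<Rightarrow> 'n) \<Rightarrow> ('m \<Rightarrow> ('n, 3) tvec) \<Rightarrow> bool" where
  "front M N g f \<nu> \<longleftrightarrow>
     smooth_map M N f \<and>
     (\<forall>p. \<nu> p \<in> tangent_space N (f p)) \<and>
     (\<forall>c\<in>M. \<forall>d\<in>N. smooth_on (snd c ` (fst c \<inter> f -` fst d)) (\<lambda>x. \<nu> (param c x) d)) \<and>
     (\<forall>p. ginner N g (f p) (\<nu> p) (\<nu> p) = 1) \<and>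
     (\<forall>p. \<forall>X\<in>tangent_space M p. ginner N g (f p) (pushforward M N f p X) (\<nu> p) = 0) \<and>
     (\<forall>p. \<forall>c\<in>M. \<forall>d\<in>N. p \<in> fst c \<and> f p \<in> fst d \<longrightarrow>
        inj (frechet_derivative (\<lambda>x. (snd d (f (param c x)), \<nu> (param c x) d)) (at (snd c p))))"

definition second_fundamental_form ::
  "('m, 2) chart set \<Rightarrow> ('n, 3) chart set \<Rightarrow> ('n, 3) metric \<Rightarrow> ('m \<Rightarrow> 'n) \<Rightarrow> ('m \<Rightarrow> ('n, 3) tvec)
    \<Rightarrow> 'm \<Rightarrow> ('m, 2) tvec \<Rightarrow> ('m, 2) tvec \<Rightarrow> real" where
  "second_fundamental_form M N g f \<nu> p X Y =
     - ginner N g (f p) (pushforward M N f p X) (cov_deriv_along_map M N g f \<nu> p Y)"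

definition null_vector ::
  "('m, 2) chart set \<Rightarrow> ('n, 3) chart set \<Rightarrow> ('m \<Rightarrow> 'n) \<Rightarrow> 'm \<Rightarrow> ('m, 2) tvec \<Rightarrow> bool" where
  "null_vector M N f p X \<longleftrightarrow>
     X \<in> tangent_space M p \<and> X \<noteq> (\<lambda>_. 0) \<and> pushforward M N f p X = (\<lambda>_. 0)"

definition singular_point :: "('m, 2) chart set \<Rightarrow> ('n, 3) chart set \<Rightarrow> ('m \<Rightarrow> 'n) \<Rightarrow> 'm \<Rightarrow> bool" where
  "singular_point M N f p \<longleftrightarrow> (\<exists>X. null_vector M N f p X)"

text \<open>\<open>\<lambda>\<close> as a function of the coordinates of the chart \<open>c\<close>\<close>

definition area_density ::
  "('m, 2) chart set \<Rightarrow> ('n, 3) chart set \<Rightarrow> ('n, 3) metric \<Rightarrow> ('m \<Rightarrow> 'n) \<Rightarrow> ('m \<Rightarrow> ('n, 3) tvec)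
    \<Rightarrow> ('m, 2) chart \<Rightarrow> real^2 \<Rightarrow> real" where
  "area_density M N g f \<nu> c x = (let q = param c x in
     volume_form N g (f q) (pushforward M N f q (coord_vector M c 1 q))
       (pushforward M N f q (coord_vector M c 2 q)) (\<nu> q))"

text \<open>At singular points, changing the chart multiplies this differential by a positive number.\<close>

definition d_area_density ::
  "('m, 2) chart set \<Rightarrow> ('n, 3) chart set \<Rightarrow> ('n, 3) metric \<Rightarrow> ('m \<Rightarrow> 'n) \<Rightarrow> ('m \<Rightarrow> ('n, 3) tvec)
    \<Rightarrow> 'm \<Rightarrow> ('m, 2) tvec \<Rightarrow> real" where
  "d_area_density M N g f \<nu> p X = (let c = chart_at M p in
     frechet_derivative (area_density M N g f \<nu> c) (at (snd c p)) (X c))"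

definition nondegenerate_singular_point ::
  "('m, 2) chart set \<Rightarrow> ('n, 3) chart set \<Rightarrow> ('n, 3) metric \<Rightarrow> ('m \<Rightarrow> 'n) \<Rightarrow> ('m \<Rightarrow> ('n, 3) tvec)
    \<Rightarrow> 'm \<Rightarrow> bool" where
  "nondegenerate_singular_point M N g f \<nu> p \<longleftrightarrow>
     singular_point M N f p \<and> (\<exists>X\<in>tangent_space M p. d_area_density M N g f \<nu> p X \<noteq> 0)"

definition nondegenerate_singular_curve ::
  "('m::topological_space, 2) chart set \<Rightarrow> ('n, 3) chart set \<Rightarrow> ('n, 3) metric \<Rightarrow> ('m \<Rightarrow> 'n)
    \<Rightarrow> ('m \<Rightarrow> ('n, 3) tvec) \<Rightarrow> real set \<Rightarrow> (real \<Rightarrow> 'm) \<Rightarrow> bool" where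
  "nondegenerate_singular_curve M N g f \<nu> I \<gamma> \<longleftrightarrow>
     continuous_on I \<gamma> \<and>
     (\<forall>c\<in>M. smooth_on (I \<inter> \<gamma> -` fst c) (snd c \<circ> \<gamma>)) \<and>
     (\<forall>t\<in>I. velocity M \<gamma> t \<noteq> (\<lambda>_. 0)) \<and>
     (\<forall>t\<in>I. nondegenerate_singular_point M N g f \<nu> (\<gamma> t))"

definition standard_cuspidal_edge :: "real^2 \<Rightarrow> real^3" where
  "standard_cuspidal_edge x = vector [(x $ 1)^2, (x $ 1)^3, x $ 2]"

definition cuspidal_edge :: "('m, 2) chart set \<Rightarrow> ('n, 3) chart set \<Rightarrow> ('m \<Rightarrow> 'n) \<Rightarrow> 'm \<Rightarrow> bool" where
  "cuspidal_edge M N f p \<longleftrightarrow>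
     (\<exists>c\<in>M. \<exists>d\<in>N. p \<in> fst c \<and> f p \<in> fst d \<and>
       (\<exists>S T \<phi> V W \<Psi>.
          diffeo_on S T \<phi> \<and> S \<subseteq> snd c ` fst c \<and> snd c p \<in> S \<and> \<phi> (snd c p) = (0 :: real^2) \<and>
          diffeo_on V W \<Psi> \<and> V \<subseteq> snd d ` fst d \<and>
          (\<forall>x\<in>S. f (param c x) \<in> fst d \<and> snd d (f (param c x)) \<in> V \<and>
             \<Psi> (snd d (f (param c x))) = standard_cuspidal_edge (\<phi> x))))"

text \<open>\<open>\<kappa>\<^sub>s\<close> does not depend on the choice of \<open>\<eta>\<close>, and only the value of the null vector field at \<open>t\<close>
  enters. If \<open>\<gamma> t\<close> is not a cuspidal edge, the value is meaningless.\<close>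

definition singular_curvature ::
  "('m, 2) chart set \<Rightarrow> ('n, 3) chart set \<Rightarrow> ('n, 3) metric \<Rightarrow> ('m \<Rightarrow> 'n) \<Rightarrow> ('m \<Rightarrow> ('n, 3) tvec)
    \<Rightarrow> (real \<Rightarrow> 'm) \<Rightarrow> real \<Rightarrow> real" where
  "singular_curvature M N g f \<nu> \<gamma> t = (let
     c = chart_at M (\<gamma> t);
     \<eta> = (SOME \<eta>. null_vector M N f (\<gamma> t) \<eta> \<and> det (vector [velocity M \<gamma> t c, \<eta> c] :: real^2^2) > 0);
     v = velocity N (f \<circ> \<gamma>);
     a = cov_deriv_along_curve N g (f \<circ> \<gamma>) v
   in sgn (d_area_density M N g f \<nu> (\<gamma> t) \<eta>) *
      (volume_form N g (f (\<gamma> t)) (v t) (a t) (\<nu> (\<gamma> t)) /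
       (sqrt (ginner N g (f (\<gamma> t)) (v t) (v t)))^3))"

text \<open>Matrices of the first and second fundamental forms with respect to the coordinate frame of the
  chart \<open>c\<close>; the shape operator \<open>A\<close>, determined by \<open>g(f\<^sub>*(A X), f\<^sub>*Y) = h(X, Y)\<close>, has matrix
  \<open>I\<inverse> II\<close> in this frame.\<close>

definition first_form_matrix ::
  "('m, 2) chart set \<Rightarrow> ('n, 3) chart set \<Rightarrow> ('n, 3) metric \<Rightarrow> ('m \<Rightarrow> 'n)
    \<Rightarrow> ('m, 2) chart \<Rightarrow> 'm \<Rightarrow> real^2^2" where
  "first_form_matrix M N g f c q = (\<chi> i j.
     ginner N g (f q) (pushforward M N f q (coord_vector M c i q))
       (pushforward M N f q (coord_vector M c j q)))"

definition second_form_matrix ::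
  "('m, 2) chart set \<Rightarrow> ('n, 3) chart set \<Rightarrow> ('n, 3) metric \<Rightarrow> ('m \<Rightarrow> 'n) \<Rightarrow> ('m \<Rightarrow> ('n, 3) tvec)
    \<Rightarrow> ('m, 2) chart \<Rightarrow> 'm \<Rightarrow> real^2^2" where
  "second_form_matrix M N g f \<nu> c q = (\<chi> i j.
     second_fundamental_form M N g f \<nu> q (coord_vector M c i q) (coord_vector M c j q))"

definition shape_operator_matrix ::
  "('m, 2) chart set \<Rightarrow> ('n, 3) chart set \<Rightarrow> ('n, 3) metric \<Rightarrow> ('m \<Rightarrow> 'n) \<Rightarrow> ('m \<Rightarrow> ('n, 3) tvec)
    \<Rightarrow> ('m, 2) chart \<Rightarrow> 'm \<Rightarrow> real^2^2" where
  "shape_operator_matrix M N g f \<nu> c q =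
     matrix_inv (first_form_matrix M N g f c q) ** second_form_matrix M N g f \<nu> c q"

text \<open>The following two functions are meaningful at regular points only.\<close>

definition K_ext ::
  "('m, 2) chart set \<Rightarrow> ('n, 3) chart set \<Rightarrow> ('n, 3) metric \<Rightarrow> ('m \<Rightarrow> 'n) \<Rightarrow> ('m \<Rightarrow> ('n, 3) tvec)
    \<Rightarrow> 'm \<Rightarrow> real" where
  "K_ext M N g f \<nu> q = det (shape_operator_matrix M N g f \<nu> (chart_at M q) q)"

definition K_gauss ::
  "('m, 2) chart set \<Rightarrow> ('n, 3) chart set \<Rightarrow> ('n, 3) metric \<Rightarrow> ('m \<Rightarrow> 'n) \<Rightarrow> 'm \<Rightarrow> real" where
  "K_gauss M N g f q = (let c = chart_at M q in
     gauss_curvature (\<lambda>x. first_form_matrix M N g f c (param c x)) (snd c q))"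

end

theory Submission
  imports Defs
begin

text \<open>Away from singular points the Gauss equation gives \<open>K - K_ext = c_N\<close>, which is locally bounded (and
  zero in flat space), and \<open>K_ext = D / lam\<^sup>2\<close> with \<open>D\<close> the determinant of the second fundamental form \<open>II\<close>.
  Both \<open>D\<close> and \<open>lam\<close> are smooth and vanish at singular points. Let \<open>\<eta>\<close> be a null vector at a
  non-degenerate singular point \<open>p\<close> and \<open>w = D\<^sub>\<eta> \<nu>\<close>, which is nonzero because \<open>(f, \<nu>)\<close> is an immersion.
  The differential of \<open>D\<close> at \<open>p\<close> is a nonzero multiple of that of \<open>lam\<close> unless \<open>II\<close> vanishes at \<open>p\<close>.
  A lower bound \<open>D \<ge> \<delta> lam\<^sup>2\<close> near \<open>p\<close>, with \<open>\<delta>\<close> of any sign, makes the differential of \<open>D\<close> vanish,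
  hence \<open>II = 0\<close> at \<open>p\<close>; conversely, if \<open>II = 0\<close> along the singular curve then \<open>II\<close> is
  \<open>O(lam)\<close> and \<open>D\<close> is \<open>O(lam\<^sup>2)\<close>. Finally, if \<open>II = 0\<close> at a cuspidal edge, then up to a negative factor the singular
  curvature times \<open>|d lam(\<eta>)|\<close> is the product of the diagonal entries of \<open>D\<^sub>\<eta> II\<close> in the basis
  \<open>(\<gamma>', \<eta>)\<close>, and the lower bound for \<open>D\<close>, compared to second order in the direction \<open>\<eta>\<close>, bounds the determinant
  of \<open>D\<^sub>\<eta> II\<close> below by a positive multiple of \<open>\<delta>\<close>.\<close>

section \<open>Smooth functions\<close>

text \<open>Many quantities are evaluated in charts picked by \<open>chart_at\<close>, and the pick
  may change from point to point, so a statement on a neighbourhood cannot simply be read off in one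
  chart. Hence the analysis is done for maps between open sets of Euclidean spaces with an arbitrary
  metric field, and transformation laws carry it to the manifolds. The first fundamental form
  degenerates at singular points; multiplying curvatures by \<open>lam\<^sup>2\<close> = det
  \<open>E\<close> gives statements without denominators, so that \<open>D\<close> and
  \<open>lam\<close> can be compared across the singular set. What links these two is one pairing:
  at p the vectors \<open>dir \<xi> F p\<close>, \<open>w\<close>, \<open>n p\<close> form an
  orthogonal frame for \<xi> transversal to \<eta>, and both the differential of \<open>lam\<close>
  and that of II(\<eta>,\<eta>) are multiples of the inner product of \<open>w\<close> with the
  covariant derivative of \<open>dir \<eta> F\<close>.\<close>

abbreviation dir :: "'a::real_normed_vector \<Rightarrow> ('a \<Rightarrow> 'b::real_normed_vector) \<Rightarrow> 'a \<Rightarrow> 'b" where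
  "dir v F x \<equiv> frechet_derivative F (at x) v"

lemma Ck_on_Suc_open:
  assumes "open S"
  shows "Ck_on (Suc k) S F \<longleftrightarrow> (\<forall>x\<in>S. F differentiable (at x)) \<and> (\<forall>v. Ck_on k S (dir v F))"
  using assms by (simp add: differentiable_on_def at_within_open[OF _ assms] cong: ball_cong)

lemma Ck_on_cong:
  assumes "open S" "\<And>x. x \<in> S \<Longrightarrow> F x = H x"
  shows "Ck_on k S F \<longleftrightarrow> Ck_on k S H"
  using assms(2)
proof (induction k arbitrary: F H)
  case 0
  then show ?case by (simp cong: continuous_on_cong)
next
  case (Suc k)
  have d: "F differentiable (at x) \<longleftrightarrow> H differentiable (at x)" if "x \<in> S" for x
    using has_derivative_transform_within_open[OF _ assms(1) that] Suc.prems
    unfolding differentiable_def by metis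
  have e: "Ck_on k S (dir v F) \<longleftrightarrow> Ck_on k S (dir v H)" if D: "\<forall>x\<in>S. F differentiable (at x)" for v
  proof (rule Suc.IH)
    fix x assume x: "x \<in> S"
    have "frechet_derivative F (at x) = frechet_derivative H (at x)"
      by (rule frechet_derivative_transform_within_open[OF _ assms(1) x]) (use D x Suc.prems in auto)
    then show "dir v F x = dir v H x" by simp
  qed
  show ?case
    unfolding Ck_on_Suc_open[OF assms(1)] using d e by meson
qed

text \<open>\<open>Ck_on (Suc k)\<close> does not mention \<open>Ck_on k\<close>, so the classes are
  nested only by induction; the bottom step is that differentiability gives continuity.\<close>

lemma Ck_on_Suc_imp:
  assumes "open S" "Ck_on (Suc k) S F"
  shows "Ck_on k S F"
  using assms(2)
proof (induction k arbitrary: F)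
  case 0
  then show ?case
    unfolding Ck_on.simps by (elim conjE) (rule differentiable_imp_continuous_on)
next
  case (Suc k)
  have "F differentiable_on S" "\<And>v. Ck_on (Suc k) S (dir v F)"
    using Suc.prems unfolding Ck_on.simps(2)[of "Suc k"] by simp_all
  then show ?case unfolding Ck_on.simps(2)[of k] using Suc.IH by simp
qed

lemma Ck_on_subset:
  assumes "Ck_on k S F" "T \<subseteq> S"
  shows "Ck_on k T F"
  using assms
proof (induction k arbitrary: F)
  case 0
  then show ?case by (auto intro: continuous_on_subset)
next
  case (Suc k)
  have "F differentiable_on S" "\<And>v. Ck_on k S (dir v F)"
    using Suc.prems unfolding Ck_on.simps(2)[of "k"] by simp_all
  then show ?case
    unfolding Ck_on.simps(2)[of k] using Suc.IH Suc.prems(2) by (meson differentiable_on_subset)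
qed

lemma Ck_on_const: "open S \<Longrightarrow> Ck_on k S (\<lambda>x. c)"
proof (induction k arbitrary: c)
  case (Suc k)
  then show ?case unfolding Ck_on.simps(2) by simp
qed simp

lemma dir_eqI: "(F has_derivative F') (at x) \<Longrightarrow> dir v F x = F' v"
  using frechet_derivative_at[of F F' x] by simp

lemma dir_bounded_linear: "bounded_linear L \<Longrightarrow> F differentiable (at x) \<Longrightarrow> dir v (\<lambda>x. L (F x)) x = L (dir v F x)"
  by (rule dir_eqI) (simp add: bounded_linear.has_derivative frechet_derivative_works)

lemma dir_bilinear:
  assumes "bounded_bilinear B" "F differentiable (at x)" "H differentiable (at x)"
  shows "dir v (\<lambda>x. B (F x) (H x)) x = B (F x) (dir v H x) + B (dir v F x) (H x)"
  by (rule dir_eqI[OF bounded_bilinear.FDERIV[OF assms(1) assms(2,3)[unfolded frechet_derivative_works]]])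

lemma dir_add:
  assumes "F differentiable (at x)" "H differentiable (at x)"
  shows "dir v (\<lambda>x. F x + H x) x = dir v F x + dir v H x"
  by (rule dir_eqI[OF has_derivative_add[OF assms[unfolded frechet_derivative_works]]])

lemma dir_diff:
  assumes "F differentiable (at x)" "H differentiable (at x)"
  shows "dir v (\<lambda>x. F x - H x) x = dir v F x - dir v H x"
  by (rule dir_eqI[OF has_derivative_diff[OF assms[unfolded frechet_derivative_works]]])

lemma dir_uminus:
  assumes "F differentiable (at x)"
  shows "dir v (\<lambda>x. - F x) x = - dir v F x"
  using dir_bounded_linear[OF bounded_linear_minus[OF bounded_linear_ident] assms] by simp

lemma dir_sum:
  assumes "\<And>i. i \<in> A \<Longrightarrow> F i differentiable (at x)"
  shows "dir v (\<lambda>x. \<Sum>i\<in>A. F i x) x = (\<Sum>i\<in>A. dir v (F i) x)"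
  by (rule dir_eqI) (use assms in \<open>auto intro!: has_derivative_sum simp: frechet_derivative_works\<close>)

lemma dir_linear: "F differentiable (at x) \<Longrightarrow> linear (\<lambda>v. dir v F x)"
  using linear_frechet_derivative by blast

lemma dir_plus: "F differentiable (at x) \<Longrightarrow> dir (a + b) F x = dir a F x + dir b F x"
  and dir_scale: "F differentiable (at x) \<Longrightarrow> dir (r *\<^sub>R a) F x = r *\<^sub>R dir a F x"
  and dir_neg: "F differentiable (at x) \<Longrightarrow> dir (- a) F x = - dir a F x"
  and dir_zero: "F differentiable (at x) \<Longrightarrow> dir 0 F x = 0"
  using linear_add[OF linear_frechet_derivative] linear_cmul[OF linear_frechet_derivative]
    linear_neg[OF linear_frechet_derivative] linear_0[OF linear_frechet_derivative] by blast+

lemma dir_cong_open: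
  assumes "open S" "x \<in> S" "\<And>y. y \<in> S \<Longrightarrow> F y = H y" "F differentiable (at x)"
  shows "dir v F x = dir v H x"
  using frechet_derivative_transform_within_open[OF assms(4,1,2)] assms(3) by metis

lemma differentiable_cong_open:
  assumes "open S" "x \<in> S" "\<And>y. y \<in> S \<Longrightarrow> F y = H y" "F differentiable (at x)"
  shows "H differentiable (at x)"
  using has_derivative_transform_within_open[OF _ assms(1,2)] assms(3,4)
  unfolding differentiable_def by metis

lemma dir_compose:
  assumes "F differentiable (at x)" "H differentiable (at (F x))"
  shows "dir v (\<lambda>x. H (F x)) x = dir (dir v F x) H (F x)"
  using frechet_derivative_compose[OF assms] by (simp add: comp_def fun_eq_iff)

lemma Ck_on_SucD:
  assumes "open S" "Ck_on (Suc k) S F"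
  shows "\<And>x. x \<in> S \<Longrightarrow> F differentiable (at x)" "\<And>v. Ck_on k S (dir v F)" "Ck_on k S F"
  using assms Ck_on_Suc_imp[OF assms] unfolding Ck_on_Suc_open[OF assms(1)] by simp_all

text \<open>Nothing is known about \<open>dir v F\<close> outside \<open>S\<close>, so a closed
  formula for it can be demanded only on \<open>S\<close>; \<open>Ck_on_cong\<close> transfers the
  regularity of the formula.\<close>

lemma Ck_on_SucI:
  assumes "open S" "\<And>x. x \<in> S \<Longrightarrow> F differentiable (at x)" "\<And>v. Ck_on k S (F' v)"
    "\<And>x v. x \<in> S \<Longrightarrow> dir v F x = F' v x"
  shows "Ck_on (Suc k) S F"
proof -
  have "Ck_on k S (dir v F)" for v
    using assms(3)[of v] Ck_on_cong[OF assms(1), of "dir v F" "F' v"] assms(4) by simp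
  then show ?thesis unfolding Ck_on_Suc_open[OF assms(1)] using assms(2) by simp
qed

section \<open>Closure of the classes C^k under algebraic operations and composition\<close>

lemma Ck_on_add:
  assumes "open S" "Ck_on k S F" "Ck_on k S H"
  shows "Ck_on k S (\<lambda>x. F x + H x)"
  using assms(2,3)
proof (induction k arbitrary: F H)
  case 0
  then show ?case by (simp add: continuous_on_add)
next
  case (Suc k)
  note F = Ck_on_SucD[OF assms(1) Suc.prems(1)] and H = Ck_on_SucD[OF assms(1) Suc.prems(2)]
  show ?case
    by (rule Ck_on_SucI[OF assms(1), where F'="\<lambda>v x. dir v F x + dir v H x"])
       (simp_all add: F H Suc.IH dir_add)
qed

lemma Ck_on_sum:
  assumes "open S" "\<And>i. i \<in> A \<Longrightarrow> Ck_on k S (F i)"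
  shows "Ck_on k S (\<lambda>x. \<Sum>i\<in>A. F i x)"
  using assms(2)
proof (induction A rule: infinite_finite_induct)
  case (insert i A)
  then show ?case by (simp add: Ck_on_add[OF assms(1)])
qed (simp_all add: Ck_on_const[OF assms(1)])

lemma Ck_on_linear:
  assumes "open S" "bounded_linear L" "Ck_on k S F"
  shows "Ck_on k S (\<lambda>x. L (F x))"
  using assms(3)
proof (induction k arbitrary: F)
  case 0
  then show ?case by (simp add: bounded_linear.continuous_on[OF assms(2)])
next
  case (Suc k)
  note F = Ck_on_SucD[OF assms(1) Suc.prems(1)]
  have "(\<lambda>x. L (F x)) differentiable (at x)" if "x \<in> S" for x
    using bounded_linear.has_derivative[OF assms(2)] F(1)[OF that] unfolding differentiable_def by blast
  then show ?case
    by (intro Ck_on_SucI[OF assms(1), where F'="\<lambda>v x. L (dir v F x)"])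
       (simp_all add: F Suc.IH dir_bounded_linear[OF assms(2)])
qed

lemma Ck_on_bilinear:
  assumes "open S" "bounded_bilinear B" "Ck_on k S F" "Ck_on k S H"
  shows "Ck_on k S (\<lambda>x. B (F x) (H x))"
  using assms(3,4)
proof (induction k arbitrary: F H)
  case 0
  then show ?case by (simp add: bounded_bilinear.continuous_on[OF assms(2)])
next
  case (Suc k)
  note F = Ck_on_SucD[OF assms(1) Suc.prems(1)] and H = Ck_on_SucD[OF assms(1) Suc.prems(2)]
  have "(\<lambda>x. B (F x) (H x)) differentiable (at x)" if "x \<in> S" for x
    using bounded_bilinear.FDERIV[OF assms(2)] F(1)[OF that] H(1)[OF that]
    unfolding differentiable_def by blast
  then show ?case
    by (intro Ck_on_SucI[OF assms(1), where F'="\<lambda>v x. B (F x) (dir v H x) + B (dir v F x) (H x)"])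
       (simp_all add: F H Suc.IH Ck_on_add[OF assms(1)] dir_bilinear[OF assms(2)])
qed

lemma dir_expand:
  fixes H :: "'b::euclidean_space \<Rightarrow> 'c::real_normed_vector"
  assumes "H differentiable (at y)"
  shows "dir w H y = (\<Sum>i\<in>Basis. (w \<bullet> i) *\<^sub>R dir i H y)"
proof -
  have l: "linear (\<lambda>w. dir w H y)" using dir_linear assms by blast
  have "dir w H y = dir (\<Sum>i\<in>Basis. (w \<bullet> i) *\<^sub>R i) H y"
    by (simp add: euclidean_representation)
  also have "\<dots> = (\<Sum>i\<in>Basis. (w \<bullet> i) *\<^sub>R dir i H y)"
    using linear_sum[OF l, of "\<lambda>i. (w \<bullet> i) *\<^sub>R i" Basis] linear_cmul[OF l] by simp
  finally show ?thesis .
qed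

text \<open>In the chain rule the direction \<open>dir v F x\<close> in which \<open>H\<close> is
  differentiated moves with x. Expanding it in \<open>Basis\<close> leaves only derivatives of
  \<open>H\<close> in fixed directions, to which the induction hypothesis applies; this is why the
  middle space is Euclidean.\<close>

lemma Ck_on_compose:
  fixes F :: "'a::real_normed_vector \<Rightarrow> 'b::euclidean_space" and H :: "'b \<Rightarrow> 'c::real_normed_vector"
  assumes "open S" "open T" "F ` S \<subseteq> T" "Ck_on k S F" "Ck_on k T H"
  shows "Ck_on k S (\<lambda>x. H (F x))"
  using assms(4,5)
proof (induction k arbitrary: H)
  case 0
  then show ?case using assms(3) by (simp add: continuous_on_compose2)
next
  case (Suc k)
  note F = Ck_on_SucD[OF assms(1) Suc.prems(1)] and H = Ck_on_SucD[OF assms(2) Suc.prems(2)]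
  have dH: "H differentiable (at (F x))" if "x \<in> S" for x using H(1) assms(3) that by blast
  have "(\<lambda>x. H (F x)) differentiable (at x)" if "x \<in> S" for x
    using differentiable_compose[of H F x UNIV] F(1) dH that by simp
  moreover have "Ck_on k S (\<lambda>x. \<Sum>i\<in>Basis. (dir v F x \<bullet> i) *\<^sub>R dir i H (F x))" for v
  proof (rule Ck_on_sum[OF assms(1)])
    fix i :: 'b
    show "Ck_on k S (\<lambda>x. (dir v F x \<bullet> i) *\<^sub>R dir i H (F x))"
      by (rule Ck_on_bilinear[OF assms(1) bounded_bilinear_scaleR
            Ck_on_linear[OF assms(1) bounded_linear_inner_left F(2)] Suc.IH[OF F(3) H(2)]])
  qed
  moreover have "dir v (\<lambda>x. H (F x)) x = (\<Sum>i\<in>Basis. (dir v F x \<bullet> i) *\<^sub>R dir i H (F x))" if "x \<in> S" for x v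
    by (rule trans[OF dir_compose[OF F(1)[OF that] dH[OF that]] dir_expand[OF dH[OF that]]])
  ultimately show ?case
    by (rule Ck_on_SucI[OF assms(1), where F'="\<lambda>v x. \<Sum>i\<in>Basis. (dir v F x \<bullet> i) *\<^sub>R dir i H (F x)"])
qed

text \<open>The derivative is a product of \<open>dir v F\<close> with two factors
  \<open>inverse (F x)\<close>, so the induction feeds on the function itself, one order
  lower.\<close>

lemma Ck_on_inverse:
  fixes F :: "'a::real_normed_vector \<Rightarrow> real"
  assumes "open S" "\<And>x. x \<in> S \<Longrightarrow> F x \<noteq> 0" "Ck_on k S F"
  shows "Ck_on k S (\<lambda>x. inverse (F x))"
  using assms(3)
proof (induction k)
  case 0
  then show ?case using assms(2) by (simp add: continuous_on_inverse)
next
  case (Suc k)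
  note F = Ck_on_SucD[OF assms(1) Suc.prems(1)]
  have h: "((\<lambda>x. inverse (F x)) has_derivative (\<lambda>h. - (inverse (F x) * dir h F x * inverse (F x)))) (at x)" if "x \<in> S" for x
    using Deriv.has_derivative_inverse[OF assms(2)[OF that] F(1)[OF that, unfolded frechet_derivative_works]] .
  have i: "Ck_on k S (\<lambda>x. inverse (F x))" using Suc.IH F(3) by blast
  have "(\<lambda>x. inverse (F x)) differentiable (at x)" if "x \<in> S" for x
    using h[OF that] unfolding differentiable_def by blast
  moreover have "Ck_on k S (\<lambda>x. - (inverse (F x) * dir v F x * inverse (F x)))" for v
    using Ck_on_linear[OF assms(1) bounded_linear_minus[OF bounded_linear_ident]
      Ck_on_bilinear[OF assms(1) bounded_bilinear_mult Ck_on_bilinear[OF assms(1) bounded_bilinear_mult i F(2)] i]] .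
  moreover have "dir v (\<lambda>x. inverse (F x)) x = - (inverse (F x) * dir v F x * inverse (F x))" if "x \<in> S" for x v
    by (rule dir_eqI[OF h[OF that]])
  ultimately show ?case
    by (rule Ck_on_SucI[OF assms(1), where F'="\<lambda>v x. - (inverse (F x) * dir v F x * inverse (F x))"])
qed

lemma Ck_on_sqrt:
  fixes F :: "'a::real_normed_vector \<Rightarrow> real"
  assumes "open S" "\<And>x. x \<in> S \<Longrightarrow> F x > 0" "Ck_on k S F"
  shows "Ck_on k S (\<lambda>x. sqrt (F x))"
  using assms(3)
proof (induction k)
  case 0
  then show ?case by (simp add: continuous_on_real_sqrt)
next
  case (Suc k)
  note F = Ck_on_SucD[OF assms(1) Suc.prems(1)]
  have h: "((\<lambda>x. sqrt (F x)) has_derivative (\<lambda>h. dir h F x * (inverse (sqrt (F x)) * (1/2)))) (at x)" if "x \<in> S" for x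
    using has_derivative_compose[OF F(1)[OF that, unfolded frechet_derivative_works]
        DERIV_real_sqrt[OF assms(2)[OF that], unfolded has_field_derivative_def]]
    by (simp add: field_simps)
  have i: "Ck_on k S (\<lambda>x. inverse (sqrt (F x)))"
    using assms(2) by (intro Ck_on_inverse[OF assms(1)] Suc.IH F(3)) force
  have "(\<lambda>x. sqrt (F x)) differentiable (at x)" if "x \<in> S" for x
    using h[OF that] unfolding differentiable_def by blast
  moreover have "Ck_on k S (\<lambda>x. dir v F x * (inverse (sqrt (F x)) * (1/2)))" for v
    by (rule Ck_on_bilinear[OF assms(1) bounded_bilinear_mult F(2)
        Ck_on_bilinear[OF assms(1) bounded_bilinear_mult i Ck_on_const[OF assms(1)]]])
  moreover have "dir v (\<lambda>x. sqrt (F x)) x = dir v F x * (inverse (sqrt (F x)) * (1/2))" if "x \<in> S" for x v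
    by (rule dir_eqI[OF h[OF that]])
  ultimately show ?case
    by (rule Ck_on_SucI[OF assms(1), where F'="\<lambda>v x. dir v F x * (inverse (sqrt (F x)) * (1/2))"])
qed

section \<open>Smooth scalar, vector and matrix functions\<close>

lemma smooth_on_cong: "open S \<Longrightarrow> (\<And>x. x \<in> S \<Longrightarrow> F x = H x) \<Longrightarrow> smooth_on S F \<longleftrightarrow> smooth_on S H"
  unfolding smooth_on_def using Ck_on_cong[of S F H] by simp

lemma smooth_on_subset: "smooth_on S F \<Longrightarrow> T \<subseteq> S \<Longrightarrow> smooth_on T F"
  unfolding smooth_on_def by (blast intro: Ck_on_subset)

lemma smooth_on_differentiable: "smooth_on S F \<Longrightarrow> open S \<Longrightarrow> x \<in> S \<Longrightarrow> F differentiable (at x)"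
  unfolding smooth_on_def using Ck_on_SucD(1)[of S 0 F x] by simp

lemma smooth_on_dir: "smooth_on S F \<Longrightarrow> open S \<Longrightarrow> smooth_on S (dir v F)"
  by (simp add: smooth_on_def Ck_on_SucD[of S _ F])

lemma smooth_on_continuous: "smooth_on S F \<Longrightarrow> continuous_on S F"
  unfolding smooth_on_def by (drule spec[of _ 0]) simp

lemma smooth_on_const: "open S \<Longrightarrow> smooth_on S (\<lambda>x. c)"
  by (simp add: smooth_on_def Ck_on_const)

lemma smooth_on_add: "open S \<Longrightarrow> smooth_on S F \<Longrightarrow> smooth_on S H \<Longrightarrow> smooth_on S (\<lambda>x. F x + H x)"
  by (simp add: smooth_on_def Ck_on_add)

lemma smooth_on_sum: "open S \<Longrightarrow> (\<And>i. i \<in> A \<Longrightarrow> smooth_on S (F i)) \<Longrightarrow> smooth_on S (\<lambda>x. \<Sum>i\<in>A. F i x)"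
  by (simp add: smooth_on_def Ck_on_sum)

lemma smooth_on_linear: "open S \<Longrightarrow> bounded_linear L \<Longrightarrow> smooth_on S F \<Longrightarrow> smooth_on S (\<lambda>x. L (F x))"
  by (simp add: smooth_on_def Ck_on_linear)

lemma smooth_on_ident: "open S \<Longrightarrow> smooth_on S (\<lambda>x. x)"
proof -
  assume S: "open S"
  have "Ck_on k S (\<lambda>x. x)" for k
  proof (cases k)
    case (Suc j)
    show ?thesis unfolding Suc
      by (rule Ck_on_SucI[OF S, where F'="\<lambda>v x. v"]) (simp_all add: Ck_on_const[OF S])
  qed simp
  then show ?thesis by (simp add: smooth_on_def)
qed

lemma smooth_on_minus: "open S \<Longrightarrow> smooth_on S F \<Longrightarrow> smooth_on S (\<lambda>x. - F x)"
  by (rule smooth_on_linear[OF _ bounded_linear_minus[OF bounded_linear_ident]])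

lemma smooth_on_diff: "open S \<Longrightarrow> smooth_on S F \<Longrightarrow> smooth_on S H \<Longrightarrow> smooth_on S (\<lambda>x. F x - H x)"
  using smooth_on_add[of S F "\<lambda>x. - H x"] smooth_on_minus[of S H] by simp

lemma smooth_on_bilinear: "open S \<Longrightarrow> bounded_bilinear B \<Longrightarrow> smooth_on S F \<Longrightarrow> smooth_on S H \<Longrightarrow> smooth_on S (\<lambda>x. B (F x) (H x))"
  by (simp add: smooth_on_def Ck_on_bilinear)

lemmas smooth_on_mult = smooth_on_bilinear[OF _ bounded_bilinear_mult]
lemmas smooth_on_scaleR = smooth_on_bilinear[OF _ bounded_bilinear_scaleR]
lemmas smooth_on_inner = smooth_on_bilinear[OF _ bounded_bilinear_inner]

lemma smooth_on_compose:
  fixes F :: "'a::real_normed_vector \<Rightarrow> 'b::euclidean_space" and H :: "'b \<Rightarrow> 'c::real_normed_vector"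
  shows "open S \<Longrightarrow> open T \<Longrightarrow> F ` S \<subseteq> T \<Longrightarrow> smooth_on S F \<Longrightarrow> smooth_on T H \<Longrightarrow> smooth_on S (\<lambda>x. H (F x))"
  by (simp add: smooth_on_def Ck_on_compose[of S T F _ H])

lemma smooth_on_inverse:
  fixes F :: "'a::real_normed_vector \<Rightarrow> real"
  shows "open S \<Longrightarrow> (\<And>x. x \<in> S \<Longrightarrow> F x \<noteq> 0) \<Longrightarrow> smooth_on S F \<Longrightarrow> smooth_on S (\<lambda>x. inverse (F x))"
  by (simp add: smooth_on_def Ck_on_inverse[of S F])

lemma smooth_on_sqrt:
  fixes F :: "'a::real_normed_vector \<Rightarrow> real"
  shows "open S \<Longrightarrow> (\<And>x. x \<in> S \<Longrightarrow> F x > 0) \<Longrightarrow> smooth_on S F \<Longrightarrow> smooth_on S (\<lambda>x. sqrt (F x))"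
  by (simp add: smooth_on_def Ck_on_sqrt[of S F])

lemma smooth_on_divide:
  fixes F H :: "'a::real_normed_vector \<Rightarrow> real"
  shows "open S \<Longrightarrow> (\<And>x. x \<in> S \<Longrightarrow> H x \<noteq> 0) \<Longrightarrow> smooth_on S F \<Longrightarrow> smooth_on S H \<Longrightarrow> smooth_on S (\<lambda>x. F x / H x)"
  using smooth_on_mult[of S F "\<lambda>x. inverse (H x)"] smooth_on_inverse[of S H] by (simp add: divide_inverse)

lemma smooth_on_prod:
  fixes F :: "'i \<Rightarrow> 'a::real_normed_vector \<Rightarrow> real"
  assumes "open S" "\<And>i. i \<in> A \<Longrightarrow> smooth_on S (F i)"
  shows "smooth_on S (\<lambda>x. \<Prod>i\<in>A. F i x)"
  using assms(2)
proof (induction A rule: infinite_finite_induct)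
  case (insert i A)
  then show ?case by (auto intro: smooth_on_mult[OF assms(1)])
qed (auto intro: smooth_on_const[OF assms(1)])

lemma smooth_on_nth: "open S \<Longrightarrow> smooth_on S F \<Longrightarrow> smooth_on S (\<lambda>x. F x $ i)"
  by (rule smooth_on_linear[OF _ bounded_linear_vec_nth])

lemma smooth_on_vec:
  fixes F :: "'a::real_normed_vector \<Rightarrow> 'b::real_normed_vector ^ 'n::finite"
  assumes "open S" "\<And>i. smooth_on S (\<lambda>x. F x $ i)"
  shows "smooth_on S F"
proof -
  have b: "bounded_linear (\<lambda>y::'b. (\<chi> j. if j = i then y else 0) :: 'b^'n)" for i
  proof (rule bounded_linear_intro[where K=1])
    show "norm ((\<chi> j. if j = i then y else 0) :: 'b^'n) \<le> norm y * 1" for y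
      unfolding norm_vec_def L2_set_def
      by (simp add: if_distrib[of norm] if_distrib[of "\<lambda>x. x^2"] sum.delta cong: if_cong)
  qed (auto simp: vec_eq_iff)
  have "smooth_on S (\<lambda>x. \<Sum>i\<in>UNIV. (\<chi> j. if j = i then F x $ i else 0) :: 'b^'n)"
    by (intro smooth_on_sum[OF assms(1)] smooth_on_linear[OF assms(1) b] assms(2))
  moreover have "(\<Sum>i\<in>UNIV. (\<chi> j. if j = i then F x $ i else 0) :: 'b^'n) = F x" for x
    by (simp add: vec_eq_iff sum.delta)
  ultimately show ?thesis by simp
qed

lemma smooth_on_matrix_vector:
  fixes A :: "'a::real_normed_vector \<Rightarrow> real^'n^'m"
  assumes "open S" "smooth_on S A" "smooth_on S v"
  shows "smooth_on S (\<lambda>x. A x *v v x)"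
  by (rule smooth_on_vec[OF assms(1)])
     (simp add: matrix_vector_mult_def, intro smooth_on_sum smooth_on_mult smooth_on_nth assms)

lemma smooth_on_det:
  fixes A :: "'a::real_normed_vector \<Rightarrow> real^'n^'n"
  assumes "open S" "smooth_on S A"
  shows "smooth_on S (\<lambda>x. det (A x))"
  unfolding det_def by (intro smooth_on_sum smooth_on_mult smooth_on_prod smooth_on_const smooth_on_nth assms)

lemma matrix_inv_right:
  fixes A :: "real^'n^'n"
  assumes "det A \<noteq> 0"
  shows "A ** matrix_inv A = mat 1"
  using assms[folded invertible_det_nz] unfolding invertible_def matrix_inv_def by (rule someI2_ex) simp

text \<open>Cramer's rule, applied to column l of the inverse. It exhibits the entries of the
  inverse as quotients of polynomials in the entries of \<open>A\<close>, from which the smoothness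
  of the Christoffel symbols follows.\<close>

lemma matrix_inv_nth:
  fixes A :: "real^'n^'n"
  assumes "det A \<noteq> 0"
  shows "matrix_inv A $ k $ l = det (\<chi> i j. if j = k then axis l 1 $ i else A $ i $ j) / det A"
proof -
  have inv: "A ** matrix_inv A = mat 1"
    using assms invertible_det_nz[of A] matrix_inv_right by blast
  have "A *v column l (matrix_inv A) = column l (A ** matrix_inv A)"
    by (simp add: vec_eq_iff column_def matrix_matrix_mult_def matrix_vector_mult_def)
  also have "\<dots> = axis l 1"
    by (simp add: inv vec_eq_iff column_def mat_def axis_def)
  finally have "column l (matrix_inv A) = (\<chi> k. det (\<chi> i j. if j = k then axis l 1 $ i else A $ i $ j) / det A)"
    by (rule iffD1[OF cramer[OF assms]])
  then have "column l (matrix_inv A) $ k = (\<chi> k. det (\<chi> i j. if j = k then axis l 1 $ i else A $ i $ j) / det A) $ k"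
    by (rule arg_cong)
  then show ?thesis by (simp only: column_def vec_lambda_beta)
qed

lemma smooth_on_matrix_inv:
  fixes A :: "'a::real_normed_vector \<Rightarrow> real^'n^'n"
  assumes "open S" "smooth_on S A" "\<And>x. x \<in> S \<Longrightarrow> det (A x) \<noteq> 0"
  shows "smooth_on S (\<lambda>x. matrix_inv (A x))"
proof (intro smooth_on_vec[OF assms(1)])
  fix k l
  have e: "smooth_on S (\<lambda>x. (\<chi> i j. if j = k then axis l 1 $ i else A x $ i $ j) $ i $ j)" for i j
    by (cases "j = k") (simp_all add: smooth_on_const[OF assms(1)] smooth_on_nth[OF assms(1)] assms(2))
  have "smooth_on S (\<lambda>x. det (\<chi> i j. if j = k then axis l 1 $ i else A x $ i $ j) / det (A x))"
    by (intro smooth_on_divide[OF assms(1)] smooth_on_det[OF assms(1)] assms smooth_on_vec[OF assms(1)] e)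
  then show "smooth_on S (\<lambda>x. matrix_inv (A x) $ k $ l)"
    by (subst smooth_on_cong[OF assms(1)]) (simp_all add: matrix_inv_nth assms(3))
qed

section \<open>Symmetry of second derivatives\<close>

lemma second_difference_mvt:
  fixes F :: "'a::real_normed_vector \<Rightarrow> real"
  assumes S: "open S" "smooth_on S F" and h: "0 < h"
    and in': "\<And>s t. 0 \<le> s \<Longrightarrow> s \<le> h \<Longrightarrow> 0 \<le> t \<Longrightarrow> t \<le> h \<Longrightarrow> x + s *\<^sub>R v + t *\<^sub>R w \<in> S"
  shows "\<exists>s t. 0 < s \<and> s < h \<and> 0 < t \<and> t < h \<and>
      F (x + h *\<^sub>R v + h *\<^sub>R w) - F (x + h *\<^sub>R v) - F (x + h *\<^sub>R w) + F x = h * h * dir w (dir v F) (x + s *\<^sub>R v + t *\<^sub>R w)"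
proof -
  have D: "(H has_derivative frechet_derivative H (at y)) (at y)" if "smooth_on S H" "y \<in> S" for H :: "'a \<Rightarrow> real" and y
    using smooth_on_differentiable[OF that(1) S(1) that(2)] by (simp add: frechet_derivative_works)
  have l: "((\<lambda>s. H (y + s *\<^sub>R u)) has_field_derivative dir u H (y + s *\<^sub>R u)) (at s)"
    if "smooth_on S H" "y + s *\<^sub>R u \<in> S" for H :: "'a \<Rightarrow> real" and y u s
  proof -
    have "((\<lambda>s. y + s *\<^sub>R u) has_derivative (\<lambda>r. r *\<^sub>R u)) (at s)"
      by (auto intro!: derivative_eq_intros)
    from diff_chain_at[OF this D[OF that]]
    have "((\<lambda>s. H (y + s *\<^sub>R u)) has_derivative (\<lambda>r. dir (r *\<^sub>R u) H (y + s *\<^sub>R u))) (at s)"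
      by (simp add: comp_def)
    moreover have "dir (r *\<^sub>R u) H (y + s *\<^sub>R u) = r * dir u H (y + s *\<^sub>R u)" for r
      using linear_cmul[OF linear_frechet_derivative[OF smooth_on_differentiable[OF that(1) S(1) that(2)]]] by simp
    moreover have "(\<lambda>r. dir (r *\<^sub>R u) H (y + s *\<^sub>R u)) = (*) (dir u H (y + s *\<^sub>R u))"
      using calculation(2) by (simp add: fun_eq_iff mult.commute)
    ultimately show ?thesis by (simp only: has_field_derivative_def)
  qed
  let ?p = "\<lambda>s. F ((x + h *\<^sub>R w) + s *\<^sub>R v) - F (x + s *\<^sub>R v)"
  have "\<exists>z>0. z < h \<and> ?p h - ?p 0 = (h - 0) * (dir v F ((x + h *\<^sub>R w) + z *\<^sub>R v) - dir v F (x + z *\<^sub>R v))"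
  proof (rule MVT2[OF h])
    fix s assume s: "0 \<le> s" "s \<le> h"
    have "(x + h *\<^sub>R w) + s *\<^sub>R v \<in> S" "x + s *\<^sub>R v \<in> S"
      using in'[OF s, of h] in'[OF s, of 0] h by (simp_all add: algebra_simps)
    then show "(?p has_field_derivative (dir v F ((x + h *\<^sub>R w) + s *\<^sub>R v) - dir v F (x + s *\<^sub>R v))) (at s)"
      by (intro DERIV_diff l S)
  qed
  then obtain s where s: "0 < s" "s < h"
    "?p h - ?p 0 = h * (dir v F ((x + h *\<^sub>R w) + s *\<^sub>R v) - dir v F (x + s *\<^sub>R v))" by auto
  let ?q = "\<lambda>t. dir v F ((x + s *\<^sub>R v) + t *\<^sub>R w)"
  have "\<exists>z>0. z < h \<and> ?q h - ?q 0 = (h - 0) * dir w (dir v F) ((x + s *\<^sub>R v) + z *\<^sub>R w)"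
  proof (rule MVT2[OF h])
    fix t assume t: "0 \<le> t" "t \<le> h"
    show "(?q has_field_derivative dir w (dir v F) ((x + s *\<^sub>R v) + t *\<^sub>R w)) (at t)"
      using in'[of s t] s t by (intro l smooth_on_dir S) simp
  qed
  then obtain t where t: "0 < t" "t < h" "?q h - ?q 0 = h * dir w (dir v F) ((x + s *\<^sub>R v) + t *\<^sub>R w)" by auto
  have "?p h - ?p 0 = h * (?q h - ?q 0)" using s(3) by (simp add: algebra_simps)
  then have "F (x + h *\<^sub>R v + h *\<^sub>R w) - F (x + h *\<^sub>R v) - F (x + h *\<^sub>R w) + F x = h * h * dir w (dir v F) (x + s *\<^sub>R v + t *\<^sub>R w)"
    using t(3) by (simp add: algebra_simps)
  then show ?thesis using s(1,2) t(1,2) by blast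
qed

text \<open>The second difference over the parallelogram spanned by h v and h w is symmetric in v
  and w. By \<open>second_difference_mvt\<close> it equals \<open>h * h\<close> times either mixed
  derivative, each taken at some point near x. If the two differed at x, continuity would keep them
  apart nearby.\<close>

lemma dir_commute_real:
  fixes F :: "'a::real_normed_vector \<Rightarrow> real"
  assumes "open S" "smooth_on S F" "x \<in> S"
  shows "dir v (dir w F) x = dir w (dir v F) x"
proof (rule ccontr)
  let ?A = "dir w (dir v F)" and ?B = "dir v (dir w F)"
  assume ne: "?B x \<noteq> ?A x"
  define e where "e = \<bar>?A x - ?B x\<bar> / 2"
  have e: "e > 0" using ne by (simp add: e_def)
  have c: "continuous_on S ?A" "continuous_on S ?B"
    using assms(1,2) by (simp_all add: smooth_on_continuous smooth_on_dir)
  obtain d1 where d1: "d1 > 0" "\<And>y. y \<in> S \<Longrightarrow> dist y x < d1 \<Longrightarrow> dist (?A y) (?A x) < e"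
    using c(1) assms(3) e unfolding continuous_on_iff by meson
  obtain d2 where d2: "d2 > 0" "\<And>y. y \<in> S \<Longrightarrow> dist y x < d2 \<Longrightarrow> dist (?B y) (?B x) < e"
    using c(2) assms(3) e unfolding continuous_on_iff by meson
  obtain d3 where d3: "d3 > 0" "ball x d3 \<subseteq> S" using assms(1,3) openE by blast
  define d where "d = min d1 (min d2 d3)"
  have d: "d > 0" using d1 d2 d3 by (simp add: d_def)
  \<comment> \<open>This h keeps all points x + s v + t w with s, t between 0 and h within distance
    d of x; the summand 1 makes the denominator positive even if v and w vanish.\<close>
  define h where "h = d / (2 * (norm v + norm w + 1))"
  have pos: "norm v + norm w + 1 > 0" by (smt (verit) norm_ge_zero)
  have h: "h > 0" using d pos by (simp add: h_def)
  have hd: "h * (norm v + norm w) < d"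
  proof -
    have "h * (norm v + norm w) \<le> h * (norm v + norm w + 1)" using h by simp
    also have "\<dots> = d / 2" using pos by (simp add: h_def divide_simps)
    finally show ?thesis using d by simp
  qed
  have near: "dist (x + s *\<^sub>R v + t *\<^sub>R w) x < d" if "0 \<le> s" "s \<le> h" "0 \<le> t" "t \<le> h" for s t
  proof -
    have "dist (x + s *\<^sub>R v + t *\<^sub>R w) x = norm (s *\<^sub>R v + t *\<^sub>R w)" by (simp add: dist_norm algebra_simps)
    also have "\<dots> \<le> s * norm v + t * norm w" using that norm_triangle_ineq[of "s *\<^sub>R v" "t *\<^sub>R w"] by simp
    also have "\<dots> \<le> h * norm v + h * norm w" using that by (intro add_mono mult_right_mono) auto
    also have "\<dots> < d" using hd by (simp add: algebra_simps)
    finally show ?thesis .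
  qed
  have inS: "x + s *\<^sub>R v + t *\<^sub>R w \<in> S" if "0 \<le> s" "s \<le> h" "0 \<le> t" "t \<le> h" for s t
    using near[OF that] d3 by (auto simp: d_def dist_commute)
  have inS': "x + s *\<^sub>R w + t *\<^sub>R v \<in> S" if "0 \<le> s" "s \<le> h" "0 \<le> t" "t \<le> h" for s t
    using inS[of t s] that by (simp add: algebra_simps)
  obtain s t where st: "0 < s" "s < h" "0 < t" "t < h"
    "F (x + h *\<^sub>R v + h *\<^sub>R w) - F (x + h *\<^sub>R v) - F (x + h *\<^sub>R w) + F x = h * h * ?A (x + s *\<^sub>R v + t *\<^sub>R w)"
    using second_difference_mvt[OF assms(1,2) h inS] by blast
  obtain s' t' where st': "0 < s'" "s' < h" "0 < t'" "t' < h"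
    "F (x + h *\<^sub>R w + h *\<^sub>R v) - F (x + h *\<^sub>R w) - F (x + h *\<^sub>R v) + F x = h * h * ?B (x + s' *\<^sub>R w + t' *\<^sub>R v)"
    using second_difference_mvt[OF assms(1,2) h inS'] by blast
  have "h * h * ?A (x + s *\<^sub>R v + t *\<^sub>R w) = h * h * ?B (x + t' *\<^sub>R v + s' *\<^sub>R w)"
    using st(5) st'(5) by (simp add: algebra_simps)
  then have eq: "?A (x + s *\<^sub>R v + t *\<^sub>R w) = ?B (x + t' *\<^sub>R v + s' *\<^sub>R w)" using h by simp
  have "dist (?A (x + s *\<^sub>R v + t *\<^sub>R w)) (?A x) < e"
    using st near[of s t] inS[of s t] by (intro d1) (auto simp: d_def)
  moreover have "dist (?B (x + t' *\<^sub>R v + s' *\<^sub>R w)) (?B x) < e"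
    using st' near[of t' s'] inS[of t' s'] by (intro d2) (auto simp: d_def)
  moreover have "\<bar>c - a\<bar> < \<bar>a - b\<bar> / 2 \<Longrightarrow> \<bar>c - b\<bar> < \<bar>a - b\<bar> / 2 \<Longrightarrow> False" for a b c :: real
    using abs_triangle_ineq4[of "c - b" "c - a"] by (simp add: algebra_simps)
  ultimately show False unfolding eq dist_real_def e_def by blast
qed

lemma dir_commute:
  fixes F :: "'a::real_normed_vector \<Rightarrow> 'b::euclidean_space"
  assumes "open S" "smooth_on S F" "x \<in> S"
  shows "dir v (dir w F) x = dir w (dir v F) x"
proof (rule euclidean_eqI)
  fix b :: 'b assume "b \<in> Basis"
  have s: "smooth_on S (\<lambda>x. F x \<bullet> b)" by (rule smooth_on_linear[OF assms(1) bounded_linear_inner_left[of b] assms(2)])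
  have d: "dir v (dir w (\<lambda>x. F x \<bullet> b)) x = dir v (dir w F) x \<bullet> b" for v w :: 'a
  proof -
    have "dir v (dir w (\<lambda>x. F x \<bullet> b)) x = dir v (\<lambda>x. dir w F x \<bullet> b) x"
    proof (rule dir_cong_open[OF assms(1,3), where F="dir w (\<lambda>x. F x \<bullet> b)" and H="\<lambda>x. dir w F x \<bullet> b"])
      show "dir w (\<lambda>x. F x \<bullet> b) y = dir w F y \<bullet> b" if "y \<in> S" for y
        by (rule dir_bounded_linear[OF bounded_linear_inner_left[of b] smooth_on_differentiable[OF assms(2,1) that], of w])
      show "dir w (\<lambda>x. F x \<bullet> b) differentiable at x"
        by (rule smooth_on_differentiable[OF smooth_on_dir[OF s assms(1)] assms(1,3)])
    qed
    also have "\<dots> = dir v (dir w F) x \<bullet> b"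
      by (rule dir_bounded_linear[OF bounded_linear_inner_left[of b] smooth_on_differentiable[OF smooth_on_dir[OF assms(2,1), of w] assms(1,3)], of v])
    finally show ?thesis .
  qed
  show "dir v (dir w F) x \<bullet> b = dir w (dir v F) x \<bullet> b"
    using dir_commute_real[OF assms(1) s assms(3), where v=v and w=w] unfolding d .
qed


section \<open>The Levi-Civita connection in coordinates\<close>

lemma bounded_bilinear_matrix_vector: "bounded_bilinear ((*v) :: real^'n^'m \<Rightarrow> real^'n \<Rightarrow> real^'m)"
  unfolding bilinear_conv_bounded_bilinear[symmetric] bilinear_def
  by (auto intro!: linearI simp: matrix_vector_mult_add_rdistrib matrix_vector_right_distrib
      matrix_vector_mult_scaleR scaleR_matrix_vector_assoc)

definition ip :: "(real^'e \<Rightarrow> real^'e^'e) \<Rightarrow> real^'e \<Rightarrow> real^'e \<Rightarrow> real^'e \<Rightarrow> real" where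
  "ip G y a b = a \<bullet> (G y *v b)"

definition Gam :: "(real^'e \<Rightarrow> real^'e^'e) \<Rightarrow> real^'e \<Rightarrow> real^'e \<Rightarrow> real^'e \<Rightarrow> real^'e" where
  "Gam G y v w = (\<chi> k. \<Sum>i\<in>UNIV. \<Sum>j\<in>UNIV. christoffel G y i j k * v $ i * w $ j)"

text \<open>R(a,b)w for constant coordinate fields a and b, whose bracket vanishes: the four terms
  are what D_a D_b w - D_b D_a w becomes when w is constant as well.\<close>

definition Rm :: "(real^'e \<Rightarrow> real^'e^'e) \<Rightarrow> real^'e \<Rightarrow> real^'e \<Rightarrow> real^'e \<Rightarrow> real^'e \<Rightarrow> real^'e" where
  "Rm G y a b w = dir a (\<lambda>z. Gam G z b w) y - dir b (\<lambda>z. Gam G z a w) y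
     + Gam G y a (Gam G y b w) - Gam G y b (Gam G y a w)"

lemma ip_add_left: "ip G y (a + b) c = ip G y a c + ip G y b c"
  and ip_add_right: "ip G y a (b + c) = ip G y a b + ip G y a c"
  and ip_diff_left: "ip G y (a - b) c = ip G y a c - ip G y b c"
  and ip_diff_right: "ip G y a (b - c) = ip G y a b - ip G y a c"
  and ip_scale_left: "ip G y (r *\<^sub>R a) b = r * ip G y a b"
  and ip_scale_right: "ip G y a (r *\<^sub>R b) = r * ip G y a b"
  and ip_zero_left: "ip G y 0 b = 0"
  and ip_zero_right: "ip G y a 0 = 0"
  by (simp_all add: ip_def inner_simps matrix_vector_mult_diff_distrib matrix_vector_right_distrib matrix_vector_mult_scaleR)

lemmas ip_simps = ip_add_left ip_add_right ip_diff_left ip_diff_right ip_scale_left ip_scale_right ip_zero_left ip_zero_right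

lemma Gam_expand: "Gam G y v w = (\<Sum>i\<in>UNIV. \<Sum>j\<in>UNIV. (v $ i * w $ j) *\<^sub>R (\<chi> k. christoffel G y i j k))"
  by (simp add: Gam_def vec_eq_iff mult_ac)

lemma bilinear_Gam: "bilinear (Gam G y)"
  unfolding bilinear_def
  by (auto intro!: linearI simp: Gam_def vec_eq_iff sum.distrib algebra_simps sum_distrib_left)

lemmas Gam_simps = bilinear_ladd[OF bilinear_Gam] bilinear_radd[OF bilinear_Gam]
  bilinear_lmul[OF bilinear_Gam] bilinear_rmul[OF bilinear_Gam]
  bilinear_lzero[OF bilinear_Gam] bilinear_rzero[OF bilinear_Gam]

lemma trilinear_eq_axis:
  fixes f g :: "real^'a \<Rightarrow> real^'b \<Rightarrow> real^'c \<Rightarrow> real"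
  assumes "\<And>b c. linear (\<lambda>a. f a b c)" "\<And>a c. linear (\<lambda>b. f a b c)" "\<And>a b. linear (\<lambda>c. f a b c)"
    and "\<And>b c. linear (\<lambda>a. g a b c)" "\<And>a c. linear (\<lambda>b. g a b c)" "\<And>a b. linear (\<lambda>c. g a b c)"
    and "\<And>i j k. f (axis i 1) (axis j 1) (axis k 1) = g (axis i 1) (axis j 1) (axis k 1)"
  shows "f a b c = g a b c"
proof -
  have 1: "f (axis i 1) (axis j 1) c = g (axis i 1) (axis j 1) c" for i j c
    by (rule fun_cong[OF linear_eq_stdbasis[OF assms(3,6)]]) (auto simp: Basis_vec_def assms(7))
  have 2: "f (axis i 1) b c = g (axis i 1) b c" for i b c
    by (rule fun_cong[OF linear_eq_stdbasis[OF assms(2,5)]]) (auto simp: Basis_vec_def 1)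
  show ?thesis
    by (rule fun_cong[OF linear_eq_stdbasis[OF assms(1,4)]]) (auto simp: Basis_vec_def 2)
qed

lemma sum_mult_axis: "(\<Sum>j\<in>UNIV. f j * axis k (1::real) $ j) = f k" for f :: "'a::finite \<Rightarrow> real"
  by (simp add: axis_def if_distrib[of "(*) _"] sum.delta cong: if_cong)

lemma Gam_axis: "Gam G y (axis i 1) (axis j 1) = (\<chi> k. christoffel G y i j k)"
  unfolding Gam_def sum_mult_axis ..

lemma inner_symmetric_matrix:
  fixes M :: "real^'n^'n"
  assumes "transpose M = M"
  shows "a \<bullet> (M *v b) = b \<bullet> (M *v a)"
proof -
  have "a \<bullet> (M *v b) = (transpose M *v a) \<bullet> b"
    unfolding transpose_matrix_vector dot_lmul_matrix ..
  then show ?thesis using assms by (simp add: inner_commute)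
qed

section \<open>Koszul formula and symmetries of the curvature tensor\<close>

locale metric_field =
  fixes G :: "real^'e::finite \<Rightarrow> real^'e^'e" and V :: "(real^'e) set"
  assumes openV: "open V" and smoothG: "smooth_on V G"
    and symG: "\<And>y. y \<in> V \<Longrightarrow> transpose (G y) = G y"
    and posG: "\<And>y v. y \<in> V \<Longrightarrow> v \<noteq> 0 \<Longrightarrow> v \<bullet> (G y *v v) > 0"
begin

lemma ip_commute: "y \<in> V \<Longrightarrow> ip G y a b = ip G y b a"
  unfolding ip_def by (intro inner_symmetric_matrix symG)

lemma ip_pos: "y \<in> V \<Longrightarrow> v \<noteq> 0 \<Longrightarrow> ip G y v v > 0"
  unfolding ip_def by (rule posG)

lemma ip_self_eq_0: "y \<in> V \<Longrightarrow> ip G y v v = 0 \<longleftrightarrow> v = 0"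
  using ip_pos[of y v] by (cases "v = 0") (auto simp: ip_zero_left)

lemma detG: "y \<in> V \<Longrightarrow> det (G y) \<noteq> 0"
proof
  assume y: "y \<in> V" and "det (G y) = 0"
  then have "\<not> invertible (G y)" by (simp add: invertible_det_nz)
  then obtain v where "v \<noteq> 0" "G y *v v = 0"
    unfolding invertible_left_inverse matrix_left_invertible_ker by blast
  then show False using posG[OF y] by force
qed

lemma symG_nth: "y \<in> V \<Longrightarrow> G y $ i $ j = G y $ j $ i"
  using arg_cong[OF symG[of y], of "\<lambda>M. M $ j $ i"] by (simp add: transpose_def)

lemma differentiable_G: "y \<in> V \<Longrightarrow> G differentiable (at y)"
  by (rule smooth_on_differentiable[OF smoothG openV])

lemma pderiv_at_G: "y \<in> V \<Longrightarrow> pderiv_at i (\<lambda>z. G z $ j $ l) y = dir (axis i 1) G y $ j $ l"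
  unfolding pderiv_at_def
  by (rule dir_bounded_linear[OF bounded_linear_compose[OF bounded_linear_vec_nth bounded_linear_vec_nth] differentiable_G])

lemma dir_G_sym: 
  assumes y: "y \<in> V" shows "dir u G y $ i $ j = dir u G y $ j $ i"
proof -
  have b: "bounded_linear (\<lambda>M::real^'e^'e. M $ i $ j)" for i j
    by (rule bounded_linear_compose[OF bounded_linear_vec_nth bounded_linear_vec_nth])
  have "dir u (\<lambda>z. G z $ i $ j) y = dir u (\<lambda>z. G z $ j $ i) y"
  proof (rule dir_cong_open[OF openV y])
    show "(\<lambda>z. G z $ i $ j) differentiable at y"
      using bounded_linear.has_derivative[OF b] differentiable_G[OF y] unfolding differentiable_def by blast
  qed (rule symG_nth)
  then show ?thesis
    using dir_bounded_linear[OF b differentiable_G[OF y]] by simp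
qed

text \<open>The Christoffel symbols are defined by components, so trilinearity is used to check the
  identity on axis vectors, where applying \<open>G y\<close> cancels the inverse matrix in
  \<open>christoffel\<close>. The symmetry of \<open>Gam\<close>, its compatibility with the metric
  and its behaviour under pullback are all read off from this formula.\<close>

lemma koszul:
  assumes y: "y \<in> V"
  shows "ip G y z (Gam G y v w) = (1/2) * (w \<bullet> (dir v G y *v z) + v \<bullet> (dir w G y *v z) - v \<bullet> (dir z G y *v w))"
proof (rule trilinear_eq_axis[where a=z and b=v and c=w and f="\<lambda>z v w. ip G y z (Gam G y v w)"
      and g="\<lambda>z v w. (1/2) * (w \<bullet> (dir v G y *v z) + v \<bullet> (dir w G y *v z) - v \<bullet> (dir z G y *v w))"])
  let ?D = "\<lambda>i j l. dir (axis i 1) G y $ j $ l"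
  have lin: "dir (a + b) G y = dir a G y + dir b G y" "dir (r *\<^sub>R a) G y = r *\<^sub>R dir a G y" for a b r
    using dir_plus[OF differentiable_G[OF y]]
      dir_scale[OF differentiable_G[OF y]] by auto
  note mv = matrix_vector_mult_add_rdistrib matrix_vector_right_distrib
      matrix_vector_mult_scaleR scaleR_matrix_vector_assoc[symmetric] inner_simps lin
  show "linear (\<lambda>a. ip G y a (Gam G y b c))" "linear (\<lambda>a. ip G y b (Gam G y a c))"
      "linear (\<lambda>a. ip G y b (Gam G y c a))" for b c
    by (auto intro!: linearI simp: ip_simps Gam_simps)
  show "linear (\<lambda>a. (1/2) * (c \<bullet> (dir b G y *v a) + b \<bullet> (dir c G y *v a) - b \<bullet> (dir a G y *v c)))" for b c
    by (auto intro!: linearI simp: mv algebra_simps add_divide_distrib diff_divide_distrib)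
  show "linear (\<lambda>b. (1/2) * (c \<bullet> (dir b G y *v a) + b \<bullet> (dir c G y *v a) - b \<bullet> (dir a G y *v c)))" for a c
    by (auto intro!: linearI simp: mv algebra_simps add_divide_distrib diff_divide_distrib)
  show "linear (\<lambda>c. (1/2) * (c \<bullet> (dir b G y *v a) + b \<bullet> (dir c G y *v a) - b \<bullet> (dir a G y *v c)))" for a b
    by (auto intro!: linearI simp: mv algebra_simps add_divide_distrib diff_divide_distrib)
  fix l i j
  let ?c = "\<chi> m. (1/2) * (?D i j m + ?D j i m - ?D m i j)"
  have "Gam G y (axis i 1) (axis j 1) = matrix_inv (G y) *v ?c"
    by (simp add: vec_eq_iff Gam_axis christoffel_def pderiv_at_G[OF y] matrix_vector_mult_def sum_distrib_left)
  then have "G y *v Gam G y (axis i 1) (axis j 1) = ?c"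
    by (simp add: matrix_vector_mul_assoc matrix_inv_right detG[OF y])
  then have "ip G y (axis l 1) (Gam G y (axis i 1) (axis j 1)) = ?c $ l" by (simp add: ip_def inner_axis' )
  moreover have "axis a 1 \<bullet> (M *v axis b 1) = M $ a $ b" for a b and M :: "real^'e^'e"
    by (simp add: inner_axis' matrix_vector_mul_component inner_axis)
  ultimately show "ip G y (axis l 1) (Gam G y (axis i 1) (axis j 1)) =
     (1/2) * (axis j 1 \<bullet> (dir (axis i 1) G y *v axis l 1) + axis i 1 \<bullet> (dir (axis j 1) G y *v axis l 1) - axis i 1 \<bullet> (dir (axis l 1) G y *v axis j 1))"
    by simp
qed

lemma dir_G_commute: "y \<in> V \<Longrightarrow> a \<bullet> (dir u G y *v b) = b \<bullet> (dir u G y *v a)"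
proof -
  assume y: "y \<in> V"
  have "transpose (dir u G y) = dir u G y" using dir_G_sym[OF y] by (simp add: vec_eq_iff transpose_def)
  then show ?thesis by (rule inner_symmetric_matrix)
qed

lemma Gam_commute: assumes y: "y \<in> V" shows "Gam G y v w = Gam G y w v"
proof -
  let ?d = "Gam G y v w - Gam G y w v"
  have "ip G y ?d ?d = 0"
    using koszul[OF y, of ?d v w] koszul[OF y, of ?d w v] dir_G_commute[OF y, of v ?d w]
    by (simp add: ip_diff_right)
  then show ?thesis using ip_self_eq_0[OF y] by simp
qed

lemma compat:
  assumes y: "y \<in> V"
  shows "v \<bullet> (dir u G y *v w) = ip G y (Gam G y u v) w + ip G y v (Gam G y u w)"
  unfolding ip_commute[OF y, of "Gam G y u v" w] koszul[OF y]
  using dir_G_commute[OF y, of v u w] dir_G_commute[OF y, of u v w] dir_G_commute[OF y, of u w v]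
  by (simp add: add_divide_distrib diff_divide_distrib)

lemma smooth_Gam_const: "smooth_on V (\<lambda>y. \<chi> k. christoffel G y i j k)"
proof (rule smooth_on_vec[OF openV])
  fix k
  have p: "smooth_on V (\<lambda>y. pderiv_at a (\<lambda>z. G z $ b $ c) y)" for a b c
    unfolding pderiv_at_def
    by (intro smooth_on_dir smooth_on_nth openV smoothG)
  have "smooth_on V (\<lambda>y. christoffel G y i j k)"
    unfolding christoffel_def
    by (intro smooth_on_mult smooth_on_const smooth_on_sum smooth_on_nth smooth_on_add smooth_on_diff
        smooth_on_matrix_inv openV smoothG detG p)
  then show "smooth_on V (\<lambda>y. (\<chi> k. christoffel G y i j k) $ k)" by simp
qed

lemma smooth_Gam: "smooth_on V (\<lambda>y. Gam G y v w)"
  unfolding Gam_expand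
  by (intro smooth_on_sum smooth_on_scaleR smooth_on_const openV smooth_Gam_const)

lemma differentiable_Gam: "y \<in> V \<Longrightarrow> (\<lambda>y. Gam G y v w) differentiable (at y)"
  by (rule smooth_on_differentiable[OF smooth_Gam openV])

text \<open>Differentiating the metric along with \<open>Gam\<close> absorbs the nested terms
  \<open>Gam G y a (Gam G y b w)\<close> by compatibility. In this form only lowered Christoffel
  terms are differentiated, and these are what a pullback determines.\<close>

lemma Rm_lowered:
  assumes y: "y \<in> V"
  shows "ip G y z (Rm G y a b w) =
    dir a (\<lambda>y. ip G y z (Gam G y b w)) y - dir b (\<lambda>y. ip G y z (Gam G y a w)) y
    - ip G y (Gam G y a z) (Gam G y b w) + ip G y (Gam G y b z) (Gam G y a w)"
proof -
  have "dir a (\<lambda>y. ip G y z (Gam G y b w)) y =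
      ip G y (Gam G y a z) (Gam G y b w) + ip G y z (Gam G y a (Gam G y b w)) + ip G y z (dir a (\<lambda>z. Gam G z b w) y)" for a b
  proof -
    have "dir a (\<lambda>y. G y *v Gam G y b w) y = G y *v dir a (\<lambda>z. Gam G z b w) y + dir a G y *v Gam G y b w"
      by (rule dir_bilinear[OF bounded_bilinear_matrix_vector differentiable_G[OF y] differentiable_Gam[OF y]])
    moreover have "(\<lambda>y. G y *v Gam G y b w) differentiable (at y)"
      by (rule smooth_on_differentiable[OF smooth_on_matrix_vector[OF openV smoothG smooth_Gam] openV y])
    ultimately show ?thesis
      unfolding ip_def using dir_bounded_linear[OF bounded_linear_inner_right[of z], of "\<lambda>y. G y *v Gam G y b w" y a]
        compat[OF y, of z a "Gam G y b w"]
      by (simp add: ip_def inner_add_right)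
  qed
  then show ?thesis by (simp add: Rm_def ip_simps)
qed

lemma linear_Rm:
  assumes y: "y \<in> V"
  shows "linear (\<lambda>a. Rm G y a b w)" "linear (\<lambda>b. Rm G y a b w)" "linear (\<lambda>w. Rm G y a b w)"
proof -
  have add: "dir a (\<lambda>z. Gam G z (p + q) w) y = dir a (\<lambda>z. Gam G z p w) y + dir a (\<lambda>z. Gam G z q w) y"
    "dir a (\<lambda>z. Gam G z w (p + q)) y = dir a (\<lambda>z. Gam G z w p) y + dir a (\<lambda>z. Gam G z w q) y" for a p q w
    unfolding Gam_simps by (rule dir_add[OF differentiable_Gam[OF y] differentiable_Gam[OF y]])+
  have scale: "dir a (\<lambda>z. Gam G z (r *\<^sub>R p) w) y = r *\<^sub>R dir a (\<lambda>z. Gam G z p w) y"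
    "dir a (\<lambda>z. Gam G z w (r *\<^sub>R p)) y = r *\<^sub>R dir a (\<lambda>z. Gam G z w p) y" for a p r w
    unfolding Gam_simps by (rule dir_bounded_linear[OF bounded_linear_scaleR_right differentiable_Gam[OF y]])+
  note lin = dir_plus[OF differentiable_Gam[OF y]]
    dir_scale[OF differentiable_Gam[OF y]]
  show "linear (\<lambda>a. Rm G y a b w)" "linear (\<lambda>b. Rm G y a b w)" "linear (\<lambda>w. Rm G y a b w)"
    by (auto intro!: linearI simp: Rm_def add scale add[unfolded Gam_simps] scale[unfolded Gam_simps] lin Gam_simps algebra_simps)
qed

text \<open>By \<open>compat\<close>, symmetrising the lowered Christoffel term in z and w gives a
  first derivative of the function g(z,w). Its second derivatives are symmetric in a and b, so the
  symmetrised curvature is zero.\<close>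

lemma Rm_antisym_right:
  assumes y: "y \<in> V"
  shows "ip G y z (Rm G y a b w) = - ip G y w (Rm G y a b z)"
proof -
  have d: "(\<lambda>y. ip G y p (Gam G y q r)) differentiable (at y)" for p q r
    unfolding ip_def
    by (rule smooth_on_differentiable[OF smooth_on_inner[OF openV smooth_on_const[OF openV] smooth_on_matrix_vector[OF openV smoothG smooth_Gam]] openV y])
  have s: "smooth_on V (\<lambda>y. z \<bullet> (G y *v w))"
    by (rule smooth_on_inner[OF openV smooth_on_const[OF openV] smooth_on_matrix_vector[OF openV smoothG smooth_on_const[OF openV]]])
  have b: "bounded_linear (\<lambda>M::real^'e^'e. z \<bullet> (M *v w))"
    by (rule bounded_linear_compose[OF bounded_linear_inner_right bounded_bilinear.bounded_linear_left[OF bounded_bilinear_matrix_vector]])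
  have K: "dir a (\<lambda>y. ip G y z (Gam G y b w)) y + dir a (\<lambda>y. ip G y w (Gam G y b z)) y = dir a (dir b (\<lambda>y. z \<bullet> (G y *v w))) y" for a b
  proof -
    have "dir a (dir b (\<lambda>y. z \<bullet> (G y *v w))) y = dir a (\<lambda>y. ip G y z (Gam G y b w) + ip G y w (Gam G y b z)) y"
    proof (rule dir_cong_open[OF openV y, where F="dir b (\<lambda>y. z \<bullet> (G y *v w))"])
      show "dir b (\<lambda>y. z \<bullet> (G y *v w)) differentiable at y"
        by (rule smooth_on_differentiable[OF smooth_on_dir[OF s openV] openV y])
      show "dir b (\<lambda>y. z \<bullet> (G y *v w)) y' = ip G y' z (Gam G y' b w) + ip G y' w (Gam G y' b z)" if "y' \<in> V" for y'
        using dir_bounded_linear[OF b differentiable_G[OF that], of b] compat[OF that, of z b w] ip_commute[OF that] by simp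
    qed
    also have "\<dots> = dir a (\<lambda>y. ip G y z (Gam G y b w)) y + dir a (\<lambda>y. ip G y w (Gam G y b z)) y"
      by (rule dir_add[OF d d])
    finally show ?thesis by simp
  qed
  show ?thesis
    using K[of a b] K[of b a] dir_commute[OF openV s y, where v=a and w=b]
    unfolding Rm_lowered[OF y]
    using ip_commute[OF y, of "Gam G y a z" "Gam G y b w"] ip_commute[OF y, of "Gam G y a w" "Gam G y b z"] by simp
qed

end

section \<open>Covariant derivatives along a map\<close>

locale map_into = metric_field G V for G :: "real^'e::finite \<Rightarrow> real^'e^'e" and V +
  fixes F :: "real^'d::finite \<Rightarrow> real^'e" and Om :: "(real^'d) set"
  assumes openOm: "open Om" and smoothF: "smooth_on Om F" and FOm: "F ` Om \<subseteq> V"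
begin

definition cov :: "(real^'d \<Rightarrow> real^'e) \<Rightarrow> real^'d \<Rightarrow> real^'d \<Rightarrow> real^'e" where
  "cov W x u = dir u W x + Gam G (F x) (dir u F x) (W x)"

lemma F_in: "x \<in> Om \<Longrightarrow> F x \<in> V" using FOm by blast

lemma diffF: "x \<in> Om \<Longrightarrow> F differentiable (at x)"
  by (rule smooth_on_differentiable[OF smoothF openOm])

lemma smooth_dirF: "smooth_on Om (dir v F)"
  by (rule smooth_on_dir[OF smoothF openOm])

lemma smooth_Gam_comp:
  assumes "smooth_on Om A" "smooth_on Om B"
  shows "smooth_on Om (\<lambda>x. Gam G (F x) (A x) (B x))"
  unfolding Gam_expand
  by (intro smooth_on_sum smooth_on_scaleR smooth_on_mult smooth_on_nth openOm assms
      smooth_on_compose[OF openOm openV FOm smoothF smooth_Gam_const])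

lemma smooth_cov: "smooth_on Om W \<Longrightarrow> smooth_on Om (\<lambda>x. cov W x u)"
  unfolding cov_def by (intro smooth_on_add openOm smooth_on_dir smooth_Gam_comp smoothF)

lemma smooth_ip: "smooth_on Om W \<Longrightarrow> smooth_on Om Z \<Longrightarrow> smooth_on Om (\<lambda>x. ip G (F x) (W x) (Z x))"
  unfolding ip_def
  by (intro smooth_on_inner smooth_on_matrix_vector openOm smooth_on_compose[OF openOm openV FOm smoothF smoothG])

text \<open>The base point and both arguments of \<open>Gam\<close> move. Written as a finite sum of
  coefficient products, the term is differentiated by the product and chain rules and
  reassembled.\<close>

lemma dir_Gam_comp:
  assumes A: "smooth_on Om A" and B: "smooth_on Om B" and x: "x \<in> Om"
  shows "dir u (\<lambda>x. Gam G (F x) (A x) (B x)) x =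
    dir (dir u F x) (\<lambda>y. Gam G y (A x) (B x)) (F x) + Gam G (F x) (dir u A x) (B x) + Gam G (F x) (A x) (dir u B x)"
proof -
  let ?C = "\<lambda>i j y. \<chi> k. christoffel G y i j k"
  note dA = smooth_on_differentiable[OF A openOm x] and dB = smooth_on_differentiable[OF B openOm x]
  have dC: "?C i j differentiable (at (F x))" for i j
    by (rule smooth_on_differentiable[OF smooth_Gam_const openV F_in[OF x]])
  have sC: "smooth_on Om (\<lambda>x. ?C i j (F x))" for i j
    by (rule smooth_on_compose[OF openOm openV FOm smoothF smooth_Gam_const])
  have sAB: "smooth_on Om (\<lambda>x. A x $ i * B x $ j)" for i j
    by (intro smooth_on_mult smooth_on_nth openOm A B)
  have sABC: "smooth_on Om (\<lambda>x. (A x $ i * B x $ j) *\<^sub>R ?C i j (F x))" for i j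
    by (intro smooth_on_scaleR openOm sAB sC)
  have dAB: "dir u (\<lambda>x. A x $ i * B x $ j) x = A x $ i * dir u B x $ j + dir u A x $ i * B x $ j" for i j
  proof -
    have "dir u (\<lambda>x. A x $ i * B x $ j) x = A x $ i * dir u (\<lambda>x. B x $ j) x + dir u (\<lambda>x. A x $ i) x * B x $ j"
      by (rule dir_bilinear[OF bounded_bilinear_mult])
        (rule smooth_on_differentiable[OF smooth_on_nth[OF openOm] openOm x], rule A B)+
    then show ?thesis
      using dir_bounded_linear[OF bounded_linear_vec_nth dA] dir_bounded_linear[OF bounded_linear_vec_nth dB] by simp
  qed
  have 1: "dir u (\<lambda>x. (A x $ i * B x $ j) *\<^sub>R ?C i j (F x)) x =
     (A x $ i * B x $ j) *\<^sub>R dir (dir u F x) (?C i j) (F x) + (A x $ i * dir u B x $ j + dir u A x $ i * B x $ j) *\<^sub>R ?C i j (F x)" for i j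
  proof -
    have "dir u (\<lambda>x. (A x $ i * B x $ j) *\<^sub>R ?C i j (F x)) x =
        (A x $ i * B x $ j) *\<^sub>R dir u (\<lambda>x. ?C i j (F x)) x + dir u (\<lambda>x. A x $ i * B x $ j) x *\<^sub>R ?C i j (F x)"
      by (rule dir_bilinear[OF bounded_bilinear_scaleR smooth_on_differentiable[OF sAB openOm x] smooth_on_differentiable[OF sC openOm x]])
    also have "dir u (\<lambda>x. ?C i j (F x)) x = dir (dir u F x) (?C i j) (F x)"
      by (rule dir_compose[OF diffF[OF x] dC])
    finally show ?thesis unfolding dAB .
  qed
  have "dir u (\<lambda>x. Gam G (F x) (A x) (B x)) x = (\<Sum>i\<in>UNIV. dir u (\<lambda>x. \<Sum>j\<in>UNIV. (A x $ i * B x $ j) *\<^sub>R ?C i j (F x)) x)"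
    unfolding Gam_expand
    by (rule dir_sum) (rule smooth_on_differentiable[OF smooth_on_sum[OF openOm sABC] openOm x])
  also have "\<dots> = (\<Sum>i\<in>UNIV. \<Sum>j\<in>UNIV. dir u (\<lambda>x. (A x $ i * B x $ j) *\<^sub>R ?C i j (F x)) x)"
    by (intro sum.cong refl dir_sum smooth_on_differentiable[OF sABC openOm x])
  finally have L: "dir u (\<lambda>x. Gam G (F x) (A x) (B x)) x = \<dots>" .
  have cC: "smooth_on V (\<lambda>y. (A x $ i * B x $ j) *\<^sub>R ?C i j y)" for i j
    by (intro smooth_on_scaleR openV smooth_on_const smooth_Gam_const)
  have R1: "dir w (\<lambda>y. Gam G y (A x) (B x)) (F x) = (\<Sum>i\<in>UNIV. \<Sum>j\<in>UNIV. dir w (\<lambda>y. (A x $ i * B x $ j) *\<^sub>R ?C i j y) (F x))" for w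
  proof -
    have "dir w (\<lambda>y. Gam G y (A x) (B x)) (F x) = (\<Sum>i\<in>UNIV. dir w (\<lambda>y. \<Sum>j\<in>UNIV. (A x $ i * B x $ j) *\<^sub>R ?C i j y) (F x))"
      unfolding Gam_expand
      by (rule dir_sum) (rule smooth_on_differentiable[OF smooth_on_sum[OF openV cC] openV F_in[OF x]])
    also have "\<dots> = (\<Sum>i\<in>UNIV. \<Sum>j\<in>UNIV. dir w (\<lambda>y. (A x $ i * B x $ j) *\<^sub>R ?C i j y) (F x))"
      by (intro sum.cong refl dir_sum smooth_on_differentiable[OF cC openV F_in[OF x]])
    finally show ?thesis .
  qed
  have R2: "dir w (\<lambda>y. (A x $ i * B x $ j) *\<^sub>R ?C i j y) (F x) = (A x $ i * B x $ j) *\<^sub>R dir w (?C i j) (F x)" for w i j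
    by (rule dir_bounded_linear[OF bounded_linear_scaleR_right dC])
  have R: "dir (dir u F x) (\<lambda>y. Gam G y (A x) (B x)) (F x) = (\<Sum>i\<in>UNIV. \<Sum>j\<in>UNIV. (A x $ i * B x $ j) *\<^sub>R dir (dir u F x) (?C i j) (F x))"
    unfolding R1 R2 ..
  show ?thesis
    unfolding L R 1 Gam_expand[of G "F x"] by (simp add: sum.distrib scaleR_add_left add_ac)
qed

lemma dir_ip:
  assumes W: "smooth_on Om W" and Z: "smooth_on Om Z" and x: "x \<in> Om"
  shows "dir u (\<lambda>x. ip G (F x) (W x) (Z x)) x = ip G (F x) (cov W x u) (Z x) + ip G (F x) (W x) (cov Z x u)"
proof -
  have sG: "smooth_on Om (\<lambda>x. G (F x))" by (rule smooth_on_compose[OF openOm openV FOm smoothF smoothG])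
  note dG = smooth_on_differentiable[OF sG openOm x] and dW = smooth_on_differentiable[OF W openOm x]
    and dZ = smooth_on_differentiable[OF Z openOm x]
  have "dir u (\<lambda>x. W x \<bullet> (G (F x) *v Z x)) x = W x \<bullet> dir u (\<lambda>x. G (F x) *v Z x) x + dir u W x \<bullet> (G (F x) *v Z x)"
    by (rule dir_bilinear[OF bounded_bilinear_inner dW smooth_on_differentiable[OF smooth_on_matrix_vector[OF openOm sG Z] openOm x]])
  also have "dir u (\<lambda>x. G (F x) *v Z x) x = G (F x) *v dir u Z x + dir u (\<lambda>x. G (F x)) x *v Z x"
    by (rule dir_bilinear[OF bounded_bilinear_matrix_vector dG dZ])
  also have "dir u (\<lambda>x. G (F x)) x = dir (dir u F x) G (F x)"
    by (rule dir_compose[OF diffF[OF x] differentiable_G[OF F_in[OF x]]])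
  finally show ?thesis
    using compat[OF F_in[OF x], of "W x" "dir u F x" "Z x"]
    by (simp add: ip_def cov_def inner_simps matrix_vector_right_distrib)
qed

lemma torsion_free: "x \<in> Om \<Longrightarrow> cov (dir v F) x u = cov (dir u F) x v"
  unfolding cov_def using dir_commute[OF openOm smoothF, where v=u and w=v and x=x] Gam_commute[OF F_in] by simp

text \<open>The second derivatives of \<open>W\<close> and of \<open>F\<close> are symmetric in u
  and v and drop out, leaving the curvature of the target. With \<open>W\<close> a derivative of
  \<open>F\<close> this feeds the Gauss equation, with \<open>W\<close> the normal field the Codazzi
  equation.\<close>

lemma cov_commutator:
  assumes W: "smooth_on Om W" and x: "x \<in> Om"
  shows "cov (\<lambda>x. cov W x v) x u - cov (\<lambda>x. cov W x u) x v = Rm G (F x) (dir u F x) (dir v F x) (W x)"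
proof -
  have "dir u (\<lambda>x. cov W x v) x = dir u (dir v W) x + (dir (dir u F x) (\<lambda>y. Gam G y (dir v F x) (W x)) (F x)
     + Gam G (F x) (dir u (dir v F) x) (W x) + Gam G (F x) (dir v F x) (dir u W x))" for u v
    unfolding cov_def dir_Gam_comp[OF smooth_dirF W x, symmetric]
    by (rule dir_add[OF smooth_on_differentiable[OF smooth_on_dir[OF W openOm] openOm x]
          smooth_on_differentiable[OF smooth_Gam_comp[OF smooth_dirF W] openOm x]])
  then show ?thesis
    unfolding cov_def[of "\<lambda>x. cov W x _"] Rm_def
    using dir_commute[OF openOm W x, where v=u and w=v] dir_commute[OF openOm smoothF x, where v=u and w=v]
    by (simp add: cov_def Gam_simps)
qed

end

section \<open>Bounds on the sectional curvature over compact sets\<close>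

context metric_field begin

lemma smooth_Rm: "smooth_on V (\<lambda>y. ip G y z (Rm G y a b w))"
proof -
  have GG: "smooth_on V (\<lambda>y. Gam G y a (Gam G y b w))" for a b w
  proof -
    \<comment> \<open>With the identity as the map, \<open>smooth_Gam_comp\<close> covers
      \<open>Gam\<close> with an argument that depends on the base point.\<close>
    interpret id: map_into G V "\<lambda>y. y" V
      by unfold_locales
        (simp_all add: openV smooth_on_ident[OF openV])
    show ?thesis by (rule id.smooth_Gam_comp[OF smooth_on_const[OF openV] smooth_Gam])
  qed
  show ?thesis
    unfolding ip_def Rm_def
    by (intro smooth_on_inner smooth_on_const smooth_on_matrix_vector smooth_on_add smooth_on_diff smooth_on_dir
        openV smoothG smooth_Gam GG)
qed

text \<open>A repeated vector in the first pair, or a pairing of \<open>Rm\<close> with its own last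
  argument, gives zero by antisymmetry; so only the class of b modulo a matters.\<close>

lemma Rm_shear:
  assumes y: "y \<in> V"
  shows "ip G y a (Rm G y a (b + t *\<^sub>R a) (b + t *\<^sub>R a)) = ip G y a (Rm G y a b b)"
proof -
  have "ip G y a (Rm G y a c a) = 0" for c
    using Rm_antisym_right[OF y, of a a c a] by simp
  moreover have "Rm G y a a c = 0" for c
    by (simp add: Rm_def)
  ultimately show ?thesis
    by (simp add: linear_add[OF linear_Rm(2)[OF y]] linear_add[OF linear_Rm(3)[OF y]]
        linear_cmul[OF linear_Rm(2)[OF y]] linear_cmul[OF linear_Rm(3)[OF y]] ip_simps)
qed

text \<open>The factor is the sum of the absolute components of the lowered tensor, a continuous
  function of y and hence bounded on compact sets.\<close>

lemma Rm_norm_bound: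
  assumes y: "y \<in> V"
  shows "\<bar>ip G y a (Rm G y a b b)\<bar> \<le> (\<Sum>i\<in>UNIV. \<Sum>j\<in>UNIV. \<Sum>k\<in>UNIV. \<Sum>l\<in>UNIV.
     \<bar>ip G y (axis l 1) (Rm G y (axis i 1) (axis j 1) (axis k 1))\<bar>) * (norm a ^ 2 * norm b ^ 2)"
proof -
  have ex: "f a = (\<Sum>i\<in>UNIV. a $ i *\<^sub>R f (axis i 1))" if "linear f" for f :: "real^'e \<Rightarrow> 'b::real_vector" and a
  proof -
    have "f a = f (\<Sum>i\<in>UNIV. a $ i *\<^sub>R axis i 1)" using basis_expansion[of a] by (simp add: scalar_mult_eq_scaleR)
    then show ?thesis by (simp add: linear_sum[OF that] linear_cmul[OF that])
  qed
  have li: "linear (\<lambda>z. ip G y z c)" "linear (\<lambda>z. ip G y c z)" for c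
    by (auto intro!: linearI simp: ip_simps)
  note comp = linear_compose[unfolded comp_def]
  let ?S = "\<lambda>i j k l. ip G y (axis l 1) (Rm G y (axis i 1) (axis j 1) (axis k 1))"
  have "ip G y a (Rm G y a b b) = (\<Sum>i\<in>UNIV. a $ i *\<^sub>R ip G y a (Rm G y (axis i 1) b b))"
    by (rule ex[OF comp[OF linear_Rm(1)[OF y] li(2)]])
  also have "\<dots> = (\<Sum>i\<in>UNIV. a $ i *\<^sub>R (\<Sum>j\<in>UNIV. b $ j *\<^sub>R ip G y a (Rm G y (axis i 1) (axis j 1) b)))"
    by (intro sum.cong refl arg_cong[of _ _ "\<lambda>z. _ *\<^sub>R z"] ex[OF comp[OF linear_Rm(2)[OF y] li(2)]])
  also have "\<dots> = (\<Sum>i\<in>UNIV. a $ i *\<^sub>R (\<Sum>j\<in>UNIV. b $ j *\<^sub>R (\<Sum>k\<in>UNIV. b $ k *\<^sub>R ip G y a (Rm G y (axis i 1) (axis j 1) (axis k 1)))))"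
    by (intro sum.cong refl arg_cong[of _ _ "\<lambda>z. _ *\<^sub>R z"] ex[OF comp[OF linear_Rm(3)[OF y] li(2)]])
  also have "\<dots> = (\<Sum>i\<in>UNIV. a $ i *\<^sub>R (\<Sum>j\<in>UNIV. b $ j *\<^sub>R (\<Sum>k\<in>UNIV. b $ k *\<^sub>R (\<Sum>l\<in>UNIV. a $ l *\<^sub>R ?S i j k l))))"
    by (intro sum.cong refl arg_cong[of _ _ "\<lambda>z. _ *\<^sub>R z"] ex[OF li(1)])
  finally have "ip G y a (Rm G y a b b) = (\<Sum>i\<in>UNIV. \<Sum>j\<in>UNIV. \<Sum>k\<in>UNIV. \<Sum>l\<in>UNIV. (a $ i * b $ j * b $ k * a $ l) * ?S i j k l)"
    by (simp add: sum_distrib_left mult.assoc)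
  then have "\<bar>ip G y a (Rm G y a b b)\<bar> \<le> (\<Sum>i\<in>UNIV. \<Sum>j\<in>UNIV. \<Sum>k\<in>UNIV. \<Sum>l\<in>UNIV. \<bar>(a $ i * b $ j * b $ k * a $ l) * ?S i j k l\<bar>)"
    by (simp only:) (intro order_trans[OF sum_abs] sum_mono order_refl)
  also have "\<dots> \<le> (\<Sum>i\<in>UNIV. \<Sum>j\<in>UNIV. \<Sum>k\<in>UNIV. \<Sum>l\<in>UNIV. \<bar>?S i j k l\<bar> * (norm a ^ 2 * norm b ^ 2))"
  proof (intro sum_mono)
    fix i j k l
    have "\<bar>a $ i\<bar> * \<bar>b $ j\<bar> * \<bar>b $ k\<bar> * \<bar>a $ l\<bar> \<le> norm a * norm b * norm b * norm a"
      by (intro mult_mono component_le_norm_cart mult_nonneg_nonneg) auto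
    then show "\<bar>(a $ i * b $ j * b $ k * a $ l) * ?S i j k l\<bar> \<le> \<bar>?S i j k l\<bar> * (norm a ^ 2 * norm b ^ 2)"
      unfolding abs_mult mult.commute[of _ "\<bar>?S i j k l\<bar>"]
      by (intro mult_left_mono) (simp_all add: power2_eq_square mult_ac)
  qed
  finally show ?thesis by (simp add: sum_distrib_right)
qed

text \<open>Take m as the minimum of the quadratic form over \<open>K\<close> times the unit sphere;
  homogeneity extends the bound to all v.\<close>

lemma ip_lower_bound:
  assumes K: "compact K" "K \<subseteq> V"
  shows "\<exists>m>0. \<forall>y\<in>K. \<forall>v. m * norm v ^ 2 \<le> ip G y v v"
proof (cases "K = {} \<or> sphere (0::real^'e) 1 = {}")
  case True
  have "v = 0" if "sphere (0::real^'e) 1 = {}" for v :: "real^'e"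
  proof (rule ccontr)
    assume "v \<noteq> 0"
    then have "(1 / norm v) *\<^sub>R v \<in> sphere 0 1" by simp
    then show False using that by blast
  qed
  then show ?thesis using True by (intro exI[of _ 1]) (auto simp: ip_zero_left)
next
  case False
  let ?h = "\<lambda>p. ip G (fst p) (snd p) (snd p)"
  have c: "compact (K \<times> sphere (0::real^'e) 1)" by (intro compact_Times K compact_sphere)
  have "continuous_on (K \<times> sphere (0::real^'e) 1) (\<lambda>p. G (fst p))"
    by (rule continuous_on_compose2[OF smooth_on_continuous[OF smoothG] continuous_on_fst[OF continuous_on_id]]) (use K(2) in auto)
  then have "continuous_on (K \<times> sphere (0::real^'e) 1) ?h"
    unfolding ip_def
    by (intro continuous_on_inner bounded_bilinear.continuous_on[OF bounded_bilinear_matrix_vector] continuous_intros)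
  then obtain p where p: "p \<in> K \<times> sphere 0 1" "\<And>q. q \<in> K \<times> sphere 0 1 \<Longrightarrow> ?h p \<le> ?h q"
    using continuous_attains_inf[OF c, of ?h] False by blast
  have pos: "?h p > 0" using p(1) K(2) by (intro ip_pos) auto
  have "?h p * norm v ^ 2 \<le> ip G y v v" if "y \<in> K" for y v
  proof (cases "v = 0")
    case False
    then have "?h p \<le> ip G y ((1 / norm v) *\<^sub>R v) ((1 / norm v) *\<^sub>R v)"
      using p(2)[of "(y, (1 / norm v) *\<^sub>R v)"] that by simp
    then show ?thesis using False by (simp add: ip_simps field_simps power2_eq_square)
  qed (simp add: ip_simps)
  then show ?thesis using pos by blast
qed

text \<open>Both sides only depend on the component of \<open>b\<close> orthogonal to \<open>a\<close>, which reduces the claim to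
  compactness of \<open>K\<close> and of the unit sphere.\<close>

lemma sectional_bound:
  assumes K: "compact K" "K \<subseteq> V"
  shows "\<exists>C. \<forall>y\<in>K. \<forall>a b. \<bar>ip G y a (Rm G y a b b)\<bar> \<le> C * (ip G y a a * ip G y b b - (ip G y a b)\<^sup>2)"
proof -
  let ?T = "\<lambda>y. \<Sum>i\<in>UNIV. \<Sum>j\<in>UNIV. \<Sum>k\<in>UNIV. \<Sum>l\<in>UNIV.
     \<bar>ip G y (axis l 1) (Rm G y (axis i 1) (axis j 1) (axis k 1))\<bar>"
  have c: "continuous_on K (\<lambda>y. ip G y z (Rm G y a b w))" for z a b w
    by (rule continuous_on_subset[OF smooth_on_continuous[OF smooth_Rm] K(2)])
  have "continuous_on K ?T"
    by (intro continuous_on_sum continuous_on_rabs c)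
  then have "bounded (?T ` K)"
    by (rule compact_imp_bounded[OF compact_continuous_image[OF _ K(1)]])
  then obtain B where "\<forall>x\<in>?T ` K. norm x \<le> B"
    unfolding bounded_iff by blast
  then have B: "?T y \<le> B" if "y \<in> K" for y
    using that by (metis (no_types, lifting) image_eqI norm_ge_zero real_norm_def abs_ge_self order_trans)
  obtain m where m: "m > 0" "\<And>y v. y \<in> K \<Longrightarrow> m * norm v ^ 2 \<le> ip G y v v"
    using ip_lower_bound[OF K] by blast
  \<comment> \<open>One factor m is spent on the length of a and one on the length of the part of b
    transversal to a; \<open>B\<close> bounds the components of the curvature tensor on
    \<open>K\<close>.\<close>
  have "\<bar>ip G y a (Rm G y a b b)\<bar> \<le> B / m\<^sup>2 * (ip G y a a * ip G y b b - (ip G y a b)\<^sup>2)" if yK: "y \<in> K" for y a b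
  proof (cases "a = 0")
    case True
    then show ?thesis by (simp add: ip_simps)
  next
    case False
    have y: "y \<in> V" using yK K(2) by blast
    \<comment> \<open>Two projections are compared: c is the part of b orthogonal to a in the
      Euclidean sense, which \<open>Rm_norm_bound\<close> estimates; d below is orthogonal in the
      metric and carries the Gram determinant. They differ by a multiple of a, so c is not longer
      than d in the Euclidean norm.\<close>
    define c where "c = b - ((a \<bullet> b) / (a \<bullet> a)) *\<^sub>R a"
    have ac: "a \<bullet> c = 0" using False by (simp add: c_def inner_diff_right)
    define s where "s = ip G y a b / ip G y a a"
    have Paa: "ip G y a a > 0" by (rule ip_pos[OF y False])
    define d where "d = b - s *\<^sub>R a"
    have gram: "ip G y a a * ip G y b b - (ip G y a b)\<^sup>2 = ip G y a a * ip G y d d"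
      using Paa ip_commute[OF y, of b a] by (simp add: d_def s_def ip_simps field_simps power2_eq_square)
    have dc: "d = c + ((a \<bullet> b) / (a \<bullet> a) - s) *\<^sub>R a" by (simp add: c_def d_def algebra_simps)
    have "norm c ^ 2 \<le> norm d ^ 2"
      unfolding dc power2_norm_eq_inner using ac
      by (simp add: inner_simps inner_commute mult.assoc[symmetric] del: mult.assoc)
    then have "m * norm c ^ 2 \<le> ip G y d d" using m(2)[OF yK, of d] m(1)
      by (meson mult_left_mono order_less_imp_le order_trans)
    then have g2: "m * norm a ^ 2 * (m * norm c ^ 2) \<le> ip G y a a * ip G y d d"
      using m(2)[OF yK, of a] m(1) Paa by (intro mult_mono) auto
    have "b = c + ((a \<bullet> b) / (a \<bullet> a)) *\<^sub>R a" by (simp add: c_def)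
    then have "ip G y a (Rm G y a b b) = ip G y a (Rm G y a c c)"
      using Rm_shear[OF y, of a c] by metis
    then have "\<bar>ip G y a (Rm G y a b b)\<bar> \<le> ?T y * (norm a ^ 2 * norm c ^ 2)"
      using Rm_norm_bound[OF y] by metis
    also have "\<dots> \<le> B * (norm a ^ 2 * norm c ^ 2)" by (intro mult_right_mono B yK) auto
    also have "\<dots> = B / m\<^sup>2 * (m * norm a ^ 2 * (m * norm c ^ 2))" using m(1) by (simp add: field_simps power2_eq_square)
    also have "\<dots> \<le> B / m\<^sup>2 * (ip G y a a * ip G y d d)"
    proof (intro mult_left_mono g2 divide_nonneg_nonneg)
      have "0 \<le> ?T y" by (intro sum_nonneg) auto
      then show "0 \<le> B" using B[OF yK] by linarith
    qed auto
    finally show ?thesis unfolding gram .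
  qed
  then show ?thesis by blast
qed

end

section \<open>Pullback metrics\<close>

locale pullback_metric = map_into G V F Om
  for G :: "real^'e::finite \<Rightarrow> real^'e^'e" and V and F :: "real^'d::finite \<Rightarrow> real^'e" and Om +
  fixes E :: "real^'d \<Rightarrow> real^'d^'d" and Om'
  assumes Om'_subset: "Om' \<subseteq> Om" and E_metric: "metric_field E Om'"
    and E_pullback: "\<And>x a b. x \<in> Om' \<Longrightarrow> ip E x a b = ip G (F x) (dir a F x) (dir b F x)"
begin

sublocale E: metric_field E Om' by (rule E_metric)

text \<open>Koszul's formula for \<open>E\<close> contains three derivatives of pulled-back inner
  products. Each splits in two by \<open>dir_ip\<close>, and torsion freeness cancels all but two
  equal terms. So the image of \<open>Gam E x a b\<close> is the tangential part of the covariant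
  derivative of \<open>dir b F\<close>.\<close>

lemma Gam_E:
  assumes x: "x \<in> Om'"
  shows "ip E x c (Gam E x a b) = ip G (F x) (dir c F x) (cov (dir b F) x a)"
proof -
  have xO: "x \<in> Om" using x Om'_subset by blast
  have D: "b \<bullet> (dir a E x *v c) = ip G (F x) (cov (dir b F) x a) (dir c F x) + ip G (F x) (dir b F x) (cov (dir c F) x a)" for a b c
  proof -
    have bl: "bounded_linear (\<lambda>M::real^'d^'d. b \<bullet> (M *v c))"
      by (rule bounded_linear_compose[OF bounded_linear_inner_right bounded_bilinear.bounded_linear_left[OF bounded_bilinear_matrix_vector]])
    have "b \<bullet> (dir a E x *v c) = dir a (\<lambda>x. b \<bullet> (E x *v c)) x"
      by (rule dir_bounded_linear[OF bl E.differentiable_G[OF x], symmetric])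
    also have "\<dots> = dir a (\<lambda>x. ip G (F x) (dir b F x) (dir c F x)) x"
    proof (rule sym, rule dir_cong_open[OF E.openV x])
      show "(\<lambda>x. ip G (F x) (dir b F x) (dir c F x)) differentiable at x"
        by (rule smooth_on_differentiable[OF smooth_ip[OF smooth_dirF smooth_dirF] openOm xO])
      show "ip G (F y) (dir b F y) (dir c F y) = b \<bullet> (E y *v c)" if "y \<in> Om'" for y
        using E_pullback[OF that, of b c] by (simp add: ip_def)
    qed
    also have "\<dots> = ip G (F x) (cov (dir b F) x a) (dir c F x) + ip G (F x) (dir b F x) (cov (dir c F) x a)"
      by (rule dir_ip[OF smooth_dirF smooth_dirF xO])
    finally show ?thesis .
  qed
  show ?thesis
    unfolding E.koszul[OF x] D
    using torsion_free[OF xO, of a b] torsion_free[OF xO, of c b] torsion_free[OF xO, of c a]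
      ip_commute[OF F_in[OF xO]] by simp
qed

text \<open>The Gauss equation before splitting \<open>D\<^sub>a F\<^sub>b\<close> into tangential and normal parts. It is used for surfaces and
  also, with equal dimensions, for isometries onto flat space.\<close>

lemma gauss_general:
  assumes x: "x \<in> Om'"
  shows "ip E x z (Rm E x a b w) = ip G (F x) (dir z F x) (Rm G (F x) (dir a F x) (dir b F x) (dir w F x))
    + (ip G (F x) (cov (dir z F) x a) (cov (dir w F) x b) - ip E x (Gam E x a z) (Gam E x b w))
    - (ip G (F x) (cov (dir z F) x b) (cov (dir w F) x a) - ip E x (Gam E x b z) (Gam E x a w))"
proof -
  have xO: "x \<in> Om" using x Om'_subset by blast
  have D: "dir a (\<lambda>y. ip E y z (Gam E y b w)) x =
      ip G (F x) (cov (dir z F) x a) (cov (dir w F) x b) + ip G (F x) (dir z F x) (cov (\<lambda>x. cov (dir w F) x b) x a)" for a b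
  proof -
    have "dir a (\<lambda>x. ip G (F x) (dir z F x) (cov (dir w F) x b)) x = dir a (\<lambda>y. ip E y z (Gam E y b w)) x"
    proof (rule dir_cong_open[OF E.openV x])
      show "(\<lambda>x. ip G (F x) (dir z F x) (cov (dir w F) x b)) differentiable at x"
        by (rule smooth_on_differentiable[OF smooth_ip[OF smooth_dirF smooth_cov[OF smooth_dirF]] openOm xO])
    qed (simp add: Gam_E)
    then show ?thesis using dir_ip[OF smooth_dirF smooth_cov[OF smooth_dirF] xO] by simp
  qed
  show ?thesis
    unfolding E.Rm_lowered[OF x] D
    using arg_cong[OF cov_commutator[OF smooth_dirF xO, where v=b and u=a], of "ip G (F x) (dir z F x)"]
    by (simp add: ip_diff_right)
qed

end

text \<open>Between spaces of equal dimension an isometric map leaves no normal direction, so the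
  difference terms of \<open>gauss_general\<close> cancel and only the curvature of the constant
  metric remains.\<close>

lemma flat_pullback:
  fixes G :: "real^'e::finite \<Rightarrow> real^'e^'e" and h :: "real^'e \<Rightarrow> real^'e"
  assumes G: "metric_field G V" and h: "smooth_on V h"
    and pull: "\<And>y a b. y \<in> V \<Longrightarrow> ip G y a b = dir a h y \<bullet> dir b h y" and y: "y \<in> V"
  shows "ip G y z (Rm G y a b w) = 0"
proof -
  let ?I = "\<lambda>_::real^'e. mat 1 :: real^'e^'e"
  interpret G: metric_field G V by fact
  have nz: "dir v h y \<noteq> 0" if "y \<in> V" "v \<noteq> 0" for y v
    using G.ip_pos[OF that] pull[OF that(1), of v v] by auto
  interpret P: pullback_metric ?I UNIV h V G V
    by (intro pullback_metric.intro map_into.intro metric_field.intro map_into_axioms.intro pullback_metric_axioms.intro)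
      (simp_all add: smooth_on_const transpose_mat G.openV G.smoothG G.symG nz h pull[unfolded ip_def] ip_def)
  have gam: "Gam ?I y v w = 0" for y v w
    by (simp add: Gam_def christoffel_def pderiv_at_def vec_eq_iff)
  have Rm: "Rm ?I y a b w = 0" for y a b w
    by (simp add: Rm_def gam)
  have inj: "inj (frechet_derivative h (at y))"
  proof (rule linear_injective_0[THEN iffD2, OF linear_frechet_derivative[OF P.diffF[OF y]], rule_format])
    fix v assume "dir v h y = 0"
    then show "v = 0" using pull[OF y, of v v] G.ip_self_eq_0[OF y] by simp
  qed
  then have surj: "surj (frechet_derivative h (at y))"
    by (rule linear_injective_imp_surjective[OF linear_frechet_derivative[OF P.diffF[OF y]] _ refl])
  have "P.cov (dir b h) y a = dir (Gam G y a b) h y" for a b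
  proof -
    \<comment> \<open>Surjectivity makes the difference an image \<open>dir c h y\<close>, while
      \<open>Gam_E\<close> makes it orthogonal to every image, itself included.\<close>
    obtain c where c: "P.cov (dir b h) y a - dir (Gam G y a b) h y = dir c h y" using surj by (meson surjD)
    have "dir c h y \<bullet> P.cov (dir b h) y a = dir c h y \<bullet> dir (Gam G y a b) h y"
      using P.Gam_E[OF y, of c a b] pull[OF y, of c] by (simp add: ip_def[of ?I])
    then have "dir c h y \<bullet> (P.cov (dir b h) y a - dir (Gam G y a b) h y) = 0"
      by (simp add: inner_diff_right)
    then have "dir c h y = 0" unfolding c by simp
    then show ?thesis using c by simp
  qed
  then show ?thesis
    unfolding P.gauss_general[OF y] Rm by (simp add: ip_simps ip_def[of ?I] pull[OF y])
qed


section \<open>Fronts in coordinates\<close>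

definition det2 :: "real^2 \<Rightarrow> real^2 \<Rightarrow> real" where
  "det2 a b = a $ 1 * b $ 2 - a $ 2 * b $ 1"

definition mu :: "(real^3 \<Rightarrow> real^3^3) \<Rightarrow> real^3 \<Rightarrow> real^3 \<Rightarrow> real^3 \<Rightarrow> real^3 \<Rightarrow> real" where
  "mu G y a b c = sqrt (det (G y)) * det (vector [a, b, c] :: real^3^3)"

text \<open>Isolates the middle argument as one factor of an inner product, so that the differential
  of \<open>lam\<close> at a point where this argument vanishes needs only the product rule.\<close>

lemma mu_cross: "mu G y a b c = b \<bullet> (sqrt (det (G y)) *\<^sub>R cross3 c a)"
  by (simp add: mu_def cross3_simps)

lemma mu_simps:
  "mu G y a (b + b') c = mu G y a b c + mu G y a b' c"
  "mu G y a (r *\<^sub>R b) c = r * mu G y a b c"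
  "mu G y a a c = 0" "mu G y a c c = 0"
  by (simp_all add: mu_def det_3 algebra_simps)

lemma det2_0D: "det2 a b \<noteq> 0 \<Longrightarrow> v = (det2 v b / det2 a b) *\<^sub>R a + (det2 a v / det2 a b) *\<^sub>R b"
  unfolding det2_def vec_eq_iff forall_2 by (simp add: divide_simps) (simp add: algebra_simps)

lemma det2_eq_0: "b \<noteq> 0 \<Longrightarrow> det2 a b = 0 \<Longrightarrow> \<exists>r. a = r *\<^sub>R b"
proof -
  assume b: "b \<noteq> 0" and d: "det2 a b = 0"
  consider "b $ 1 \<noteq> 0" | "b $ 2 \<noteq> 0" using b by (auto simp: vec_eq_iff forall_2)
  then show ?thesis
  proof cases
    case 1
    then show ?thesis using d by (intro exI[of _ "a $ 1 / b $ 1"]) (auto simp: vec_eq_iff forall_2 det2_def field_simps)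
  next
    case 2
    then show ?thesis using d by (intro exI[of _ "a $ 2 / b $ 2"]) (auto simp: vec_eq_iff forall_2 det2_def field_simps)
  qed
qed

lemma vec2_expand: "a = a $ 1 *\<^sub>R axis 1 1 + a $ 2 *\<^sub>R (axis 2 1 :: real^2)"
  by (simp add: vec_eq_iff forall_2 axis_def)

text \<open>A change of frame multiplies the determinant of the matrix of h by the squared
  determinant of the frame. It serves both for passing to a frame adapted to the null vector and for
  changing the chart of the surface.\<close>

lemma bilinear2_minor:
  fixes h :: "real^2 \<Rightarrow> real^2 \<Rightarrow> real"
  assumes "bilinear h"
  shows "h a a * h b b - h a b * h b a =
    (det2 a b)\<^sup>2 * (h (axis 1 1) (axis 1 1) * h (axis 2 1) (axis 2 1) - h (axis 1 1) (axis 2 1) * h (axis 2 1) (axis 1 1))"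
proof -
  note s = bilinear_ladd[OF assms] bilinear_radd[OF assms] bilinear_lmul[OF assms] bilinear_rmul[OF assms]
  have H: "h a b = a $ 1 * b $ 1 * h (axis 1 1) (axis 1 1) + a $ 1 * b $ 2 * h (axis 1 1) (axis 2 1)
      + a $ 2 * b $ 1 * h (axis 2 1) (axis 1 1) + a $ 2 * b $ 2 * h (axis 2 1) (axis 2 1)" for a b
    by (subst vec2_expand[of a], subst vec2_expand[of b]) (simp add: s algebra_simps)
  show ?thesis unfolding det2_def H[of a a] H[of b b] H[of a b] H[of b a] by algebra
qed

text \<open>The segment from the identity to \<open>A\<close> stays positive definite, so the
  determinant cannot vanish on it and keeps the sign it has at the identity.\<close>

lemma positive_definite_det:
  fixes A :: "real^'n^'n"
  assumes "\<And>v. v \<noteq> 0 \<Longrightarrow> v \<bullet> (A *v v) > 0"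
  shows "det A > 0"
proof (rule ccontr)
  let ?B = "\<lambda>t::real. (1 - t) *\<^sub>R mat 1 + t *\<^sub>R A"
  have nz: "det (?B t) \<noteq> 0" if "0 \<le> t" "t \<le> 1" for t
  proof
    assume "det (?B t) = 0"
    then have "\<not> invertible (?B t)" by (simp add: invertible_det_nz)
    then obtain v where v: "v \<noteq> 0" "?B t *v v = 0"
      unfolding invertible_left_inverse matrix_left_invertible_ker by blast
    have "v \<bullet> (?B t *v v) = (1 - t) * (v \<bullet> v) + t * (v \<bullet> (A *v v))"
      by (simp add: matrix_vector_mult_add_rdistrib scaleR_matrix_vector_assoc[symmetric] inner_simps)
    moreover have "v \<bullet> v > 0" using v by simp
    moreover have "v \<bullet> (A *v v) > 0" using assms v by blast
    ultimately have "v \<bullet> (?B t *v v) > 0"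
      using that by (cases "t = 0") (auto intro!: add_nonneg_pos)
    then show False using v by simp
  qed
  have "continuous_on {0..1} (\<lambda>t. det (?B t))"
    unfolding det_def by (intro continuous_intros)
  moreover assume "\<not> det A > 0"
  ultimately have "\<exists>t\<ge>0. t \<le> 1 \<and> det (?B t) = 0"
    by (intro IVT2') (auto simp: det_I)
  then show False using nz by blast
qed

section \<open>Fundamental forms and Gauss equation of a front\<close>

locale local_front = map_into G V F Om
  for G :: "real^3 \<Rightarrow> real^3^3" and V and F :: "real^2 \<Rightarrow> real^3" and Om +
  fixes n :: "real^2 \<Rightarrow> real^3"
  assumes smoothn: "smooth_on Om n"
    and unit: "\<And>x. x \<in> Om \<Longrightarrow> ip G (F x) (n x) (n x) = 1"
    and normal: "\<And>x u. x \<in> Om \<Longrightarrow> ip G (F x) (dir u F x) (n x) = 0"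
    and immersed: "\<And>x v. x \<in> Om \<Longrightarrow> dir v F x = 0 \<Longrightarrow> dir v n x = 0 \<Longrightarrow> v = 0"
begin

definition E :: "real^2 \<Rightarrow> real^2^2" where
  "E x = (\<chi> i j. ip G (F x) (dir (axis i 1) F x) (dir (axis j 1) F x))"

definition II :: "real^2 \<Rightarrow> real^2 \<Rightarrow> real^2 \<Rightarrow> real" where
  "II x a b = - ip G (F x) (dir a F x) (cov n x b)"

definition lam :: "real^2 \<Rightarrow> real" where
  "lam x = mu G (F x) (dir (axis 1 1) F x) (dir (axis 2 1) F x) (n x)"

definition D :: "real^2 \<Rightarrow> real" where
  "D x = II x (axis 1 1) (axis 1 1) * II x (axis 2 1) (axis 2 1) - II x (axis 1 1) (axis 2 1) * II x (axis 2 1) (axis 1 1)"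

lemma dirF_lin: "x \<in> Om \<Longrightarrow> dir (a + b) F x = dir a F x + dir b F x" "x \<in> Om \<Longrightarrow> dir (r *\<^sub>R a) F x = r *\<^sub>R dir a F x"
  using dir_plus[OF diffF] dir_scale[OF diffF] by auto

lemma cov_lin:
  assumes "smooth_on Om W" "x \<in> Om"
  shows "cov W x (a + b) = cov W x a + cov W x b" "cov W x (r *\<^sub>R a) = r *\<^sub>R cov W x a"
  using dir_plus[OF smooth_on_differentiable[OF assms(1) openOm assms(2)]]
    dir_scale[OF smooth_on_differentiable[OF assms(1) openOm assms(2)]] assms(2)
  by (simp_all add: cov_def dirF_lin Gam_simps scaleR_add_right)

lemma bilinear_II: "x \<in> Om \<Longrightarrow> bilinear (II x)"
  unfolding bilinear_def
  by (auto intro!: linearI simp: II_def dirF_lin cov_lin[OF smoothn] ip_simps)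

lemma smooth_II: "smooth_on Om (\<lambda>x. II x a b)"
  unfolding II_def
  by (rule smooth_on_minus[OF openOm smooth_ip[OF smooth_dirF smooth_cov[OF smoothn]]])

text \<open>Differentiate the orthogonality of \<open>dir a F\<close> and \<open>n\<close>. Torsion
  freeness then makes \<open>II\<close> symmetric, at singular points as well.\<close>

lemma II_second_derivative:
  assumes x: "x \<in> Om"
  shows "ip G (F x) (cov (dir a F) x b) (n x) = II x a b"
proof -
  have "dir b (\<lambda>x. ip G (F x) (dir a F x) (n x)) x = dir b (\<lambda>x. 0) x"
    by (rule dir_cong_open[OF openOm x normal smooth_on_differentiable[OF smooth_ip[OF smooth_dirF smoothn] openOm x]])
  then show ?thesis
    using dir_ip[OF smooth_dirF[of a] smoothn x, of b] by (simp add: II_def)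
qed

lemma normal': "x \<in> Om \<Longrightarrow> ip G (F x) (n x) (dir u F x) = 0"
  using normal ip_commute[OF F_in] by simp

lemma II_commute: "x \<in> Om \<Longrightarrow> II x a b = II x b a"
  using II_second_derivative[of x a b] II_second_derivative[of x b a] torsion_free[of x a b] by simp

lemma cov_n_n: 
  assumes x: "x \<in> Om" shows "ip G (F x) (n x) (cov n x b) = 0"
proof -
  have "dir b (\<lambda>x. ip G (F x) (n x) (n x)) x = dir b (\<lambda>x. 1) x"
    by (rule dir_cong_open[OF openOm x unit smooth_on_differentiable[OF smooth_ip[OF smoothn smoothn] openOm x]])
  then show ?thesis
    using dir_ip[OF smoothn smoothn x, of b] ip_commute[OF F_in[OF x], of "n x" "cov n x b"] by simp
qed

lemma detG_pos: "y \<in> V \<Longrightarrow> det (G y) > 0"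
  by (rule positive_definite_det) (rule posG)

text \<open>The matrix with rows a, b, c times the metric times its transpose is the Gram matrix.
  With \<open>n\<close> in the last slot this gives \<open>lam\<^sup>2\<close> = det
  \<open>E\<close>, and later the independence of the adapted frame at a singular point.\<close>

lemma mu_gram:
  assumes y: "y \<in> V"
  shows "(mu G y a b c)\<^sup>2 = det (vector [vector [ip G y a a, ip G y a b, ip G y a c],
     vector [ip G y b a, ip G y b b, ip G y b c], vector [ip G y c a, ip G y c b, ip G y c c]] :: real^3^3)"
proof -
  let ?A = "vector [a, b, c] :: real^3^3"
  have "?A ** G y ** transpose ?A = vector [vector [ip G y a a, ip G y a b, ip G y a c],
     vector [ip G y b a, ip G y b b, ip G y b c], vector [ip G y c a, ip G y c b, ip G y c c]]"
    by (simp add: vec_eq_iff forall_3 matrix_matrix_mult_def transpose_def ip_def inner_vec_def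
        matrix_vector_mult_def sum_3 algebra_simps)
  moreover have "det (?A ** G y ** transpose ?A) = (det ?A)\<^sup>2 * det (G y)"
    by (simp add: det_mul power2_eq_square)
  ultimately show ?thesis
    using detG_pos[OF y] by (simp add: mu_def power_mult_distrib)
qed

lemma ortho_basis:
  assumes y: "y \<in> V" and "mu G y a b c \<noteq> 0" "ip G y a v = 0" "ip G y b v = 0" "ip G y c v = 0"
  shows "v = 0"
proof -
  let ?A = "vector [a, b, c] :: real^3^3"
  have "det ?A \<noteq> 0" using assms(2) by (auto simp: mu_def)
  then have "invertible ?A" by (simp add: invertible_det_nz)
  moreover have "?A *v (G y *v v) = 0"
    using assms(3-5) unfolding ip_def
    by (simp add: vec_eq_iff forall_3 matrix_vector_mul_component)
  ultimately have "G y *v v = 0"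
    unfolding invertible_left_inverse matrix_left_invertible_ker by blast
  then have "ip G y v v = 0" by (simp add: ip_def)
  then show ?thesis using ip_self_eq_0[OF y] by simp
qed

lemma dirF_expand:
  assumes "x \<in> Om"
  shows "dir a F x = a $ 1 *\<^sub>R dir (axis 1 1) F x + a $ 2 *\<^sub>R dir (axis 2 1) F x"
  using arg_cong[OF vec2_expand[of a], of "\<lambda>a. dir a F x"] by (simp only: dirF_lin[OF assms])

lemma ip_E:
  assumes x: "x \<in> Om"
  shows "ip E x a b = ip G (F x) (dir a F x) (dir b F x)"
  unfolding dirF_expand[OF x, of a] dirF_expand[OF x, of b]
  by (simp add: ip_def[of E] E_def inner_vec_def matrix_vector_mult_def sum_2 ip_simps algebra_simps)

lemma mu_dir:
  assumes x: "x \<in> Om"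
  shows "mu G (F x) (dir a F x) (dir b F x) (n x) = det2 a b * lam x"
  unfolding dirF_expand[OF x, of a] dirF_expand[OF x, of b]
  by (simp add: det2_def lam_def mu_def det_3 algebra_simps)

lemma lam_square:
  assumes x: "x \<in> Om"
  shows "(lam x)\<^sup>2 = det (E x)"
  unfolding lam_def mu_gram[OF F_in[OF x]]
  by (simp add: det_3 det_2 E_def normal[OF x] normal'[OF x] unit[OF x])

lemma lam_eq_0: 
  assumes x: "x \<in> Om"
  shows "lam x = 0 \<longleftrightarrow> (\<exists>v. v \<noteq> 0 \<and> dir v F x = 0)"
proof -
  have "lam x = 0 \<longleftrightarrow> \<not> invertible (E x)"
    using lam_square[OF x] by (auto simp: invertible_det_nz)
  also have "\<dots> \<longleftrightarrow> (\<exists>v. v \<noteq> 0 \<and> E x *v v = 0)"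
    unfolding invertible_left_inverse matrix_left_invertible_ker by blast
  also have "\<dots> \<longleftrightarrow> (\<exists>v. v \<noteq> 0 \<and> dir v F x = 0)"
  proof -
    have "E x *v v = 0 \<longleftrightarrow> dir v F x = 0" for v
    proof
      assume "E x *v v = 0"
      then have "ip E x v v = 0" by (simp add: ip_def)
      then show "dir v F x = 0" using ip_E[OF x] ip_self_eq_0[OF F_in[OF x]] by simp
    next
      assume "dir v F x = 0"
      then have "ip E x (E x *v v) v = 0" using ip_E[OF x] by (simp add: ip_simps)
      then show "E x *v v = 0" by (simp add: ip_def)
    qed
    then show ?thesis by simp
  qed
  finally show ?thesis .
qed

lemma smooth_E: "smooth_on Om E"
  by (intro smooth_on_vec openOm) (simp add: E_def smooth_ip[OF smooth_dirF smooth_dirF])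

lemma smooth_normal_cross:
  "smooth_on Om (\<lambda>x. sqrt (det (G (F x))) *\<^sub>R cross3 (n x) (dir a F x))"
proof -
  have b: "bounded_bilinear cross3"
    using bilinear_cross bilinear_conv_bounded_bilinear by blast
  have "smooth_on Om (\<lambda>x. det (G (F x)))"
    by (rule smooth_on_det[OF openOm smooth_on_compose[OF openOm openV FOm smoothF smoothG]])
  then have "smooth_on Om (\<lambda>x. sqrt (det (G (F x))))"
    by (intro smooth_on_sqrt[OF openOm]) (simp_all add: detG_pos F_in)
  then show ?thesis
    by (rule smooth_on_scaleR[OF openOm _ smooth_on_bilinear[OF openOm b smoothn smooth_dirF]])
qed

lemma smooth_lam: "smooth_on Om lam"
  unfolding lam_def mu_cross by (rule smooth_on_inner[OF openOm smooth_dirF smooth_normal_cross])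

lemma smooth_D: "smooth_on Om D"
  unfolding D_def by (intro smooth_on_diff smooth_on_mult openOm smooth_II)

definition Reg :: "(real^2) set" where "Reg = {x \<in> Om. lam x \<noteq> 0}"

lemma open_Reg: "open Reg"
proof -
  have "Reg = Om \<inter> lam -` (- {0})" by (auto simp: Reg_def)
  then show ?thesis
    using continuous_open_preimage[OF smooth_on_continuous[OF smooth_lam] openOm, of "- {0}"] by (simp add: open_Compl)
qed

lemma metric_field_E: "metric_field E Reg"
proof
  show "open Reg" by (rule open_Reg)
  show "smooth_on Reg E" by (rule smooth_on_subset[OF smooth_E]) (auto simp: Reg_def)
  show "transpose (E y) = E y" if "y \<in> Reg" for y
    using that ip_commute[OF F_in] by (auto simp: E_def transpose_def vec_eq_iff Reg_def)
  show "v \<bullet> (E y *v v) > 0" if "y \<in> Reg" "v \<noteq> 0" for y v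
  proof -
    have y: "y \<in> Om" "lam y \<noteq> 0" using that by (auto simp: Reg_def)
    then have "dir v F y \<noteq> 0" using that lam_eq_0 by blast
    then show ?thesis using ip_pos[OF F_in[OF y(1)]] ip_E[OF y(1), of v v] by (simp add: ip_def[of E])
  qed
qed

sublocale pullback_metric G V F Om E Reg
proof (intro pullback_metric.intro pullback_metric_axioms.intro map_into_axioms metric_field_E)
  show "Reg \<subseteq> Om" by (auto simp: Reg_def)
  show "ip E x a b = ip G (F x) (dir a F x) (dir b F x)" if "x \<in> Reg" for x a b
    using that ip_E by (auto simp: Reg_def)
qed

text \<open>The Gauss formula: \<open>Gam_E\<close> gives the tangential part of the covariant
  derivative, \<open>II\<close> its normal part, and what remains is orthogonal to a frame because
  \<open>lam x\<close> is nonzero. The tangential products cancel in the difference.\<close>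

lemma gauss_weingarten:
  assumes x: "x \<in> Reg"
  shows "ip G (F x) (cov (dir c F) x a) (cov (dir d F) x b) - ip E x (Gam E x a c) (Gam E x b d) = II x c a * II x d b"
proof -
  have xO: "x \<in> Om" and l: "lam x \<noteq> 0" using x by (auto simp: Reg_def)
  have dec: "cov (dir c F) x a = dir (Gam E x a c) F x + II x c a *\<^sub>R n x" for a c
  proof -
    let ?v = "cov (dir c F) x a - dir (Gam E x a c) F x - II x c a *\<^sub>R n x"
    have t: "ip G (F x) (dir z F x) ?v = 0" for z
      using Gam_E[OF x, of z a c] ip_E[OF xO, of z "Gam E x a c"] normal[OF xO] by (simp add: ip_simps)
    have "ip G (F x) (n x) ?v = 0"
      using II_second_derivative[OF xO, of c a] ip_commute[OF F_in[OF xO], of "n x" "cov (dir c F) x a"]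
      by (simp add: ip_simps normal'[OF xO] unit[OF xO])
    then have "?v = 0" using ortho_basis[OF F_in[OF xO] l[unfolded lam_def] t t] by blast
    then show ?thesis by (simp add: algebra_simps)
  qed
  show ?thesis
    unfolding dec ip_E[OF xO]
    by (simp add: ip_simps normal[OF xO] normal'[OF xO] unit[OF xO])
qed

lemma gauss_equation:
  assumes x: "x \<in> Reg"
  shows "ip E x a (Rm E x a b b) = ip G (F x) (dir a F x) (Rm G (F x) (dir a F x) (dir b F x) (dir b F x))
    + (II x a a * II x b b - II x a b * II x b a)"
  using gauss_general[OF x, of a a b b] gauss_weingarten[OF x, of a a b b] gauss_weingarten[OF x, of a b b a] by simp

text \<open>Matches the component formula of \<open>gauss_curvature\<close>, lowered with the first
  column of \<open>E\<close>, with the coordinate-free \<open>Rm\<close>.\<close>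

lemma gauss_curvature_E:
  assumes x: "x \<in> Reg"
  shows "gauss_curvature E x * det (E x) = ip E x (axis 1 1) (Rm E x (axis 1 1) (axis 2 1) (axis 2 1))"
proof -
  have c: "curvature E x 1 2 2 l = Rm E x (axis 1 1) (axis 2 1) (axis 2 1) $ l" for l
  proof -
    have p: "pderiv_at i (\<lambda>y. christoffel E y j k l) x = dir (axis i 1) (\<lambda>z. Gam E z (axis j 1) (axis k 1)) x $ l" for i j k
      using dir_bounded_linear[OF bounded_linear_vec_nth[of l] E.differentiable_Gam[OF x, of "axis j 1" "axis k 1"], of "axis i 1"]
      by (simp add: pderiv_at_def Gam_axis)
    have g: "Gam E x (axis i 1) (Gam E x (axis j 1) (axis k 1)) $ l = (\<Sum>m\<in>UNIV. christoffel E x i m l * christoffel E x j k m)" for i j k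
      unfolding Gam_axis[of E x j k] by (simp add: Gam_def sum_2 axis_def forall_2) (use exhaust_2[of i] in auto)
    show ?thesis unfolding curvature_def p Rm_def vector_add_component vector_minus_component g
      by (simp add: sum_subtractf)
  qed
  have "det (E x) \<noteq> 0" using lam_square[of x] x by (auto simp: Reg_def)
  then show ?thesis
    unfolding gauss_curvature_def c
    by (simp add: ip_def inner_axis' matrix_vector_mult_def E.symG_nth[OF x, of _ 1] mult.commute)
qed

theorem gauss_local:
  assumes x: "x \<in> Reg"
  shows "gauss_curvature E x * det (E x) =
    ip G (F x) (dir (axis 1 1) F x) (Rm G (F x) (dir (axis 1 1) F x) (dir (axis 2 1) F x) (dir (axis 2 1) F x)) + D x"
  unfolding gauss_curvature_E[OF x] gauss_equation[OF x] D_def ..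

lemma dir_mult:
  fixes f g :: "real^2 \<Rightarrow> real"
  shows "smooth_on Om f \<Longrightarrow> smooth_on Om g \<Longrightarrow> x \<in> Om \<Longrightarrow> dir v (\<lambda>x. f x * g x) x = f x * dir v g x + dir v f x * g x"
  by (rule dir_bilinear[OF bounded_bilinear_mult smooth_on_differentiable[OF _ openOm] smooth_on_differentiable[OF _ openOm]])

lemma differentiable_lam: "x \<in> Om \<Longrightarrow> lam differentiable (at x)"
  by (rule smooth_on_differentiable[OF smooth_lam openOm])

lemma differentiable_II: "x \<in> Om \<Longrightarrow> (\<lambda>x. II x a b) differentiable (at x)"
  by (rule smooth_on_differentiable[OF smooth_II openOm])

lemma II_minor: "x \<in> Om \<Longrightarrow> II x a a * II x b b - II x a b * II x b a = (det2 a b)\<^sup>2 * D x"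
  unfolding D_def by (rule bilinear2_minor[OF bilinear_II])

text \<open>A null vector annihilates \<open>II\<close> in both slots, so the determinant in a frame
  containing it is zero.\<close>

lemma D_singular:
  assumes x: "x \<in> Om" and l: "lam x = 0"
  shows "D x = 0"
proof -
  obtain v where v: "v \<noteq> 0" "dir v F x = 0" using l lam_eq_0[OF x] by blast
  have "II x v a = 0" for a by (simp add: II_def v(2) ip_simps)
  moreover from this have "II x a v = 0" for a using II_commute[OF x] by simp
  \<comment> \<open>The companion vector is v turned by a right angle, so that \<open>det2\<close>
    is the squared Euclidean length of v.\<close>
  ultimately show ?thesis
    using II_minor[OF x, of "vector [v $ 2, - v $ 1]" v] v(1)
    by (auto simp: det2_def vec_eq_iff forall_2 sum_power2_eq_zero_iff power2_eq_square[symmetric])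
qed

end

section \<open>Non-degenerate singular points\<close>

locale singular_front = local_front G V F Om n
  for G :: "real^3 \<Rightarrow> real^3^3" and V and F :: "real^2 \<Rightarrow> real^3" and Om and n +
  fixes p \<eta> :: "real^2"
  assumes p: "p \<in> Om" and \<eta>: "\<eta> \<noteq> 0" and null: "dir \<eta> F p = 0" and nondegenerate: "\<exists>X. dir X lam p \<noteq> 0"
begin

definition w :: "real^3" where "w = cov n p \<eta>"

text \<open>The factor between the volume form and the pairing with \<open>w\<close>: for \<xi>
  transversal to \<eta>, the form with \<open>dir \<xi> F p\<close> and \<open>n p\<close> in its
  outer slots sees only the \<open>w\<close>-component of the middle vector.\<close>

definition \<kappa> :: "real^2 \<Rightarrow> real" where "\<kappa> \<xi> = mu G (F p) (dir \<xi> F p) w (n p) / ip G (F p) w w"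

lemma Fp: "F p \<in> V" by (rule F_in[OF p])

lemma lam_p: "lam p = 0" using lam_eq_0[OF p] \<eta> null by blast

lemma w_nonzero: "w \<noteq> 0"
proof -
  have "w = dir \<eta> n p" by (simp add: w_def cov_def null Gam_simps)
  then show ?thesis using immersed[OF p null] \<eta> by auto
qed

lemma w_pos: "ip G (F p) w w > 0" by (rule ip_pos[OF Fp w_nonzero])

lemma II_null: "II p \<eta> a = 0" "II p a \<eta> = 0"
  using II_commute[OF p, of a \<eta>] by (simp_all add: II_def null ip_simps)

lemma tangent_w: "ip G (F p) (dir a F p) w = 0" "ip G (F p) w (dir a F p) = 0"
  using II_null(2)[of a] ip_commute[OF Fp, of w] by (simp_all add: II_def w_def)

lemma normal_w: "ip G (F p) (n p) w = 0" "ip G (F p) w (n p) = 0"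
  using cov_n_n[OF p, of \<eta>] ip_commute[OF Fp, of w] by (simp_all add: w_def)

text \<open>Up to the factor \<open>det2 \<xi> \<eta>\<close>, \<open>lam\<close> is
  \<open>mu\<close> evaluated on \<open>dir \<xi> F\<close>, \<open>dir \<eta> F\<close> and
  \<open>n\<close>. As \<open>dir \<eta> F\<close> is zero at p, the product rule retains only its
  derivative, and for a vanishing field the ordinary derivative is the covariant one.\<close>

lemma dir_lam_mu: "det2 \<xi> \<eta> * dir X lam p = mu G (F p) (dir \<xi> F p) (cov (dir \<eta> F) p X) (n p)"
proof -
  let ?Z = "\<lambda>x. sqrt (det (G (F x))) *\<^sub>R cross3 (n x) (dir \<xi> F x)"
  have "det2 \<xi> \<eta> * dir X lam p = dir X (\<lambda>x. det2 \<xi> \<eta> * lam x) p"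
    by (rule dir_bounded_linear[OF bounded_linear_mult_right differentiable_lam[OF p], symmetric])
  also have "\<dots> = dir X (\<lambda>x. dir \<eta> F x \<bullet> ?Z x) p"
  proof (rule dir_cong_open[OF openOm p])
    show "(\<lambda>x. det2 \<xi> \<eta> * lam x) differentiable at p"
      by (rule smooth_on_differentiable[OF smooth_on_mult[OF openOm smooth_on_const[OF openOm] smooth_lam] openOm p])
    show "det2 \<xi> \<eta> * lam y = dir \<eta> F y \<bullet> ?Z y" if "y \<in> Om" for y
      unfolding mu_dir[OF that, symmetric] mu_cross ..
  qed
  also have "\<dots> = dir \<eta> F p \<bullet> dir X ?Z p + dir X (dir \<eta> F) p \<bullet> ?Z p"
    by (rule dir_bilinear[OF bounded_bilinear_inner smooth_on_differentiable[OF smooth_dirF openOm p]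
        smooth_on_differentiable[OF smooth_normal_cross openOm p]])
  also have "\<dots> = cov (dir \<eta> F) p X \<bullet> ?Z p"
    by (simp add: null cov_def Gam_simps)
  finally show ?thesis unfolding mu_cross .
qed

text \<open>Non-degeneracy forces rank one: if \<open>dir \<xi> F p\<close> vanished too,
  \<open>dir_lam_mu\<close> would make the differential of \<open>lam\<close> zero.\<close>

lemma tangent_nonzero: "det2 \<xi> \<eta> \<noteq> 0 \<Longrightarrow> dir \<xi> F p \<noteq> 0"
  using dir_lam_mu[of \<xi>] nondegenerate by (auto simp: mu_def det_3)

lemma mu_w_nonzero:
  assumes "det2 \<xi> \<eta> \<noteq> 0"
  shows "mu G (F p) (dir \<xi> F p) w (n p) \<noteq> 0"
proof
  assume "mu G (F p) (dir \<xi> F p) w (n p) = 0"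
  then have "(mu G (F p) (dir \<xi> F p) w (n p))\<^sup>2 = 0" by simp
  then have "ip G (F p) (dir \<xi> F p) (dir \<xi> F p) * ip G (F p) w w = 0"
    unfolding mu_gram[OF Fp]
    by (simp add: det_3 tangent_w normal_w normal[OF p] normal'[OF p] unit[OF p])
  then show False using w_pos ip_pos[OF Fp tangent_nonzero[OF assms]] by simp
qed

lemma kappa_nonzero: "det2 \<xi> \<eta> \<noteq> 0 \<Longrightarrow> \<kappa> \<xi> \<noteq> 0"
  using mu_w_nonzero w_pos by (simp add: \<kappa>_def)

lemma decompose:
  assumes "det2 \<xi> \<eta> \<noteq> 0"
  shows "X = (ip G (F p) (dir \<xi> F p) X / ip G (F p) (dir \<xi> F p) (dir \<xi> F p)) *\<^sub>R dir \<xi> F p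
     + (ip G (F p) w X / ip G (F p) w w) *\<^sub>R w + ip G (F p) (n p) X *\<^sub>R n p"
proof -
  let ?v = "X - ((ip G (F p) (dir \<xi> F p) X / ip G (F p) (dir \<xi> F p) (dir \<xi> F p)) *\<^sub>R dir \<xi> F p
     + (ip G (F p) w X / ip G (F p) w w) *\<^sub>R w + ip G (F p) (n p) X *\<^sub>R n p)"
  have "ip G (F p) (dir \<xi> F p) (dir \<xi> F p) > 0" by (rule ip_pos[OF Fp tangent_nonzero[OF assms]])
  then have "?v = 0"
    using w_pos
    by (intro ortho_basis[OF Fp mu_w_nonzero[OF assms]])
      (simp_all add: ip_simps tangent_w normal_w normal[OF p] normal'[OF p] unit[OF p])
  then show ?thesis by simp
qed

lemma mu_w:
  assumes "det2 \<xi> \<eta> \<noteq> 0"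
  shows "mu G (F p) (dir \<xi> F p) X (n p) = \<kappa> \<xi> * ip G (F p) X w"
  by (subst decompose[OF assms, of X])
    (simp add: mu_simps \<kappa>_def ip_commute[OF Fp, of w X])

lemma dir_lam:
  assumes "det2 \<xi> \<eta> \<noteq> 0"
  shows "det2 \<xi> \<eta> * dir X lam p = \<kappa> \<xi> * ip G (F p) (cov (dir \<eta> F) p X) w"
  unfolding dir_lam_mu mu_w[OF assms] ..

lemma dir_II: "dir X (\<lambda>x. II x a b) p = - ip G (F p) (cov (dir a F) p X) (cov n p b) - ip G (F p) (dir a F p) (cov (\<lambda>x. cov n x b) p X)"
proof -
  have "dir X (\<lambda>x. II x a b) p = - dir X (\<lambda>x. ip G (F x) (dir a F x) (cov n x b)) p"
    unfolding II_def
    by (rule dir_uminus[OF smooth_on_differentiable[OF smooth_ip[OF smooth_dirF smooth_cov[OF smoothn]] openOm p]])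
  then show ?thesis
    using dir_ip[OF smooth_dirF[of a] smooth_cov[OF smoothn, of b] p, of X] by simp
qed

text \<open>Up to sign this is the pairing with \<open>w\<close> that appears in
  \<open>dir_lam\<close>: the differentials of \<open>lam\<close> and of II(\<eta>,\<eta>) are
  proportional at p, with a nonzero factor.\<close>

lemma dir_II_null: "dir X (\<lambda>x. II x \<eta> \<eta>) p = - ip G (F p) (cov (dir \<eta> F) p X) w"
  by (simp add: dir_II null ip_simps w_def)

text \<open>At a singular point the shape of \<open>II\<close> is forced by \<open>II(\<eta>, \<cdot>) = 0\<close>, so that only one term of the
  differential of the determinant survives.\<close>

lemma dir_D:
  "(det2 \<xi> \<eta>)\<^sup>2 * dir X D p = II p \<xi> \<xi> * dir X (\<lambda>x. II x \<eta> \<eta>) p"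
proof -
  note s = smooth_II
  have sm: "smooth_on Om (\<lambda>x. II x a b * II x c d)" for a b c d by (rule smooth_on_mult[OF openOm s s])
  have "(det2 \<xi> \<eta>)\<^sup>2 * dir X D p = dir X (\<lambda>x. (det2 \<xi> \<eta>)\<^sup>2 * D x) p"
    by (rule dir_bounded_linear[OF bounded_linear_mult_right smooth_on_differentiable[OF smooth_D openOm p], symmetric])
  also have "\<dots> = dir X (\<lambda>x. II x \<xi> \<xi> * II x \<eta> \<eta> - II x \<xi> \<eta> * II x \<eta> \<xi>) p"
    by (rule dir_cong_open[OF openOm p II_minor[symmetric]
      smooth_on_differentiable[OF smooth_on_mult[OF openOm smooth_on_const[OF openOm] smooth_D] openOm p]])
  also have "\<dots> = dir X (\<lambda>x. II x \<xi> \<xi> * II x \<eta> \<eta>) p - dir X (\<lambda>x. II x \<xi> \<eta> * II x \<eta> \<xi>) p"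
    by (rule dir_diff[OF smooth_on_differentiable[OF sm openOm p] smooth_on_differentiable[OF sm openOm p]])
  also have "\<dots> = II p \<xi> \<xi> * dir X (\<lambda>x. II x \<eta> \<eta>) p"
    unfolding dir_mult[OF s s p] by (simp add: II_null)
  finally show ?thesis .
qed

text \<open>A direction X with \<open>dir X lam p \<noteq> 0\<close> also changes II(\<eta>,\<eta>),
  so \<open>dir_D\<close> forces II(\<xi>,\<xi>) = 0 for a \<xi> transversal to \<eta>; the entries
  involving \<eta> vanish at any singular point.\<close>

lemma II_vanishes:
  assumes "\<And>X. dir X D p = 0"
  shows "II p a b = 0"
proof -
  define \<xi> :: "real^2" where "\<xi> = vector [\<eta> $ 2, - \<eta> $ 1]"
  have d: "det2 \<xi> \<eta> \<noteq> 0"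
    using \<eta> by (auto simp: \<xi>_def det2_def vec_eq_iff forall_2 sum_power2_eq_zero_iff power2_eq_square[symmetric])
  obtain X where X: "dir X lam p \<noteq> 0" using nondegenerate by blast
  have "\<kappa> \<xi> * ip G (F p) (cov (dir \<eta> F) p X) w \<noteq> 0" using dir_lam[OF d, of X] d X by (metis mult_eq_0_iff)
  then have "dir X (\<lambda>x. II x \<eta> \<eta>) p \<noteq> 0" unfolding dir_II_null by simp
  then have "II p \<xi> \<xi> = 0" using dir_D[of \<xi> X] assms by simp
  then have "II p (x *\<^sub>R \<xi> + y *\<^sub>R \<eta>) (x' *\<^sub>R \<xi> + y' *\<^sub>R \<eta>) = 0" for x y x' y'
    by (simp add: bilinear_ladd[OF bilinear_II[OF p]] bilinear_radd[OF bilinear_II[OF p]]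
      bilinear_lmul[OF bilinear_II[OF p]] bilinear_rmul[OF bilinear_II[OF p]] II_null)
  then show ?thesis using det2_0D[OF d, of a] det2_0D[OF d, of b] by metis
qed

text \<open>The function \<open>D x - \<delta> * (lam x)\<^sup>2\<close> is nonnegative on
  \<open>U\<close> and zero at p, hence minimal there; the square of \<open>lam\<close> has zero
  differential at p, so the sign of \<delta> does not matter.\<close>

lemma II_vanishes_of_lower_bound:
  assumes U: "open U" "p \<in> U" "U \<subseteq> Om" and lower: "\<And>x. x \<in> U \<Longrightarrow> D x \<ge> \<delta> * (lam x)\<^sup>2"
  shows "II p a b = 0"
proof (rule II_vanishes)
  fix X
  let ?h = "\<lambda>x. D x - \<delta> * (lam x * lam x)"
  have s1: "smooth_on Om (\<lambda>x. lam x * lam x)" by (rule smooth_on_mult[OF openOm smooth_lam smooth_lam])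
  have s2: "smooth_on Om (\<lambda>x. \<delta> * (lam x * lam x))" by (rule smooth_on_mult[OF openOm smooth_on_const[OF openOm] s1])
  have s: "smooth_on Om ?h" by (rule smooth_on_diff[OF openOm smooth_D s2])
  have Dp: "D p = 0" by (rule D_singular[OF p lam_p])
  have "frechet_derivative ?h (at p) = (\<lambda>v. 0)"
  proof (rule differential_zero_maxmin[OF U(2,1)])
    show "(?h has_derivative frechet_derivative ?h (at p)) (at p)"
      using smooth_on_differentiable[OF s openOm p] by (simp only: frechet_derivative_works)
    show "(\<forall>y\<in>U. ?h y \<le> ?h p) \<or> (\<forall>y\<in>U. ?h p \<le> ?h y)"
      using lower by (simp add: Dp lam_p power2_eq_square)
  qed
  then have "0 = dir X ?h p" by simp
  also have "\<dots> = dir X D p - dir X (\<lambda>x. \<delta> * (lam x * lam x)) p"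
    by (rule dir_diff[OF smooth_on_differentiable[OF smooth_D openOm p] smooth_on_differentiable[OF s2 openOm p]])
  also have "dir X (\<lambda>x. \<delta> * (lam x * lam x)) p = \<delta> * dir X (\<lambda>x. lam x * lam x) p"
    by (rule dir_bounded_linear[OF bounded_linear_mult_right smooth_on_differentiable[OF s1 openOm p]])
  also have "\<dots> = 0" unfolding dir_mult[OF smooth_lam smooth_lam p] by (simp add: lam_p)
  finally show "dir X D p = 0" by simp
qed

lemma II_quotient_limit:
  assumes "smooth_on Om h" "h p = 0"
  shows "((\<lambda>s. h (p + s *\<^sub>R \<eta>) / s) \<longlongrightarrow> dir \<eta> h p) (at 0)"
proof -
  have "((\<lambda>s. p + s *\<^sub>R \<eta>) has_derivative (\<lambda>r. r *\<^sub>R \<eta>)) (at 0)"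
    by (auto intro!: derivative_eq_intros)
  moreover have h: "h differentiable (at p)" by (rule smooth_on_differentiable[OF assms(1) openOm p])
  then have "(h has_derivative frechet_derivative h (at p)) (at (p + 0 *\<^sub>R \<eta>))"
    by (simp add: frechet_derivative_works)
  ultimately have "((\<lambda>s. h (p + s *\<^sub>R \<eta>)) has_derivative (\<lambda>r. dir (r *\<^sub>R \<eta>) h p)) (at 0)"
    by (rule has_derivative_compose)
  moreover have "(\<lambda>r. dir (r *\<^sub>R \<eta>) h p) = (*) (dir \<eta> h p)"
    using dir_scale[OF h] by (simp add: fun_eq_iff mult.commute)
  ultimately have "((\<lambda>s. h (p + s *\<^sub>R \<eta>)) has_field_derivative dir \<eta> h p) (at 0)"
    by (simp only: has_field_derivative_def)
  then show ?thesis by (simp add: DERIV_def assms(2))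
qed

text \<open>Since \<open>II\<close> vanishes at \<open>p\<close>, both sides of \<open>D \<ge> \<delta> lam\<^sup>2\<close> are of second order along \<open>p + s \<eta>\<close>; this is
  the inequality between their leading coefficients.\<close>

lemma dir_II_minor:
  assumes U: "open U" "p \<in> U" "U \<subseteq> Om" and lower: "\<And>x. x \<in> U \<Longrightarrow> D x \<ge> \<delta> * (lam x)\<^sup>2"
    and II0: "\<And>a b. II p a b = 0"
  shows "dir \<eta> (\<lambda>x. II x a a) p * dir \<eta> (\<lambda>x. II x b b) p - dir \<eta> (\<lambda>x. II x a b) p * dir \<eta> (\<lambda>x. II x b a) p
    \<ge> (det2 a b)\<^sup>2 * \<delta> * (dir \<eta> lam p)\<^sup>2"
proof (rule tendsto_le[of "at (0::real)"])
  let ?q = "\<lambda>s. p + s *\<^sub>R \<eta>"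
  let ?f = "\<lambda>s. (II (?q s) a a / s) * (II (?q s) b b / s) - (II (?q s) a b / s) * (II (?q s) b a / s)"
  let ?g = "\<lambda>s. (det2 a b)\<^sup>2 * \<delta> * (lam (?q s) / s)\<^sup>2"
  show "(?f \<longlongrightarrow> dir \<eta> (\<lambda>x. II x a a) p * dir \<eta> (\<lambda>x. II x b b) p - dir \<eta> (\<lambda>x. II x a b) p * dir \<eta> (\<lambda>x. II x b a) p) (at 0)"
    by (intro tendsto_diff tendsto_mult II_quotient_limit smooth_II II0)
  show "(?g \<longlongrightarrow> (det2 a b)\<^sup>2 * \<delta> * (dir \<eta> lam p)\<^sup>2) (at 0)"
    by (intro tendsto_mult tendsto_const tendsto_power II_quotient_limit smooth_lam lam_p)
  have "((\<lambda>s. ?q s) \<longlongrightarrow> ?q 0) (at 0)" by (intro tendsto_intros)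
  then have "\<forall>\<^sub>F s in at 0. ?q s \<in> U" using U(1,2) by (intro topological_tendstoD) auto
  then show "\<forall>\<^sub>F s in at 0. ?g s \<le> ?f s"
  proof (rule eventually_rev_mp[OF _ eventuallyI], intro impI)
    fix s assume s: "?q s \<in> U"
    then have o: "?q s \<in> Om" using U(3) by blast
    have "?g s = (det2 a b)\<^sup>2 * (\<delta> * (lam (?q s))\<^sup>2) / s\<^sup>2" by (simp add: power_divide)
    also have "\<dots> \<le> (det2 a b)\<^sup>2 * D (?q s) / s\<^sup>2"
      by (intro divide_right_mono mult_left_mono lower s) auto
    also have "\<dots> = ?f s" unfolding II_minor[OF o, symmetric] by (simp add: diff_divide_distrib power2_eq_square)
    finally show "?g s \<le> ?f s" .
  qed
qed simp

text \<open>Here \<open>T\<close> is the velocity and \<open>T'\<close> the coordinate acceleration of the singular curve, so that the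
  determinant on the left is the numerator of the singular curvature. By the Codazzi equation,
  \<open>D\<^sub>T F\<^sub>T\<close> paired with \<open>w = D\<^sub>\<eta> n\<close> is the derivative of \<open>II(T, T)\<close> in the direction \<open>\<eta>\<close>.\<close>

lemma cuspidal_edge_inequality:
  assumes U: "open U" "p \<in> U" "U \<subseteq> Om" and lower: "\<And>x. x \<in> U \<Longrightarrow> D x \<ge> \<delta> * (lam x)\<^sup>2"
    and T: "det2 T \<eta> > 0" "dir T lam p = 0"
  shows "mu G (F p) (dir T F p) (cov (dir T F) p T + dir T' F p) (n p) * dir \<eta> lam p
    \<le> - \<delta> * det2 T \<eta> * (\<kappa> T * dir \<eta> lam p)\<^sup>2"
proof -
  have d: "det2 T \<eta> \<noteq> 0" using T by simp
  have II0: "II p a b = 0" for a b by (rule II_vanishes_of_lower_bound[OF U lower])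
  let ?B = "\<lambda>a b. dir \<eta> (\<lambda>x. II x a b) p"
  have k: "\<kappa> T \<noteq> 0" by (rule kappa_nonzero[OF d])
  \<comment> \<open>As \<open>lam\<close> has zero derivative along T, \<open>dir_lam\<close> shows
    that the covariant derivative of \<open>dir \<eta> F\<close> along T has no
    \<open>w\<close>-component.\<close>
  have Tw: "ip G (F p) (cov (dir \<eta> F) p T) w = 0"
    using dir_lam[OF d, of T] T(2) k by simp
  \<comment> \<open>In the adapted frame the component along \<open>dir T F p\<close> is a multiple
    of II(T,T) = 0, and the normal component vanishes because n has unit length; only
    \<open>w\<close> is left.\<close>
  have "cov n p T = (ip G (F p) w (cov n p T) / ip G (F p) w w) *\<^sub>R w"
    using decompose[OF d, of "cov n p T"] II0[of T T] cov_n_n[OF p, of T] by (simp add: II_def)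
  then have cT: "ip G (F p) (cov (dir \<eta> F) p T) (cov n p T) = 0"
    using Tw by (metis ip_scale_right mult_zero_right)
  \<comment> \<open>II(T,\<eta>) = II(\<eta>,T) is differentiated along T. On the right one term
    contains \<open>dir \<eta> F p = 0\<close> and the other is \<open>cT\<close>; the left side
    then trades a second derivative of n for one of \<open>F\<close>.\<close>
  have "dir T (\<lambda>x. II x T \<eta>) p = dir T (\<lambda>x. II x \<eta> T) p"
    by (rule dir_cong_open[OF openOm p II_commute differentiable_II[OF p]])
  also have "\<dots> = 0" unfolding dir_II by (simp add: cT null ip_simps)
  finally have 1: "ip G (F p) (dir T F p) (cov (\<lambda>x. cov n x \<eta>) p T) = - ip G (F p) (cov (dir T F) p T) w"
    unfolding dir_II by (simp add: w_def)
  \<comment> \<open>Codazzi: the curvature term contains \<open>dir \<eta> F p = 0\<close>, so the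
    two covariant derivatives of n commute at p.\<close>
  have "cov (\<lambda>x. cov n x T) p \<eta> = cov (\<lambda>x. cov n x \<eta>) p T"
    using cov_commutator[OF smoothn p, where v=T and u=\<eta>] linear_0[OF linear_Rm(1)[OF Fp]] by (simp add: null)
  then have BTT: "?B T T = ip G (F p) (cov (dir T F) p T) w"
    unfolding dir_II using cT torsion_free[OF p, of T \<eta>] 1 by simp
  \<comment> \<open>The term with T' is an image under the differential of \<open>F\<close>, hence
    orthogonal to \<open>w\<close>, and drops out.\<close>
  have N: "mu G (F p) (dir T F p) (cov (dir T F) p T + dir T' F p) (n p) = \<kappa> T * ?B T T"
    unfolding mu_w[OF d] BTT by (simp add: ip_simps tangent_w)
  have E: "\<kappa> T * ?B \<eta> \<eta> = - det2 T \<eta> * dir \<eta> lam p"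
    using dir_lam[OF d, of \<eta>] by (simp add: dir_II_null)
  have "?B T \<eta> = ?B \<eta> T"
    by (rule dir_cong_open[OF openOm p II_commute differentiable_II[OF p]])
  \<comment> \<open>By the symmetry of \<open>II\<close> the off-diagonal product is a square;
    omitting it from the minor leaves a lower bound for the diagonal product.\<close>
  then have "?B T \<eta> * ?B \<eta> T \<ge> 0" by simp
  then have "?B T T * ?B \<eta> \<eta> \<ge> (det2 T \<eta>)\<^sup>2 * \<delta> * (dir \<eta> lam p)\<^sup>2"
    using dir_II_minor[OF U lower II0, of T \<eta>] by linarith
  \<comment> \<open>One factor \<open>\<kappa> T\<close> for each diagonal entry, so that
    \<open>N\<close> and \<open>E\<close> can replace them by the numerator of the singular
    curvature and by the derivative of \<open>lam\<close>.\<close>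
  then have "(\<kappa> T)\<^sup>2 * (?B T T * ?B \<eta> \<eta>) \<ge> (\<kappa> T)\<^sup>2 * ((det2 T \<eta>)\<^sup>2 * \<delta> * (dir \<eta> lam p)\<^sup>2)"
    by (rule mult_left_mono) simp
  also have "(\<kappa> T)\<^sup>2 * (?B T T * ?B \<eta> \<eta>) = (\<kappa> T * ?B T T) * (\<kappa> T * ?B \<eta> \<eta>)" by (simp add: power2_eq_square)
  also have "\<dots> = det2 T \<eta> * (- (\<kappa> T * ?B T T) * dir \<eta> lam p)" unfolding E by simp
  also have "(\<kappa> T)\<^sup>2 * ((det2 T \<eta>)\<^sup>2 * \<delta> * (dir \<eta> lam p)\<^sup>2) = det2 T \<eta> * (\<delta> * det2 T \<eta> * (\<kappa> T * dir \<eta> lam p)\<^sup>2)"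
    by (simp add: power2_eq_square)
  finally have "\<delta> * det2 T \<eta> * (\<kappa> T * dir \<eta> lam p)\<^sup>2 \<le> - (\<kappa> T * ?B T T) * dir \<eta> lam p"
    by (rule mult_left_le_imp_le[OF _ T(1)])
  then show ?thesis unfolding N by simp
qed

end

section \<open>Quadratic bound for \<open>D\<close> near a singular curve\<close>

context local_front begin

lemma segment_mvt:
  fixes h :: "real^2 \<Rightarrow> real"
  assumes h: "smooth_on Om h" and r: "cball p r \<subseteq> Om" and y: "y \<in> cball p r" "y + s *\<^sub>R e \<in> cball p r"
  shows "\<exists>z\<in>cball p r. h (y + s *\<^sub>R e) - h y = s * dir e h z"
proof -
  have seg: "y + t *\<^sub>R (s *\<^sub>R e) \<in> cball p r" if "0 \<le> t" "t \<le> 1" for t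
  proof -
    have "(1 - t) *\<^sub>R y + t *\<^sub>R (y + s *\<^sub>R e) \<in> cball p r"
      by (rule convexD_alt[OF convex_cball y that])
    then show ?thesis by (simp add: algebra_simps)
  qed
  have "\<exists>z>0. z < 1 \<and> h (y + 1 *\<^sub>R (s *\<^sub>R e)) - h (y + 0 *\<^sub>R (s *\<^sub>R e)) = (1 - 0) * dir (s *\<^sub>R e) h (y + z *\<^sub>R (s *\<^sub>R e))"
  proof (rule MVT2)
    fix t :: real assume t: "0 \<le> t" "t \<le> 1"
    let ?y = "y + t *\<^sub>R (s *\<^sub>R e)"
    have hd: "h differentiable (at ?y)" using smooth_on_differentiable[OF h openOm] seg[OF t] r by blast
    have "((\<lambda>t. y + t *\<^sub>R (s *\<^sub>R e)) has_derivative (\<lambda>q. q *\<^sub>R (s *\<^sub>R e))) (at t)"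
      by (auto intro!: derivative_eq_intros)
    from has_derivative_compose[OF this hd[unfolded frechet_derivative_works]]
    have "((\<lambda>t. h (y + t *\<^sub>R (s *\<^sub>R e))) has_derivative (\<lambda>q. dir (q *\<^sub>R (s *\<^sub>R e)) h ?y)) (at t)" .
    moreover have "(\<lambda>q. dir (q *\<^sub>R (s *\<^sub>R e)) h ?y) = (*) (dir (s *\<^sub>R e) h ?y)"
      using dir_scale[OF hd, of _ "s *\<^sub>R e"] by (simp add: fun_eq_iff mult.commute)
    ultimately show "((\<lambda>t. h (y + t *\<^sub>R (s *\<^sub>R e))) has_field_derivative dir (s *\<^sub>R e) h ?y) (at t)"
      by (simp only: has_field_derivative_def)
  qed simp
  then obtain z where z: "0 < z" "z < 1" "h (y + s *\<^sub>R e) - h y = dir (s *\<^sub>R e) h (y + z *\<^sub>R (s *\<^sub>R e))"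
    by auto
  have zc: "y + z *\<^sub>R (s *\<^sub>R e) \<in> cball p r" using seg z by simp
  moreover have "h differentiable (at (y + z *\<^sub>R (s *\<^sub>R e)))"
    using smooth_on_differentiable[OF h openOm] zc r by blast
  ultimately show ?thesis
    using z(3) dir_scale by (metis real_scaleR_def)
qed

lemma singular_curve_tangent:
  assumes c: "(c has_vector_derivative T) (at t)" "c t \<in> Om" and z: "\<forall>\<^sub>F s in nhds t. lam (c s) = 0"
  shows "dir T lam (c t) = 0"
proof -
  have "(lam \<circ> c has_derivative (\<lambda>q. dir (q *\<^sub>R T) lam (c t))) (at t)"
    using diff_chain_at[OF c(1)[unfolded has_vector_derivative_def] differentiable_lam[OF c(2), unfolded frechet_derivative_works]]
    by (simp add: comp_def)
  moreover have "(lam \<circ> c has_derivative (\<lambda>q. 0)) (at t)"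
  proof -
    obtain S where S: "open S" "t \<in> S" "\<forall>s\<in>S. lam (c s) = 0" using z unfolding eventually_nhds by blast
    show ?thesis
      by (rule has_derivative_transform_within_open[OF has_derivative_const S(1,2)]) (use S in auto)
  qed
  ultimately have "(\<lambda>q. dir (q *\<^sub>R T) lam (c t)) = (\<lambda>q. 0)" by (rule has_derivative_unique)
  then show ?thesis by (metis scaleR_one)
qed

text \<open>Every point near \<open>c t0\<close> is of the form \<open>c t + s e\<close> with \<open>e\<close> transversal to the curve; along this
  segment \<open>lam\<close> grows at least and \<open>II\<close> at most linearly in \<open>s\<close>.\<close>

lemma D_bound_near_curve:
  assumes c: "(c has_vector_derivative T) (at t0)" "T \<noteq> 0" "c t0 \<in> Om" "d > 0" "continuous_on {t0 - d..t0 + d} c"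
    and on_curve: "\<And>t. \<bar>t - t0\<bar> \<le> d \<Longrightarrow> c t \<in> Om \<Longrightarrow> lam (c t) = 0 \<and> (\<forall>a b. II (c t) a b = 0)"
    and nondeg: "dir e\<^sub>0 lam (c t0) \<noteq> 0"
  shows "\<exists>U C. open U \<and> c t0 \<in> U \<and> U \<subseteq> Om \<and> (\<forall>x\<in>U. \<bar>D x\<bar> \<le> C * (lam x)\<^sup>2)"
proof -
  define p where "p = c t0"
  have p: "p \<in> Om" using c(3) by (simp add: p_def)
  have isc: "isCont c t0" using c(1) by (rule has_vector_derivative_continuous)
  then have evO: "\<forall>\<^sub>F t in nhds t0. c t \<in> Om"
    using topological_tendstoD[of c "c t0" "nhds t0" Om] openOm c(3) by (simp add: isCont_def tendsto_at_iff_tendsto_nhds)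
  have "\<forall>\<^sub>F t in nhds t0. \<bar>t - t0\<bar> \<le> d"
    unfolding eventually_nhds_metric using c(4) by (auto simp: dist_real_def intro!: exI[of _ d])
  with evO have "\<forall>\<^sub>F t in nhds t0. lam (c t) = 0"
    by eventually_elim (use on_curve in blast)
  then have Tlam: "dir T lam p = 0" unfolding p_def by (rule singular_curve_tangent[OF c(1,3)])
  have linlam: "linear (frechet_derivative lam (at p))"
    by (rule linear_frechet_derivative[OF differentiable_lam[OF p]])
  have e0: "e\<^sub>0 \<noteq> 0" using nondeg linear_0[OF linlam] by (auto simp: p_def)
  have dT: "det2 T e\<^sub>0 \<noteq> 0"
  proof
    assume "det2 T e\<^sub>0 = 0"
    then obtain r where r: "T = r *\<^sub>R e\<^sub>0" using det2_eq_0[OF e0] by blast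
    then have "r * dir e\<^sub>0 lam p = 0" using Tlam linear_cmul[OF linlam] by simp
    then show False using nondeg r c(2) by (simp add: p_def)
  qed
  \<comment> \<open>The sign makes \<open>\<phi>\<close> below increase through
    \<open>t0\<close>.\<close>
  define e where "e = sgn (det2 T e\<^sub>0) *\<^sub>R e\<^sub>0"
  have e: "det2 T e > 0" "e \<noteq> 0" "dir e lam p \<noteq> 0"
    using dT e0 nondeg linear_cmul[OF linlam] by (auto simp: e_def det2_def p_def sgn_if algebra_simps)
  obtain r0 where r0: "r0 > 0" "cball p r0 \<subseteq> Om" using openOm p open_contains_cball by blast
  have contl: "continuous_on Om (dir e lam)" by (rule smooth_on_continuous[OF smooth_on_dir[OF smooth_lam openOm]])
  define m where "m = \<bar>dir e lam p\<bar> / 2"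
  have m: "m > 0" using e(3) by (simp add: m_def)
  obtain r1 where r1: "r1 > 0" "\<And>x. x \<in> Om \<Longrightarrow> dist x p < r1 \<Longrightarrow> dist (dir e lam x) (dir e lam p) < m"
    using contl p m unfolding continuous_on_iff by meson
  define r where "r = min r0 (r1 / 2)"
  have r: "r > 0" "cball p r \<subseteq> Om" using r0 r1 by (auto simp: r_def)
  have lower: "\<bar>dir e lam x\<bar> \<ge> m" if "x \<in> cball p r" for x
  proof -
    have "dist x p < r1" using that r1(1) by (auto simp: r_def dist_commute)
    then have "dist (dir e lam x) (dir e lam p) < m" using r1(2) that r by blast
    then show ?thesis unfolding dist_real_def m_def by linarith
  qed
  have "\<exists>M. \<forall>x\<in>cball p r. \<bar>dir e (\<lambda>x. II x a b) x\<bar> \<le> M" for a b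
  proof -
    have "continuous_on (cball p r) (dir e (\<lambda>x. II x a b))"
      by (rule continuous_on_subset[OF smooth_on_continuous[OF smooth_on_dir[OF smooth_II openOm]] r(2)])
    then have "bounded (dir e (\<lambda>x. II x a b) ` cball p r)"
      by (rule compact_imp_bounded[OF compact_continuous_image[OF _ compact_cball]])
    then show ?thesis unfolding bounded_iff by auto
  qed
  then obtain M where M: "\<And>a b x. x \<in> cball p r \<Longrightarrow> \<bar>dir e (\<lambda>x. II x a b) x\<bar> \<le> M a b" by metis
  \<comment> \<open>A linear function constant along lines of direction e, evaluated on the curve:
    if it has the same value at x and at \<open>c t\<close>, then x - c t is a multiple of
    e.\<close>
  define \<phi> where "\<phi> t = det2 (c t - p) e" for t
  have \<phi>0: "\<phi> t0 = 0" by (simp add: \<phi>_def p_def det2_def)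
  have d\<phi>: "(\<phi> has_real_derivative det2 T e) (at t0)"
  proof -
    have bl: "bounded_linear (\<lambda>v. det2 v e)"
      unfolding det2_def
      by (intro bounded_linear_sub bounded_linear_compose[OF bounded_linear_mult_left bounded_linear_vec_nth])
    have "((\<lambda>t. c t - p) has_vector_derivative T) (at t0)"
      using c(1) by (auto intro!: derivative_eq_intros)
    from bounded_linear.has_vector_derivative[OF bl this] show ?thesis
      by (simp add: \<phi>_def[abs_def] has_real_derivative_iff_has_vector_derivative)
  qed
  obtain d1 where d1: "d1 > 0" "\<And>h. 0 < h \<Longrightarrow> h < d1 \<Longrightarrow> \<phi> t0 < \<phi> (t0 + h)"
    using DERIV_pos_inc_right[OF d\<phi> e(1)] by blast
  obtain d2 where d2: "d2 > 0" "\<And>h. 0 < h \<Longrightarrow> h < d2 \<Longrightarrow> \<phi> (t0 - h) < \<phi> t0"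
    using DERIV_pos_inc_left[OF d\<phi> e(1)] by blast
  obtain d3 where d3: "d3 > 0" "\<And>t. dist t t0 < d3 \<Longrightarrow> dist (c t) p < r"
    using isc r(1) unfolding continuous_at_eps_delta p_def by (metis dist_norm real_norm_def)
  define h where "h = min (min d1 d2) (min d3 d) / 2"
  have h: "0 < h" "h < d1" "h < d2" "h < d3" "h < d" using d1 d2 d3 c(4) by (auto simp: h_def)
  \<comment> \<open>The strip between the levels attained at \<open>t0 - h\<close> and
    \<open>t0 + h\<close>: the intermediate value theorem then finds a curve point on the line of
    direction e through each x in \<open>U\<close>.\<close>
  define U where "U = {x. \<phi> (t0 - h) < det2 (x - p) e} \<inter> {x. det2 (x - p) e < \<phi> (t0 + h)} \<inter> ball p r"
  have "open U"
    unfolding U_def det2_def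
    by (intro open_Int open_Collect_less open_ball continuous_intros)
  moreover have "p \<in> U" using d1(2)[OF h(1,2)] d2(2)[OF h(1,3)] r(1) \<phi>0 by (auto simp: U_def det2_def)
  moreover have "U \<subseteq> Om" using r(2) by (auto simp: U_def)
  \<comment> \<open>Each entry of \<open>II\<close> is at most |M| |s| and |s| is at most |lam| / m;
    the two products in \<open>D\<close> contribute one summand each.\<close>
  moreover define C where "C = (\<bar>M (axis 1 1) (axis 1 1)\<bar> * \<bar>M (axis 2 1) (axis 2 1)\<bar>
      + \<bar>M (axis 1 1) (axis 2 1)\<bar> * \<bar>M (axis 2 1) (axis 1 1)\<bar>) / m\<^sup>2"
  have "\<bar>D x\<bar> \<le> C * (lam x)\<^sup>2" if x: "x \<in> U" for x
  proof -
    have cont: "continuous_on {t0 - h..t0 + h} \<phi>"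
      unfolding \<phi>_def det2_def
      by (intro continuous_intros continuous_on_subset[OF c(5)]) (use h in auto)
    have "\<exists>t\<ge>t0 - h. t \<le> t0 + h \<and> \<phi> t = det2 (x - p) e"
      by (rule IVT'[OF _ _ _ cont]) (use x h in \<open>auto simp: U_def\<close>)
    then obtain t where t': "t0 - h \<le> t" "t \<le> t0 + h" "\<phi> t = det2 (x - p) e" by blast
    have "\<bar>t - t0\<bar> \<le> h" using t' by linarith
    note t = this t'(3)
    have ct: "c t \<in> cball p r" using d3(2)[of t] t h by (force simp: dist_real_def dist_commute)
    then have z: "lam (c t) = 0" "\<And>a b. II (c t) a b = 0" using on_curve[of t] t h r(2) by auto
    have "det2 (x - c t) e = 0" using t(2) by (simp add: \<phi>_def det2_def algebra_simps)
    then obtain s where "x - c t = s *\<^sub>R e" using det2_eq_0[OF e(2)] by blast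
    then have xs: "x = c t + s *\<^sub>R e" by (simp add: algebra_simps)
    have xc: "c t + s *\<^sub>R e \<in> cball p r" using x xs by (auto simp: U_def)
    have l: "m * \<bar>s\<bar> \<le> \<bar>lam x\<bar>"
    proof -
      obtain z where z': "z \<in> cball p r" "lam x - 0 = s * dir e lam z"
        using segment_mvt[OF smooth_lam r(2) ct xc] z(1) xs by metis
      show ?thesis
        using mult_right_mono[OF lower[OF z'(1)] abs_ge_zero[of s]] z'(2) by (simp add: abs_mult mult.commute)
    qed
    have i: "\<bar>II x a b\<bar> \<le> \<bar>M a b\<bar> * \<bar>s\<bar>" for a b
    proof -
      obtain z where z': "z \<in> cball p r" "II x a b - 0 = s * dir e (\<lambda>x. II x a b) z"
        using segment_mvt[OF smooth_II r(2) ct xc, of a b] z(2) xs by metis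
      show ?thesis
        using mult_right_mono[OF order_trans[OF M[OF z'(1), of a b] abs_ge_self] abs_ge_zero[of s]] z'(2)
        by (simp add: abs_mult mult.commute)
    qed
    have ii: "\<bar>II x a b * II x a' b'\<bar> \<le> (\<bar>M a b\<bar> * \<bar>M a' b'\<bar>) * s\<^sup>2" for a b a' b'
    proof -
      have "\<bar>II x a b\<bar> * \<bar>II x a' b'\<bar> \<le> (\<bar>M a b\<bar> * \<bar>s\<bar>) * (\<bar>M a' b'\<bar> * \<bar>s\<bar>)"
        by (intro mult_mono i) auto
      also have "\<dots> = (\<bar>M a b\<bar> * \<bar>M a' b'\<bar>) * \<bar>s\<bar>\<^sup>2" by (simp only: power2_eq_square mult_ac)
      finally show ?thesis by (simp add: abs_mult)
    qed
    have Cm: "C * m\<^sup>2 = \<bar>M (axis 1 1) (axis 1 1)\<bar> * \<bar>M (axis 2 1) (axis 2 1)\<bar>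
      + \<bar>M (axis 1 1) (axis 2 1)\<bar> * \<bar>M (axis 2 1) (axis 1 1)\<bar>" using m by (simp add: C_def)
    have "\<bar>D x\<bar> \<le> C * m\<^sup>2 * s\<^sup>2"
      unfolding D_def Cm distrib_right using ii[of "axis 1 1" "axis 1 1" "axis 2 1" "axis 2 1"] ii[of "axis 1 1" "axis 2 1" "axis 2 1" "axis 1 1"]
        abs_triangle_ineq4[of "II x (axis 1 1) (axis 1 1) * II x (axis 2 1) (axis 2 1)" "II x (axis 1 1) (axis 2 1) * II x (axis 2 1) (axis 1 1)"]
      by linarith
    also have "\<dots> = C * (m * \<bar>s\<bar>)\<^sup>2" by (simp add: power_mult_distrib)
    also have "\<dots> \<le> C * (lam x)\<^sup>2"
    proof (rule mult_left_mono)
      show "(m * \<bar>s\<bar>)\<^sup>2 \<le> (lam x)\<^sup>2" using power_mono[OF l, of 2] m by simp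
    qed (simp add: C_def)
    finally show ?thesis .
  qed
  ultimately show ?thesis unfolding p_def by blast
qed

end


section \<open>Independence of the charts\<close>

lemma jacobian_dir:
  fixes F :: "real^'n \<Rightarrow> real^'m"
  shows "F differentiable (at x) \<Longrightarrow> jacobian F (at x) *v v = dir v F x"
  by (rule dir_eqI[symmetric]) (simp add: jacobian_works[symmetric])

text \<open>A chain rule in which the inner direction n x moves with x: it is expanded in the basis
  and reassembled. It describes the derivative of a vector field along a map after a change of
  target chart, and the acceleration of the image of a curve.\<close>

lemma dir_dir_compose:
  fixes F n :: "'a::real_normed_vector \<Rightarrow> 'b::euclidean_space" and \<tau> :: "'b \<Rightarrow> 'c::real_normed_vector"
  assumes S: "open S" "x \<in> S" and T: "open T" "F ` S \<subseteq> T" and F: "F differentiable (at x)" and n: "n differentiable (at x)"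
    and \<tau>: "smooth_on T \<tau>"
  shows "dir b (\<lambda>x. dir (n x) \<tau> (F x)) x = dir (dir b n x) \<tau> (F x) + dir (dir b F x) (dir (n x) \<tau>) (F x)"
    and "(\<lambda>x. dir (n x) \<tau> (F x)) differentiable (at x)"
proof -
  have Fx: "F x \<in> T" using S T by blast
  have d\<tau>: "\<tau> differentiable (at y)" if "y \<in> T" for y by (rule smooth_on_differentiable[OF \<tau> T(1) that])
  have di: "dir i \<tau> differentiable (at (F x))" for i
    by (rule smooth_on_differentiable[OF smooth_on_dir[OF \<tau> T(1)] T(1) Fx])
  have diF: "(\<lambda>x. dir i \<tau> (F x)) differentiable (at x)" for i
    using differentiable_compose[of "dir i \<tau>" F x UNIV] di F by simp
  have ni: "(\<lambda>x. n x \<bullet> i) differentiable (at x)" for i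
    using n by (intro differentiable_inner) auto
  have prod: "(\<lambda>x. (n x \<bullet> i) *\<^sub>R dir i \<tau> (F x)) differentiable (at x)" for i
    by (rule differentiable_scaleR[OF ni diF])
  let ?s = "\<lambda>x. \<Sum>i\<in>Basis. (n x \<bullet> i) *\<^sub>R dir i \<tau> (F x)"
  have s: "?s differentiable (at x)" by (intro differentiable_sum ballI prod finite_Basis)
  have eq: "?s y = dir (n y) \<tau> (F y)" if "y \<in> S" for y
    using dir_expand[OF d\<tau>, of "F y" "n y"] T that by auto
  show "(\<lambda>x. dir (n x) \<tau> (F x)) differentiable (at x)"
    by (rule differentiable_cong_open[OF S eq s])
  have "dir b (\<lambda>x. dir (n x) \<tau> (F x)) x = dir b ?s x"
    by (rule dir_cong_open[OF S eq s, symmetric])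
  also have "\<dots> = (\<Sum>i\<in>Basis. dir b (\<lambda>x. (n x \<bullet> i) *\<^sub>R dir i \<tau> (F x)) x)"
    by (rule dir_sum[OF prod])
  also have "\<dots> = (\<Sum>i\<in>Basis. (n x \<bullet> i) *\<^sub>R dir (dir b F x) (dir i \<tau>) (F x) + (dir b n x \<bullet> i) *\<^sub>R dir i \<tau> (F x))"
  proof (rule sum.cong[OF refl])
    fix i :: 'b
    have "dir b (\<lambda>x. (n x \<bullet> i) *\<^sub>R dir i \<tau> (F x)) x = (n x \<bullet> i) *\<^sub>R dir b (\<lambda>x. dir i \<tau> (F x)) x + dir b (\<lambda>x. n x \<bullet> i) x *\<^sub>R dir i \<tau> (F x)"
      by (rule dir_bilinear[OF bounded_bilinear_scaleR ni diF])
    also have "dir b (\<lambda>x. dir i \<tau> (F x)) x = dir (dir b F x) (dir i \<tau>) (F x)" by (rule dir_compose[OF F di])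
    also have "dir b (\<lambda>x. n x \<bullet> i) x = dir b n x \<bullet> i" by (rule dir_bounded_linear[OF bounded_linear_inner_left n])
    finally show "dir b (\<lambda>x. (n x \<bullet> i) *\<^sub>R dir i \<tau> (F x)) x = (n x \<bullet> i) *\<^sub>R dir (dir b F x) (dir i \<tau>) (F x) + (dir b n x \<bullet> i) *\<^sub>R dir i \<tau> (F x)" .
  qed
  also have "\<dots> = (\<Sum>i\<in>Basis. (n x \<bullet> i) *\<^sub>R dir (dir b F x) (dir i \<tau>) (F x)) + dir (dir b n x) \<tau> (F x)"
    using dir_expand[OF d\<tau>[OF Fx], of "dir b n x"] by (simp add: sum.distrib)
  also have "(\<Sum>i\<in>Basis. (n x \<bullet> i) *\<^sub>R dir (dir b F x) (dir i \<tau>) (F x)) = dir (dir b F x) (dir (n x) \<tau>) (F x)"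
  proof -
    have "dir (dir b F x) (dir (n x) \<tau>) (F x) = dir (dir b F x) (\<lambda>y. \<Sum>i\<in>Basis. (n x \<bullet> i) *\<^sub>R dir i \<tau> y) (F x)"
      by (rule dir_cong_open[OF T(1) Fx dir_expand[OF d\<tau>] smooth_on_differentiable[OF smooth_on_dir[OF \<tau> T(1)] T(1) Fx]])
    also have "\<dots> = (\<Sum>i\<in>Basis. dir (dir b F x) (\<lambda>y. (n x \<bullet> i) *\<^sub>R dir i \<tau> y) (F x))"
      by (rule dir_sum) (intro differentiable_scaleR differentiable_const di)
    also have "\<dots> = (\<Sum>i\<in>Basis. (n x \<bullet> i) *\<^sub>R dir (dir b F x) (dir i \<tau>) (F x))"
      by (intro sum.cong refl dir_bounded_linear[OF bounded_linear_scaleR_right di])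
    finally show ?thesis by simp
  qed
  finally show "dir b (\<lambda>x. dir (n x) \<tau> (F x)) x = dir (dir b n x) \<tau> (F x) + dir (dir b F x) (dir (n x) \<tau>) (F x)"
    by (simp add: add.commute)
qed

section \<open>Tangent vectors and derivatives under changes of charts\<close>

locale smooth_manifold =
  fixes A :: "('m::{t2_space,second_countable_topology}, 'd::finite) chart set"
  assumes atlas: "smooth_atlas A"
begin

lemma chart_homeo: "c \<in> A \<Longrightarrow> homeomorphism (fst c) (snd c ` fst c) (snd c) (param c)"
  and chart_open: "c \<in> A \<Longrightarrow> open (fst c)" "c \<in> A \<Longrightarrow> open (snd c ` fst c)"
  and transition_smooth: "c \<in> A \<Longrightarrow> c' \<in> A \<Longrightarrow> smooth_on (snd c ` (fst c \<inter> fst c')) (transition c c')"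
  using atlas by (auto simp: smooth_atlas_def)

lemma chart_at_in: "chart_at A p \<in> A" "p \<in> fst (chart_at A p)"
proof -
  have "p \<in> (\<Union>c\<in>A. fst c)" using atlas by (simp add: smooth_atlas_def)
  then have "\<exists>c. c \<in> A \<and> p \<in> fst c" by blast
  from someI_ex[OF this] show "chart_at A p \<in> A" "p \<in> fst (chart_at A p)"
    unfolding chart_at_def by blast+
qed

lemma param_snd: "c \<in> A \<Longrightarrow> q \<in> fst c \<Longrightarrow> param c (snd c q) = q"
  using homeomorphism_apply1[OF chart_homeo] .

lemma param_in: "c \<in> A \<Longrightarrow> x \<in> snd c ` fst c \<Longrightarrow> param c x \<in> fst c"
  using homeomorphism_image2[OF chart_homeo] by blast

lemma chart_image_open: "c \<in> A \<Longrightarrow> open U \<Longrightarrow> open (snd c ` (fst c \<inter> U))"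
  using homeomorphism_imp_open_map[OF chart_homeo, of c "fst c \<inter> U"] chart_open[of c]
  by (metis openin_open_eq openin_open_Int inf_le1)

lemma chart_preimage_open: "c \<in> A \<Longrightarrow> open W \<Longrightarrow> open (fst c \<inter> snd c -` W)"
  using continuous_open_preimage[OF homeomorphism_cont1[OF chart_homeo] chart_open(1)] .

lemma overlap_open: "c \<in> A \<Longrightarrow> c' \<in> A \<Longrightarrow> open (snd c ` (fst c \<inter> fst c'))"
  by (intro chart_image_open chart_open)

lemma transition_apply: "c \<in> A \<Longrightarrow> q \<in> fst c \<Longrightarrow> transition c c' (snd c q) = snd c' q"
  by (simp add: transition_def param_snd)

lemma transition_differentiable:
  "c \<in> A \<Longrightarrow> c' \<in> A \<Longrightarrow> q \<in> fst c \<Longrightarrow> q \<in> fst c' \<Longrightarrow> transition c c' differentiable (at (snd c q))"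
  by (rule smooth_on_differentiable[OF transition_smooth overlap_open]) auto

lemma dir_change_chart:
  fixes H :: "'m \<Rightarrow> 'b::real_normed_vector"
  assumes c: "c \<in> A" "c' \<in> A" "q \<in> fst c" "q \<in> fst c'"
    and H: "(\<lambda>x. H (param c' x)) differentiable (at (snd c' q))"
  shows "dir v (\<lambda>x. H (param c x)) (snd c q) =
    dir (dir v (transition c c') (snd c q)) (\<lambda>x. H (param c' x)) (snd c' q)"
proof -
  have t: "transition c c' (snd c q) = snd c' q" by (rule transition_apply[OF c(1,3)])
  have H': "(\<lambda>x. H (param c' x)) differentiable (at (transition c c' (snd c q)))" using H by (simp add: t)
  have "dir (dir v (transition c c') (snd c q)) (\<lambda>x. H (param c' x)) (snd c' q) =
      dir v (\<lambda>x. H (param c' (transition c c' x))) (snd c q)"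
    using dir_compose[OF transition_differentiable[OF c] H'] by (simp add: t)
  also have "\<dots> = dir v (\<lambda>x. H (param c x)) (snd c q)"
  proof (rule dir_cong_open[OF overlap_open[OF c(1,2)]])
    show "snd c q \<in> snd c ` (fst c \<inter> fst c')" using c by blast
    show "H (param c' (transition c c' y)) = H (param c y)" if y: "y \<in> snd c ` (fst c \<inter> fst c')" for y
    proof -
      obtain q' where q': "q' \<in> fst c" "q' \<in> fst c'" "y = snd c q'" using y by blast
      show ?thesis using q' c by (simp add: transition_apply param_snd)
    qed
    show "(\<lambda>x. H (param c' (transition c c' x))) differentiable at (snd c q)"
      using differentiable_compose[of "\<lambda>x. H (param c' x)" "transition c c'" "snd c q" UNIV] H' transition_differentiable[OF c] by simp
  qed
  finally show ?thesis by simp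
qed

lemma transition_cocycle:
  assumes c: "c \<in> A" "c' \<in> A" "c'' \<in> A" "q \<in> fst c" "q \<in> fst c'" "q \<in> fst c''"
  shows "dir v (transition c c'') (snd c q) = dir (dir v (transition c c') (snd c q)) (transition c' c'') (snd c' q)"
  using dir_change_chart[OF c(1,2,4,5), of "snd c''" v] transition_differentiable[OF c(2,3,5,6)]
  by (simp add: transition_def comp_def)

lemma transition_refl:
  assumes c: "c \<in> A" "q \<in> fst c"
  shows "dir v (transition c c) (snd c q) = v"
proof -
  have "dir v (\<lambda>x. x) (snd c q) = dir v (transition c c) (snd c q)"
    by (rule dir_cong_open[OF chart_open(2)[OF c(1)]]) (use c in \<open>auto simp: transition_apply\<close>)
  then show ?thesis by simp
qed

lemma tangent_change:
  assumes "X \<in> tangent_space A p" "c \<in> A" "c' \<in> A" "p \<in> fst c" "p \<in> fst c'"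
  shows "X c' = dir (X c) (transition c c') (snd c p)"
proof -
  have "X c' = jacobian (transition c c') (at (snd c p)) *v X c"
    using assms unfolding tangent_space_def by blast
  then show ?thesis by (simp only: jacobian_dir[OF transition_differentiable[OF assms(2-5)]])
qed

lemma tangentI:
  assumes "\<And>c. c \<notin> A \<or> p \<notin> fst c \<Longrightarrow> X c = 0"
    and "\<And>c c'. c \<in> A \<Longrightarrow> c' \<in> A \<Longrightarrow> p \<in> fst c \<Longrightarrow> p \<in> fst c' \<Longrightarrow> X c' = dir (X c) (transition c c') (snd c p)"
  shows "X \<in> tangent_space A p"
proof -
  have "X c' = jacobian (transition c c') (at (snd c p)) *v X c"
    if "c \<in> A" "c' \<in> A" "p \<in> fst c" "p \<in> fst c'" for c c'
    unfolding jacobian_dir[OF transition_differentiable[OF that]] by (rule assms(2)[OF that])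
  then show ?thesis using assms(1) unfolding tangent_space_def by blast
qed

lemma tangent_eq_0:
  assumes X: "X \<in> tangent_space A p" and c: "c \<in> A" "p \<in> fst c"
  shows "X = (\<lambda>_. 0) \<longleftrightarrow> X c = 0"
proof
  assume 0: "X c = 0"
  show "X = (\<lambda>_. 0)"
  proof
    fix c'
    show "X c' = 0"
    proof (cases "c' \<in> A \<and> p \<in> fst c'")
      case True
      then show ?thesis
        using tangent_change[OF X c(1) _ c(2), of c'] 0
          dir_zero[OF transition_differentiable[OF c(1) _ c(2)]] by simp
    next
      case False
      then show ?thesis using X unfolding tangent_space_def by blast
    qed
  qed
qed simp

text \<open>The tangent vector with prescribed components in one chart, inverse to evaluation at
  that chart. It turns statements about all tangent vectors into statements about all coordinate
  vectors.\<close>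

definition tvector :: "('m, 'd) chart \<Rightarrow> real^'d \<Rightarrow> 'm \<Rightarrow> ('m, 'd) tvec" where
  "tvector c v p = (\<lambda>c'. if c' \<in> A \<and> p \<in> fst c' then dir v (transition c c') (snd c p) else 0)"

lemma tvector_tangent: "c \<in> A \<Longrightarrow> p \<in> fst c \<Longrightarrow> tvector c v p \<in> tangent_space A p"
proof (rule tangentI)
  fix c\<^sub>1 c\<^sub>2 assume "c \<in> A" "p \<in> fst c" "c\<^sub>1 \<in> A" "c\<^sub>2 \<in> A" "p \<in> fst c\<^sub>1" "p \<in> fst c\<^sub>2"
  then show "tvector c v p c\<^sub>2 = dir (tvector c v p c\<^sub>1) (transition c\<^sub>1 c\<^sub>2) (snd c\<^sub>1 p)"
    unfolding tvector_def using transition_cocycle[of c c\<^sub>1 c\<^sub>2 p v] by simp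
qed (auto simp: tvector_def)

lemma tvector_self: "c \<in> A \<Longrightarrow> p \<in> fst c \<Longrightarrow> tvector c v p c = v"
  by (simp add: tvector_def transition_refl)

lemma coord_vector_tvector: "c \<in> A \<Longrightarrow> p \<in> fst c \<Longrightarrow> coord_vector A c i p = tvector c (axis i 1) p"
  by (auto simp: coord_vector_def tvector_def fun_eq_iff jacobian_dir[OF transition_differentiable])

end

lemma det_vector3_mult: "det (vector [J *v a, J *v b, J *v c] :: real^3^3) = det J * det (vector [a, b, c] :: real^3^3)"
  for J :: "real^3^3"
proof -
  have "(vector [J *v a, J *v b, J *v c] :: real^3^3) = vector [a, b, c] ** transpose J"
    by (simp add: vec_eq_iff forall_3 matrix_matrix_mult_def transpose_def matrix_vector_mult_def sum_3 mult.commute)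
  then show ?thesis by (simp add: det_mul)
qed

text \<open>The curvature depends on second derivatives of the matrix field, so agreement on an open
  set is what counts; the \<open>metric_field\<close> hypothesis supplies the differentiability
  needed to exchange the two fields under \<open>frechet_derivative\<close>.\<close>

lemma gauss_curvature_cong:
  assumes "metric_field H S" and x: "x \<in> S" and eq: "\<And>y. y \<in> S \<Longrightarrow> H y = G y"
  shows "gauss_curvature G x = gauss_curvature H x"
proof -
  interpret metric_field H S by fact
  have c: "christoffel H y i j k = christoffel G y i j k" if y: "y \<in> S" for y i j k
  proof -
    have "pderiv_at a (\<lambda>z. H z $ b $ l) y = pderiv_at a (\<lambda>z. G z $ b $ l) y" for a b l
      unfolding pderiv_at_def
      by (rule dir_cong_open[OF openV y _ smooth_on_differentiable[OF smooth_on_nth[OF openV smooth_on_nth[OF openV smoothG]] openV y]])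
        (simp add: eq)
    then show ?thesis by (simp add: christoffel_def eq[OF y])
  qed
  have "pderiv_at a (\<lambda>z. christoffel H z i j k) x = pderiv_at a (\<lambda>z. christoffel G z i j k) x" for a i j k
  proof -
    have "(\<lambda>z. christoffel H z i j k) differentiable (at x)"
      using smooth_on_differentiable[OF smooth_on_nth[OF openV smooth_Gam_const] openV x, of i j k] by simp
    from dir_cong_open[OF openV x c this] show ?thesis unfolding pderiv_at_def .
  qed
  then show ?thesis
    by (simp add: gauss_curvature_def curvature_def c[OF x] eq[OF x])
qed

lemma metric_field_subset: "metric_field G V \<Longrightarrow> open W \<Longrightarrow> W \<subseteq> V \<Longrightarrow> metric_field G W"
  unfolding metric_field_def by (auto intro: smooth_on_subset)

section \<open>The quantities of a front in arbitrary charts\<close>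

locale front_in_manifold = M: smooth_manifold M + N: smooth_manifold N
  for M :: "('m::{t2_space,second_countable_topology}, 2) chart set"
    and N :: "('n::{t2_space,second_countable_topology}, 3) chart set" +
  fixes g :: "('n, 3) metric" and f :: "'m \<Rightarrow> 'n" and \<nu> :: "'m \<Rightarrow> ('n, 3) tvec"
  assumes orientedN: "oriented_atlas N" and metric: "riemannian_metric N g" and front: "front M N g f \<nu>"
begin

abbreviation Gc :: "('n, 3) chart \<Rightarrow> real^3 \<Rightarrow> real^3^3" where "Gc d \<equiv> g d \<circ> param d"
abbreviation Vc :: "('n, 3) chart \<Rightarrow> (real^3) set" where "Vc d \<equiv> snd d ` fst d"
abbreviation Fc :: "('m, 2) chart \<Rightarrow> ('n, 3) chart \<Rightarrow> real^2 \<Rightarrow> real^3" where "Fc c d \<equiv> snd d \<circ> f \<circ> param c"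
abbreviation nc :: "('m, 2) chart \<Rightarrow> ('n, 3) chart \<Rightarrow> real^2 \<Rightarrow> real^3" where "nc c d \<equiv> \<lambda>x. \<nu> (param c x) d"
abbreviation Oc :: "('m, 2) chart \<Rightarrow> ('n, 3) chart \<Rightarrow> (real^2) set" where "Oc c d \<equiv> snd c ` (fst c \<inter> f -` fst d)"

lemma cont_f: "continuous_on UNIV f"
  using front by (simp add: front_def smooth_map_def)

lemma open_preimage_f: "open U \<Longrightarrow> open (f -` U)"
  using cont_f by (simp add: continuous_on_open_vimage)

lemma Oc_open: "c \<in> M \<Longrightarrow> d \<in> N \<Longrightarrow> open (Oc c d)"
  by (intro M.chart_image_open open_preimage_f N.chart_open)

lemma smooth_Fc: "c \<in> M \<Longrightarrow> d \<in> N \<Longrightarrow> smooth_on (Oc c d) (Fc c d)"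
  using front by (simp add: front_def smooth_map_def)

lemma smooth_nc: "c \<in> M \<Longrightarrow> d \<in> N \<Longrightarrow> smooth_on (Oc c d) (nc c d)"
  using front by (simp add: front_def)

lemma metric_field_Gc: "d \<in> N \<Longrightarrow> metric_field (Gc d) (Vc d)"
proof
  assume d: "d \<in> N"
  show "open (Vc d)" by (rule N.chart_open(2)[OF d])
  show "smooth_on (Vc d) (Gc d)" using metric d by (simp add: riemannian_metric_def)
  show "transpose (Gc d y) = Gc d y" if "y \<in> Vc d" for y
    using metric d N.param_in[OF d that] by (simp add: riemannian_metric_def)
  show "v \<bullet> (Gc d y *v v) > 0" if "y \<in> Vc d" "v \<noteq> 0" for y v
    using metric d N.param_in[OF d that(1)] that(2) by (simp add: riemannian_metric_def)
qed

lemma Gc_snd: "d \<in> N \<Longrightarrow> y \<in> fst d \<Longrightarrow> Gc d (snd d y) = g d y"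
  by (simp add: N.param_snd)

lemma metric_change:
  assumes d: "d \<in> N" "d' \<in> N" "y \<in> fst d" "y \<in> fst d'"
  shows "g d y = transpose (jacobian (transition d d') (at (snd d y))) ** g d' y ** jacobian (transition d d') (at (snd d y))"
proof -
  have "\<forall>c\<in>N. \<forall>c'\<in>N. \<forall>p\<in>fst c \<inter> fst c'.
        let J = jacobian (transition c c') (at (snd c p))
        in g c p = transpose J ** g c' p ** J"
    using metric unfolding riemannian_metric_def by blast
  then show ?thesis unfolding Let_def using d by blast
qed

lemma ip_change:
  assumes d: "d \<in> N" "d' \<in> N" "y \<in> fst d" "y \<in> fst d'"
  shows "ip (Gc d) (snd d y) a b = ip (Gc d') (snd d' y) (dir a (transition d d') (snd d y)) (dir b (transition d d') (snd d y))"
proof -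
  let ?J = "jacobian (transition d d') (at (snd d y))"
  have J: "?J *v v = dir v (transition d d') (snd d y)" for v
    by (rule jacobian_dir[OF N.transition_differentiable[OF d]])
  have "a \<bullet> (transpose ?J *v (g d' y *v (?J *v b))) = (?J *v a) \<bullet> (g d' y *v (?J *v b))"
    unfolding transpose_matrix_vector inner_commute[of a] dot_lmul_matrix by (rule inner_commute)
  then show ?thesis
    unfolding ip_def Gc_snd[OF d(1,3)] Gc_snd[OF d(2,4)] J[symmetric]
    by (subst metric_change[OF d]) (simp only: matrix_vector_mul_assoc[symmetric])
qed

lemma ginner_chart:
  assumes X: "X \<in> tangent_space N y" and Y: "Y \<in> tangent_space N y" and d: "d \<in> N" "y \<in> fst d"
  shows "ginner N g y X Y = ip (Gc d) (snd d y) (X d) (Y d)"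
proof -
  let ?d = "chart_at N y"
  have "ginner N g y X Y = ip (Gc ?d) (snd ?d y) (X ?d) (Y ?d)"
    by (simp add: ginner_def ip_def Let_def N.param_snd[OF N.chart_at_in])
  also have "\<dots> = ip (Gc d) (snd d y) (X d) (Y d)"
    using ip_change[OF N.chart_at_in(1) d(1) N.chart_at_in(2) d(2)]
      N.tangent_change[OF X N.chart_at_in(1) d(1) N.chart_at_in(2) d(2)]
      N.tangent_change[OF Y N.chart_at_in(1) d(1) N.chart_at_in(2) d(2)] by simp
  finally show ?thesis .
qed

text \<open>The orientation of \<open>N\<close> enters here: the square root of the metric
  determinant picks up the absolute value of the Jacobian determinant, the determinant of the
  components the Jacobian determinant itself, and positivity makes them cancel.\<close>

lemma volume_form_chart:
  assumes X: "X \<in> tangent_space N y" and Y: "Y \<in> tangent_space N y" and Z: "Z \<in> tangent_space N y"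
    and d: "d \<in> N" "y \<in> fst d"
  shows "volume_form N g y X Y Z = mu (Gc d) (snd d y) (X d) (Y d) (Z d)"
proof -
  let ?d = "chart_at N y"
  let ?J = "jacobian (transition ?d d) (at (snd ?d y))"
  note ch = N.chart_at_in(1) d(1) N.chart_at_in(2) d(2)
  have J: "W d = ?J *v W ?d" if "W \<in> tangent_space N y" for W
    using N.tangent_change[OF that ch] jacobian_dir[OF N.transition_differentiable[OF ch]] by simp
  have "det ?J > 0" using orientedN ch by (auto simp: oriented_atlas_def)
  moreover have "det (g ?d y) = (det ?J)\<^sup>2 * det (g d y)"
    by (subst metric_change[OF ch]) (simp add: det_mul power2_eq_square)
  ultimately have "sqrt (det (g ?d y)) = det ?J * sqrt (det (g d y))"
    by (simp add: real_sqrt_mult)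
  then show ?thesis
    unfolding volume_form_def Let_def mu_def Gc_snd[OF d] J[OF X] J[OF Y] J[OF Z] det_vector3_mult by simp
qed

lemma Fc_differentiable: "c \<in> M \<Longrightarrow> d \<in> N \<Longrightarrow> q \<in> fst c \<Longrightarrow> f q \<in> fst d \<Longrightarrow> Fc c d differentiable (at (snd c q))"
  by (rule smooth_on_differentiable[OF smooth_Fc Oc_open]) auto

lemma nc_differentiable: "c \<in> M \<Longrightarrow> d \<in> N \<Longrightarrow> q \<in> fst c \<Longrightarrow> f q \<in> fst d \<Longrightarrow> nc c d differentiable (at (snd c q))"
  by (rule smooth_on_differentiable[OF smooth_nc Oc_open]) auto

lemma dir_Fc_change:
  assumes c: "c \<in> M" "c' \<in> M" "q \<in> fst c" "q \<in> fst c'" and d: "d \<in> N" "f q \<in> fst d"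
  shows "dir v (Fc c d) (snd c q) = dir (dir v (transition c c') (snd c q)) (Fc c' d) (snd c' q)"
  using M.dir_change_chart[OF c, of "snd d \<circ> f" v] Fc_differentiable[OF c(2) d(1) c(4) d(2)]
  by (simp add: comp_def)

lemma dir_nc_change:
  assumes c: "c \<in> M" "c' \<in> M" "q \<in> fst c" "q \<in> fst c'" and d: "d \<in> N" "f q \<in> fst d"
  shows "dir v (nc c d) (snd c q) = dir (dir v (transition c c') (snd c q)) (nc c' d) (snd c' q)"
  using M.dir_change_chart[OF c, of "\<lambda>q. \<nu> q d" v] nc_differentiable[OF c(2) d(1) c(4) d(2)] by simp

lemma pushforward_chart:
  assumes X: "X \<in> tangent_space M q" and c: "c \<in> M" "q \<in> fst c" and d: "d \<in> N" "f q \<in> fst d"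
  shows "pushforward M N f q X d = dir (X c) (Fc c d) (snd c q)"
proof -
  let ?c = "chart_at M q"
  have "pushforward M N f q X d = dir (X ?c) (Fc ?c d) (snd ?c q)"
    unfolding jacobian_dir[OF Fc_differentiable[OF M.chart_at_in(1) d(1) M.chart_at_in(2) d(2)], symmetric]
    using d by (simp add: pushforward_def Let_def)
  also have "X ?c = dir (X c) (transition c ?c) (snd c q)"
    by (rule M.tangent_change[OF X c(1) M.chart_at_in(1) c(2) M.chart_at_in(2)])
  finally show ?thesis
    unfolding dir_Fc_change[OF c(1) M.chart_at_in(1) c(2) M.chart_at_in(2) d] .
qed

lemma Fc_transition:
  assumes c: "c \<in> M" and d: "d \<in> N" "d' \<in> N" and y: "y \<in> snd c ` (fst c \<inter> f -` (fst d \<inter> fst d'))"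
  shows "Fc c d' y = transition d d' (Fc c d y)"
  using y c d by (auto simp: M.param_snd N.transition_apply)

lemma overlap_open_f: "c \<in> M \<Longrightarrow> d \<in> N \<Longrightarrow> d' \<in> N \<Longrightarrow> open (snd c ` (fst c \<inter> f -` (fst d \<inter> fst d')))"
  by (intro M.chart_image_open open_preimage_f open_Int N.chart_open)

lemma dir_Fc_transition:
  assumes c: "c \<in> M" "q \<in> fst c" and d: "d \<in> N" "d' \<in> N" "f q \<in> fst d" "f q \<in> fst d'"
  shows "dir v (Fc c d') (snd c q) = dir (dir v (Fc c d) (snd c q)) (transition d d') (snd d (f q))"
proof -
  have Fq: "Fc c d (snd c q) = snd d (f q)" using c by (simp add: M.param_snd)
  have "dir v (Fc c d') (snd c q) = dir v (\<lambda>y. transition d d' (Fc c d y)) (snd c q)"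
    by (rule dir_cong_open[OF overlap_open_f[OF c(1) d(1,2)] _ Fc_transition[OF c(1) d(1,2)] Fc_differentiable[OF c(1) d(2) c(2) d(4)]])
      (use c d in auto)
  also have "\<dots> = dir (dir v (Fc c d) (snd c q)) (transition d d') (Fc c d (snd c q))"
    by (rule dir_compose[OF Fc_differentiable[OF c(1) d(1) c(2) d(3)]])
      (use N.transition_differentiable[OF d] Fq in simp)
  finally show ?thesis by (simp only: Fq)
qed

lemma pushforward_tangent:
  assumes X: "X \<in> tangent_space M q"
  shows "pushforward M N f q X \<in> tangent_space N (f q)"
proof (rule N.tangentI)
  fix d d' assume d: "d \<in> N" "d' \<in> N" "f q \<in> fst d" "f q \<in> fst d'"
  let ?c = "chart_at M q"
  show "pushforward M N f q X d' = dir (pushforward M N f q X d) (transition d d') (snd d (f q))"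
    unfolding pushforward_chart[OF X M.chart_at_in d(1,3)] pushforward_chart[OF X M.chart_at_in d(2,4)]
    by (rule dir_Fc_transition[OF M.chart_at_in d])
qed (auto simp: pushforward_def Let_def)

lemma \<nu>_tangent: "\<nu> q \<in> tangent_space N (f q)"
  using front by (simp add: front_def)

text \<open>The bridge from the manifolds to coordinates. The immersion condition arrives as
  injectivity of the derivative of a pair, which is the pair of the derivatives of position and
  normal.\<close>

lemma local_front_chart:
  assumes c: "c \<in> M" and d: "d \<in> N"
  shows "local_front (Gc d) (Vc d) (Fc c d) (Oc c d) (nc c d)"
proof (intro local_front.intro map_into.intro map_into_axioms.intro local_front_axioms.intro metric_field_Gc[OF d]
    Oc_open[OF c d] smooth_Fc[OF c d] smooth_nc[OF c d])
  show "Fc c d ` Oc c d \<subseteq> Vc d" using c by (auto simp: M.param_snd)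
  fix x assume "x \<in> Oc c d"
  then obtain q where q: "q \<in> fst c" "f q \<in> fst d" "x = snd c q" by auto
  have p: "param c x = q" "Fc c d x = snd d (f q)" using q c by (simp_all add: M.param_snd)
  have "ginner N g (f q) (\<nu> q) (\<nu> q) = 1" using front by (simp add: front_def)
  then show "ip (Gc d) (Fc c d x) (nc c d x) (nc c d x) = 1"
    unfolding ginner_chart[OF \<nu>_tangent \<nu>_tangent d q(2)] p .
  show "ip (Gc d) (Fc c d x) (dir u (Fc c d) x) (nc c d x) = 0" for u
  proof -
    let ?X = "M.tvector c u q"
    have X: "?X \<in> tangent_space M q" by (rule M.tvector_tangent[OF c q(1)])
    have "ginner N g (f q) (pushforward M N f q ?X) (\<nu> q) = 0" using front X by (simp add: front_def)
    then show ?thesis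
      unfolding ginner_chart[OF pushforward_tangent[OF X] \<nu>_tangent d q(2)] p(1)
        pushforward_chart[OF X c q(1) d q(2)] M.tvector_self[OF c q(1)] p(2) q(3)[symmetric] .
  qed
  fix v assume v: "dir v (Fc c d) x = 0" "dir v (nc c d) x = 0"
  let ?P = "\<lambda>x. (snd d (f (param c x)), \<nu> (param c x) d)"
  have inj: "inj (frechet_derivative ?P (at x))"
    using front c d q by (simp add: front_def)
  have "(?P has_derivative (\<lambda>v. (dir v (Fc c d) x, dir v (nc c d) x))) (at x)"
    using has_derivative_Pair Fc_differentiable[OF c d q(1,2)] nc_differentiable[OF c d q(1,2)] q(3)
    by (fastforce simp: frechet_derivative_works comp_def)
  then have eq: "dir u ?P x = (dir u (Fc c d) x, dir u (nc c d) x)" for u by (rule dir_eqI)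
  have "dir v ?P x = dir 0 ?P x"
    unfolding eq using v dir_zero[OF Fc_differentiable[OF c d q(1,2)]]
      dir_zero[OF nc_differentiable[OF c d q(1,2)]] q(3) by simp
  then show "v = 0" using inj by (rule injD[rotated])
qed

abbreviation "IIc c d \<equiv> local_front.II (Gc d) (Fc c d) (nc c d)"
abbreviation "lamc c d \<equiv> local_front.lam (Gc d) (Fc c d) (nc c d)"
abbreviation "Dc c d \<equiv> local_front.D (Gc d) (Fc c d) (nc c d)"
abbreviation "Ec c d \<equiv> local_front.E (Gc d) (Fc c d)"

lemma Fc_snd: "c \<in> M \<Longrightarrow> q \<in> fst c \<Longrightarrow> Fc c d (snd c q) = snd d (f q)"
  by (simp add: M.param_snd)

lemma in_Oc: "q \<in> fst c \<Longrightarrow> f q \<in> fst d \<Longrightarrow> snd c q \<in> Oc c d"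
  by blast

lemma II_chart:
  assumes c: "c \<in> M" "q \<in> fst c" and d: "d \<in> N" "f q \<in> fst d"
  shows "IIc c d (snd c q) a b = - ip (Gc d) (snd d (f q)) (dir a (Fc c d) (snd c q))
     (dir b (nc c d) (snd c q) + Gam (Gc d) (snd d (f q)) (dir b (Fc c d) (snd c q)) (\<nu> q d))"
  unfolding local_front.II_def[OF local_front_chart[OF c(1) d(1)]]
    map_into.cov_def[OF local_front.axioms(1)[OF local_front_chart[OF c(1) d(1)]]] Fc_snd[OF c] M.param_snd[OF c] ..

lemma II_change:
  assumes c: "c \<in> M" "c' \<in> M" "q \<in> fst c" "q \<in> fst c'" and d: "d \<in> N" "f q \<in> fst d"
  shows "IIc c d (snd c q) a b =
    IIc c' d (snd c' q) (dir a (transition c c') (snd c q)) (dir b (transition c c') (snd c q))"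
  unfolding II_chart[OF c(1,3) d] II_chart[OF c(2,4) d] dir_Fc_change[OF c d] dir_nc_change[OF c d] ..

lemma conn_term_Gam: "conn_term g d y v w = Gam (Gc d) (snd d y) v w"
  by (simp add: conn_term_def Gam_def)

lemma second_fundamental_form_chart_at:
  fixes q X Y defines "c \<equiv> chart_at M q" and "d \<equiv> chart_at N (f q)"
  assumes X: "X \<in> tangent_space M q" and Y: "Y \<in> tangent_space M q"
  shows "second_fundamental_form M N g f \<nu> q X Y = IIc c d (snd c q) (X c) (Y c)"
proof -
  have c: "c \<in> M" "q \<in> fst c" and d: "d \<in> N" "f q \<in> fst d"
    using M.chart_at_in N.chart_at_in by (auto simp: c_def d_def)
  have "cov_deriv_along_map M N g f \<nu> q Y d = dir (Y c) (nc c d) (snd c q)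
      + Gam (Gc d) (snd d (f q)) (dir (Y c) (Fc c d) (snd c q)) (\<nu> q d)"
    using d unfolding cov_deriv_along_map_def Let_def conn_term_Gam pushforward_chart[OF Y c d] c_def[symmetric] by simp
  then show ?thesis
    unfolding II_chart[OF c d] second_fundamental_form_def ginner_def Let_def d_def[symmetric]
      pushforward_chart[OF X c d] ip_def Gc_snd[OF d] by simp
qed

text \<open>The metric in the chart \<open>d\<close> is the pullback of the metric in \<open>d'\<close> by the transition map \<open>\<tau>\<close>, so
  \<open>Gam_E\<close> is the transformation law of the Christoffel symbols.\<close>

lemma II_change_target:
  assumes c: "c \<in> M" "q \<in> fst c" and d: "d \<in> N" "d' \<in> N" "f q \<in> fst d" "f q \<in> fst d'"
  shows "IIc c d (snd c q) a b = IIc c d' (snd c q) a b"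
proof -
  let ?\<tau> = "transition d d'" and ?W = "snd d ` (fst d \<inter> fst d')"
  let ?x = "snd c q" and ?y = "snd d (f q)"
  let ?O = "snd c ` (fst c \<inter> f -` (fst d \<inter> fst d'))"
  have W: "open ?W" "?W \<subseteq> Vc d" using N.overlap_open[OF d(1,2)] by auto
  have yW: "?y \<in> ?W" using d by blast
  have \<tau>y: "?\<tau> ?y = snd d' (f q)" by (rule N.transition_apply[OF d(1,3)])
  interpret P: pullback_metric "Gc d'" "Vc d'" ?\<tau> ?W "Gc d" ?W
  proof (intro pullback_metric.intro map_into.intro map_into_axioms.intro pullback_metric_axioms.intro
      metric_field_Gc[OF d(2)] metric_field_subset[OF metric_field_Gc[OF d(1)] W] W(1) N.transition_smooth[OF d(1,2)] order_refl)
    show "?\<tau> ` ?W \<subseteq> Vc d'" using d by (auto simp: N.transition_apply)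
    fix x a b assume "x \<in> ?W"
    then obtain y where y: "y \<in> fst d" "y \<in> fst d'" "x = snd d y" by blast
    show "ip (Gc d) x a b = ip (Gc d') (?\<tau> x) (dir a ?\<tau> x) (dir b ?\<tau> x)"
      unfolding y(3) N.transition_apply[OF d(1) y(1)] by (rule ip_change[OF d(1,2) y(1,2)])
  qed
  have n': "nc c d' z = dir (nc c d z) ?\<tau> (Fc c d z)" if z: "z \<in> ?O" for z
  proof -
    obtain r where r: "r \<in> fst c" "f r \<in> fst d" "f r \<in> fst d'" "z = snd c r" using z by blast
    show ?thesis
      using N.tangent_change[OF \<nu>_tangent d(1,2) r(2,3)] c(1) r by (simp add: M.param_snd)
  qed
  have xO: "?x \<in> ?O" using c d by blast
  have FO: "Fc c d ` ?O \<subseteq> ?W" using c(1) by (auto simp: M.param_snd)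
  have "dir b (nc c d') ?x = dir b (\<lambda>z. dir (nc c d z) ?\<tau> (Fc c d z)) ?x"
    by (rule dir_cong_open[OF overlap_open_f[OF c(1) d(1,2)] xO n' nc_differentiable[OF c(1) d(2) c(2) d(4)]])
  also have "\<dots> = dir (dir b (nc c d) ?x) ?\<tau> (Fc c d ?x) + dir (dir b (Fc c d) ?x) (dir (nc c d ?x) ?\<tau>) (Fc c d ?x)"
    by (rule dir_dir_compose(1)[OF overlap_open_f[OF c(1) d(1,2)] xO W(1) FO Fc_differentiable[OF c(1) d(1) c(2) d(3)]
        nc_differentiable[OF c(1) d(1) c(2) d(3)] N.transition_smooth[OF d(1,2)]])
  also have "\<dots> = dir (dir b (nc c d) ?x) ?\<tau> ?y + dir (dir b (Fc c d) ?x) (dir (\<nu> q d) ?\<tau>) ?y"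
    unfolding Fc_snd[OF c] M.param_snd[OF c] ..
  finally have dn: "dir b (nc c d') ?x = \<dots>" .
  have nq: "\<nu> q d' = dir (\<nu> q d) ?\<tau> ?y"
    by (rule N.tangent_change[OF \<nu>_tangent d])
  have ipc: "ip (Gc d') (snd d' (f q)) (dir u ?\<tau> ?y) (dir v ?\<tau> ?y) = ip (Gc d) ?y u v" for u v
    by (rule ip_change[OF d, symmetric])
  have "ip (Gc d) ?y (dir a (Fc c d) ?x) (Gam (Gc d) ?y (dir b (Fc c d) ?x) (\<nu> q d)) =
     ip (Gc d') (snd d' (f q)) (dir (dir a (Fc c d) ?x) ?\<tau> ?y)
       (dir (dir b (Fc c d) ?x) (dir (\<nu> q d) ?\<tau>) ?y +
         Gam (Gc d') (snd d' (f q)) (dir (dir b (Fc c d) ?x) ?\<tau> ?y) (dir (\<nu> q d) ?\<tau> ?y))"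
    unfolding P.Gam_E[OF yW] P.cov_def \<tau>y ..
  then show ?thesis
    unfolding II_chart[OF c d(1,3)] II_chart[OF c d(2,4)] dir_Fc_transition[OF c d] dn nq
    by (simp add: ip_add_right ipc)
qed

text \<open>Unfolding the definition yields the formula only in the charts chosen at q and f q;
  \<open>II_change\<close> and \<open>II_change_target\<close> carry it over to arbitrary
  charts.\<close>

lemma second_fundamental_form_chart:
  assumes X: "X \<in> tangent_space M q" and Y: "Y \<in> tangent_space M q"
    and c: "c \<in> M" "q \<in> fst c" and d: "d \<in> N" "f q \<in> fst d"
  shows "second_fundamental_form M N g f \<nu> q X Y = IIc c d (snd c q) (X c) (Y c)"
  unfolding second_fundamental_form_chart_at[OF X Y]
    II_change_target[OF M.chart_at_in N.chart_at_in(1) d(1) N.chart_at_in(2) d(2)]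
    II_change[OF c(1) M.chart_at_in(1) c(2) M.chart_at_in(2) d]
    M.tangent_change[OF X c(1) M.chart_at_in(1) c(2) M.chart_at_in(2)]
    M.tangent_change[OF Y c(1) M.chart_at_in(1) c(2) M.chart_at_in(2)] ..

lemma null_vector_chart:
  assumes c: "c \<in> M" "q \<in> fst c" and d: "d \<in> N" "f q \<in> fst d"
  shows "null_vector M N f q X \<longleftrightarrow> X \<in> tangent_space M q \<and> X c \<noteq> 0 \<and> dir (X c) (Fc c d) (snd c q) = 0"
  unfolding null_vector_def
  using M.tangent_eq_0[OF _ c, of X] N.tangent_eq_0[OF pushforward_tangent d, of X] pushforward_chart[OF _ c d, of X]
  by auto

lemma singular_point_chart:
  assumes c: "c \<in> M" "q \<in> fst c" and d: "d \<in> N" "f q \<in> fst d"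
  shows "singular_point M N f q \<longleftrightarrow> lamc c d (snd c q) = 0"
proof -
  have "singular_point M N f q \<longleftrightarrow> (\<exists>v. v \<noteq> 0 \<and> dir v (Fc c d) (snd c q) = 0)"
  proof
    assume "singular_point M N f q"
    then show "\<exists>v. v \<noteq> 0 \<and> dir v (Fc c d) (snd c q) = 0"
      unfolding singular_point_def null_vector_chart[OF c d] by blast
  next
    assume "\<exists>v. v \<noteq> 0 \<and> dir v (Fc c d) (snd c q) = 0"
    then obtain v where "v \<noteq> 0" "dir v (Fc c d) (snd c q) = 0" by blast
    then have "null_vector M N f q (M.tvector c v q)"
      unfolding null_vector_chart[OF c d] by (simp add: M.tvector_tangent[OF c] M.tvector_self[OF c])
    then show "singular_point M N f q" unfolding singular_point_def by blast
  qed
  then show ?thesis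
    using local_front.lam_eq_0[OF local_front_chart[OF c(1) d(1)] in_Oc[OF c(2) d(2)]] by simp
qed

lemma area_density_chart:
  assumes c: "c \<in> M" "q \<in> fst c" and d: "d \<in> N" "f q \<in> fst d"
  shows "area_density M N g f \<nu> c (snd c q) = lamc c d (snd c q)"
proof -
  note T = M.tvector_tangent[OF c]
  show ?thesis
    unfolding area_density_def Let_def M.param_snd[OF c] M.coord_vector_tvector[OF c]
      volume_form_chart[OF pushforward_tangent[OF T] pushforward_tangent[OF T] \<nu>_tangent d]
      pushforward_chart[OF T c d] M.tvector_self[OF c]
      local_front.lam_def[OF local_front_chart[OF c(1) d(1)]] Fc_snd[OF c] ..
qed

lemma d_area_density_chart:
  fixes q defines "c \<equiv> chart_at M q"
  assumes d: "d \<in> N" "f q \<in> fst d"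
  shows "d_area_density M N g f \<nu> q X = dir (X c) (lamc c d) (snd c q)"
proof -
  have c: "c \<in> M" "q \<in> fst c" using M.chart_at_in by (auto simp: c_def)
  have "dir (X c) (lamc c d) (snd c q) = dir (X c) (area_density M N g f \<nu> c) (snd c q)"
  proof (rule dir_cong_open[OF Oc_open[OF c(1) d(1)] in_Oc[OF c(2) d(2)]])
    show "lamc c d y = area_density M N g f \<nu> c y" if "y \<in> Oc c d" for y
      using that area_density_chart[OF c(1) _ d(1)] by auto
    show "lamc c d differentiable at (snd c q)"
      by (rule local_front.differentiable_lam[OF local_front_chart[OF c(1) d(1)] in_Oc[OF c(2) d(2)]])
  qed
  then show ?thesis by (simp add: d_area_density_def Let_def c_def)
qed

lemma first_form_matrix_chart:
  assumes c: "c \<in> M" "q \<in> fst c" and d: "d \<in> N" "f q \<in> fst d"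
  shows "first_form_matrix M N g f c q = Ec c d (snd c q)"
proof -
  note T = M.tvector_tangent[OF c]
  show ?thesis
    unfolding first_form_matrix_def M.coord_vector_tvector[OF c]
      ginner_chart[OF pushforward_tangent[OF T] pushforward_tangent[OF T] d]
      pushforward_chart[OF T c d] M.tvector_self[OF c]
      local_front.E_def[OF local_front_chart[OF c(1) d(1)]] Fc_snd[OF c] ..
qed

lemma det_second_form_matrix_chart:
  assumes c: "c \<in> M" "q \<in> fst c" and d: "d \<in> N" "f q \<in> fst d"
  shows "det (second_form_matrix M N g f \<nu> c q) = Dc c d (snd c q)"
proof -
  note T = M.tvector_tangent[OF c]
  have "second_form_matrix M N g f \<nu> c q = (\<chi> i j. IIc c d (snd c q) (axis i 1) (axis j 1))"
    unfolding second_form_matrix_def M.coord_vector_tvector[OF c]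
      second_fundamental_form_chart[OF T T c d] M.tvector_self[OF c] ..
  then show ?thesis
    by (simp add: det_2 local_front.D_def[OF local_front_chart[OF c(1) d(1)]])
qed

text \<open>In the defining chart K_ext is det II over det I, and the latter is
  \<open>lam\<^sup>2\<close>. Passing to the chart c multiplies \<open>D\<close> and
  \<open>lam\<^sup>2\<close> by the same factor, a squared Jacobian determinant.\<close>

lemma K_ext_chart:
  assumes c: "c \<in> M" "q \<in> fst c" and d: "d \<in> N" "f q \<in> fst d" and reg: "\<not> singular_point M N f q"
  shows "K_ext M N g f \<nu> q * (lamc c d (snd c q))\<^sup>2 = Dc c d (snd c q)"
proof -
  let ?c = "chart_at M q"
  note ch = M.chart_at_in[of q]
  interpret c: local_front "Gc d" "Vc d" "Fc c d" "Oc c d" "nc c d" by (rule local_front_chart[OF c(1) d(1)])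
  interpret c': local_front "Gc d" "Vc d" "Fc ?c d" "Oc ?c d" "nc ?c d" by (rule local_front_chart[OF ch(1) d(1)])
  have x': "snd ?c q \<in> Oc ?c d" by (rule in_Oc[OF ch(2) d(2)])
  have E: "det (Ec ?c d (snd ?c q)) = (lamc ?c d (snd ?c q))\<^sup>2" by (rule c'.lam_square[OF x', symmetric])
  have "det (Ec ?c d (snd ?c q)) \<noteq> 0" using reg unfolding singular_point_chart[OF ch d] E by simp
  then have "det (Ec ?c d (snd ?c q)) * det (matrix_inv (Ec ?c d (snd ?c q))) = 1"
    unfolding det_mul[symmetric] by (simp only: matrix_inv_right det_I not_False_eq_True)
  moreover have "e * i = 1 \<Longrightarrow> i * h * e = h" for e i h :: real by algebra
  ultimately have "det (matrix_inv (Ec ?c d (snd ?c q))) * Dc ?c d (snd ?c q) * det (Ec ?c d (snd ?c q)) = Dc ?c d (snd ?c q)"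
    by blast
  then have K: "K_ext M N g f \<nu> q * (lamc ?c d (snd ?c q))\<^sup>2 = Dc ?c d (snd ?c q)"
    unfolding K_ext_def shape_operator_matrix_def det_mul first_form_matrix_chart[OF ch d] det_second_form_matrix_chart[OF ch d] E[symmetric] .
  let ?t = "\<lambda>v. dir v (transition c ?c) (snd c q)"
  let ?j = "det2 (?t (axis 1 1)) (?t (axis 2 1))"
  have l: "lamc c d (snd c q) = ?j * lamc ?c d (snd ?c q)"
    unfolding c.lam_def dir_Fc_change[OF c(1) ch(1) c(2) ch(2) d] c'.mu_dir[OF x', symmetric] Fc_snd[OF c] Fc_snd[OF ch]
      M.param_snd[OF c] M.param_snd[OF ch] ..
  have "Dc c d (snd c q) = ?j\<^sup>2 * Dc ?c d (snd ?c q)"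
    unfolding c.D_def II_change[OF c(1) ch(1) c(2) ch(2) d] by (rule c'.II_minor[OF x'])
  then show ?thesis unfolding l K[symmetric] by (simp add: power_mult_distrib)
qed

text \<open>The chart of the target is arbitrary, but the chart of the surface is the one in which \<open>K_gauss\<close> is
  defined: this way the invariance of the intrinsic curvature under coordinate changes of the
  surface is never needed.\<close>

lemma K_gauss_chart:
  fixes q defines "c \<equiv> chart_at M q"
  assumes d: "d \<in> N" "f q \<in> fst d" and reg: "\<not> singular_point M N f q"
  shows "(K_gauss M N g f q - K_ext M N g f \<nu> q) * (lamc c d (snd c q))\<^sup>2 =
    ip (Gc d) (snd d (f q)) (dir (axis 1 1) (Fc c d) (snd c q))
      (Rm (Gc d) (snd d (f q)) (dir (axis 1 1) (Fc c d) (snd c q)) (dir (axis 2 1) (Fc c d) (snd c q)) (dir (axis 2 1) (Fc c d) (snd c q)))"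
proof -
  have c: "c \<in> M" "q \<in> fst c" using M.chart_at_in by (auto simp: c_def)
  interpret c: local_front "Gc d" "Vc d" "Fc c d" "Oc c d" "nc c d" by (rule local_front_chart[OF c(1) d(1)])
  have x: "snd c q \<in> c.Reg"
    using in_Oc[OF c(2) d(2)] reg unfolding singular_point_chart[OF c d] c.Reg_def by blast
  have "gauss_curvature (\<lambda>x. first_form_matrix M N g f c (param c x)) (snd c q) = gauss_curvature (Ec c d) (snd c q)"
  proof (rule gauss_curvature_cong[OF c.metric_field_E x])
    fix y assume "y \<in> c.Reg"
    then obtain r where "r \<in> fst c" "f r \<in> fst d" "y = snd c r" unfolding c.Reg_def by blast
    then show "Ec c d y = first_form_matrix M N g f c (param c y)"
      using first_form_matrix_chart[OF c(1) _ d(1)] c(1) by (simp add: M.param_snd)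
  qed
  then have "K_gauss M N g f q = gauss_curvature (Ec c d) (snd c q)"
    by (simp add: K_gauss_def Let_def c_def)
  then show ?thesis
    using c.gauss_local[OF x] c.lam_square[OF in_Oc[OF c(2) d(2)]] K_ext_chart[OF c d reg]
    unfolding Fc_snd[OF c] by (simp add: algebra_simps)
qed

text \<open>The difference times \<open>lam\<^sup>2\<close> is a curvature term of the target, which
  \<open>sectional_bound\<close> estimates by a constant times the Gram determinant of the two
  tangent vectors. This determinant is again \<open>lam\<^sup>2\<close>, so the bound survives as
  the tangent vectors become dependent.\<close>

lemma curvature_difference_bound:
  assumes d: "d \<in> N" and K: "compact K" "K \<subseteq> Vc d"
  shows "\<exists>C. \<forall>q. f q \<in> fst d \<and> snd d (f q) \<in> K \<and> \<not> singular_point M N f q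
    \<longrightarrow> \<bar>K_gauss M N g f q - K_ext M N g f \<nu> q\<bar> \<le> C"
proof -
  interpret metric_field "Gc d" "Vc d" by (rule metric_field_Gc[OF d])
  obtain C where C: "\<And>y a b. y \<in> K \<Longrightarrow> \<bar>ip (Gc d) y a (Rm (Gc d) y a b b)\<bar> \<le>
      C * (ip (Gc d) y a a * ip (Gc d) y b b - (ip (Gc d) y a b)\<^sup>2)"
    using sectional_bound[OF K] by blast
  have "\<bar>K_gauss M N g f q - K_ext M N g f \<nu> q\<bar> \<le> C"
    if q: "f q \<in> fst d" "snd d (f q) \<in> K" and reg: "\<not> singular_point M N f q" for q
  proof -
    let ?c = "chart_at M q"
    note ch = M.chart_at_in[of q]
    interpret c: local_front "Gc d" "Vc d" "Fc ?c d" "Oc ?c d" "nc ?c d" by (rule local_front_chart[OF ch(1) d(1)])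
    let ?l = "lamc ?c d (snd ?c q)"
    have l: "?l\<^sup>2 > 0" using reg unfolding singular_point_chart[OF ch d q(1)] by simp
    have y: "snd d (f q) \<in> Vc d" using q by blast
    have "ip (Gc d) (snd d (f q)) (dir (axis 1 1) (Fc ?c d) (snd ?c q)) (dir (axis 1 1) (Fc ?c d) (snd ?c q))
        * ip (Gc d) (snd d (f q)) (dir (axis 2 1) (Fc ?c d) (snd ?c q)) (dir (axis 2 1) (Fc ?c d) (snd ?c q))
        - (ip (Gc d) (snd d (f q)) (dir (axis 1 1) (Fc ?c d) (snd ?c q)) (dir (axis 2 1) (Fc ?c d) (snd ?c q)))\<^sup>2 = ?l\<^sup>2"
      unfolding c.lam_square[OF in_Oc[OF ch(2) q(1)]] det_2 c.E_def vec_lambda_beta Fc_snd[OF ch]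
      using ip_commute[OF y] by (simp add: power2_eq_square)
    then have "\<bar>K_gauss M N g f q - K_ext M N g f \<nu> q\<bar> * ?l\<^sup>2 \<le> C * ?l\<^sup>2"
      using C[OF q(2), of "dir (axis 1 1) (Fc ?c d) (snd ?c q)" "dir (axis 2 1) (Fc ?c d) (snd ?c q)"]
      unfolding K_gauss_chart[OF d q(1) reg, symmetric] by (simp add: abs_mult)
    then show ?thesis using l by (simp add: mult_le_cancel_right)
  qed
  then show ?thesis by blast
qed

end


section \<open>Singular curves\<close>

lemma vector_derivative_dir:
  "k differentiable (at t) \<Longrightarrow> vector_derivative k (at t) = dir 1 k t"
  by (simp add: frechet_derivative_eq_vector_derivative)

lemma vector_derivative_cong_open:
  assumes "open S" "t \<in> S" "\<And>s. s \<in> S \<Longrightarrow> k s = h s" "k differentiable (at t)"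
  shows "vector_derivative h (at t) = dir 1 k t"
  using vector_derivative_dir[OF differentiable_cong_open[OF assms]] dir_cong_open[OF assms] by simp

lemma det_vector2: "det (vector [a, b] :: real^2^2) = det2 a b"
  by (simp add: det_2 det2_def)

lemma dir_standard_cuspidal_edge:
  "(standard_cuspidal_edge has_derivative (\<lambda>u. vector [2 * z $ 1 * u $ 1, 3 * (z $ 1)\<^sup>2 * u $ 1, u $ 2])) (at z)"
proof -
  have n: "((\<lambda>x::real^2. x $ i) has_derivative (\<lambda>u. u $ i)) (at z)" for i
    by (rule bounded_linear_imp_has_derivative[OF bounded_linear_vec_nth])
  have sq: "((\<lambda>x::real^2. x $ 1 * x $ 1) has_derivative (\<lambda>u. 2 * z $ 1 * u $ 1)) (at z)"
    by (rule has_derivative_eq_rhs[OF has_derivative_mult[OF n n]]) (simp add: fun_eq_iff)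
  have cube: "((\<lambda>x::real^2. x $ 1 * x $ 1 * x $ 1) has_derivative (\<lambda>u. 3 * (z $ 1)\<^sup>2 * u $ 1)) (at z)"
    by (rule has_derivative_eq_rhs[OF has_derivative_mult[OF sq n]]) (simp add: fun_eq_iff power2_eq_square algebra_simps)
  have "((\<lambda>x. standard_cuspidal_edge x $ i) has_derivative (\<lambda>u. (vector [2 * z $ 1 * u $ 1, 3 * (z $ 1)\<^sup>2 * u $ 1, u $ 2] :: real^3) $ i)) (at z)" for i
    using exhaust_3[of i] sq cube n[of 2]
    unfolding standard_cuspidal_edge_def power2_eq_square[of "_ $ 1"] power3_eq_cube by auto
  then show ?thesis
    by (subst has_derivative_componentwise_within) (auto simp: Basis_vec_def inner_axis)
qed

context front_in_manifold begin

text \<open>The isometry composed with the inverse of a chart pulls the Euclidean inner product back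
  to the metric, so \<open>flat_pullback\<close> removes the curvature term of
  \<open>K_gauss_chart\<close>.\<close>

lemma curvature_flat:
  assumes flat: "euclidean_3space N g" and reg: "\<not> singular_point M N f q"
  shows "K_gauss M N g f q = K_ext M N g f \<nu> q"
proof -
  obtain \<Phi> :: "'n \<Rightarrow> real^3" where \<Phi>: "smooth_map N standard_atlas \<Phi>"
    "\<And>d y. d \<in> N \<Longrightarrow> y \<in> fst d \<Longrightarrow> (let J = jacobian (\<Phi> \<circ> param d) (at (snd d y)) in g d y = transpose J ** J)"
    using flat unfolding euclidean_3space_def by blast
  let ?d = "chart_at N (f q)" and ?c = "chart_at M q"
  note d = N.chart_at_in[of "f q"] and c = M.chart_at_in[of q]
  let ?h = "\<Phi> \<circ> param ?d"
  have h: "smooth_on (Vc ?d) ?h"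
    using \<Phi>(1) d(1) by (simp add: smooth_map_def standard_atlas_def comp_def)
  have pull: "ip (Gc ?d) y a b = dir a ?h y \<bullet> dir b ?h y" if y: "y \<in> Vc ?d" for y a b
  proof -
    obtain z where z: "z \<in> fst ?d" "y = snd ?d z" using y by blast
    let ?J = "jacobian ?h (at y)"
    have J: "?J *v v = dir v ?h y" for v
      by (rule jacobian_dir[OF smooth_on_differentiable[OF h N.chart_open(2)[OF d(1)] y]])
    have "Gc ?d y = transpose ?J ** ?J"
      using \<Phi>(2)[OF d(1) z(1)] unfolding z(2) Gc_snd[OF d(1) z(1)] Let_def .
    then have "ip (Gc ?d) y a b = a \<bullet> (transpose ?J *v (?J *v b))"
      by (simp only: ip_def matrix_vector_mul_assoc)
    also have "\<dots> = (?J *v a) \<bullet> (?J *v b)"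
      unfolding transpose_matrix_vector inner_commute[of a] dot_lmul_matrix by (rule inner_commute)
    finally show ?thesis unfolding J .
  qed
  have "(K_gauss M N g f q - K_ext M N g f \<nu> q) * (lamc ?c ?d (snd ?c q))\<^sup>2 = 0"
    unfolding K_gauss_chart[OF d reg]
    by (rule flat_pullback[OF metric_field_Gc[OF d(1)] h pull]) (use d in auto)
  then show ?thesis
    using reg unfolding singular_point_chart[OF c d] by simp
qed

end

section \<open>Velocity, acceleration and transversality of the singular curve\<close>

locale singular_curve = front_in_manifold M N g f \<nu>
  for M :: "('m::{t2_space,second_countable_topology}, 2) chart set"
    and N :: "('n::{t2_space,second_countable_topology}, 3) chart set"
    and g :: "('n, 3) metric" and f :: "'m \<Rightarrow> 'n" and \<nu> :: "'m \<Rightarrow> ('n, 3) tvec" +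
  fixes I :: "real set" and \<gamma> :: "real \<Rightarrow> 'm"
  assumes openI: "open I" and curve: "nondegenerate_singular_curve M N g f \<nu> I \<gamma>"
begin

abbreviation Cc :: "('m, 2) chart \<Rightarrow> real \<Rightarrow> real^2" where "Cc c \<equiv> snd c \<circ> \<gamma>"

definition cdom :: "('m, 2) chart \<Rightarrow> ('n, 3) chart \<Rightarrow> real set" where
  "cdom c d = {s \<in> I. \<gamma> s \<in> fst c \<and> f (\<gamma> s) \<in> fst d}"

lemma cont_\<gamma>: "continuous_on I \<gamma>"
  and smooth_Cc: "c \<in> M \<Longrightarrow> smooth_on (I \<inter> \<gamma> -` fst c) (Cc c)"
  and velocity_nonzero: "t \<in> I \<Longrightarrow> velocity M \<gamma> t \<noteq> (\<lambda>_. 0)"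
  and nondegenerate_point: "t \<in> I \<Longrightarrow> nondegenerate_singular_point M N g f \<nu> (\<gamma> t)"
  using curve by (auto simp: nondegenerate_singular_curve_def)

lemma singular_\<gamma>: "t \<in> I \<Longrightarrow> singular_point M N f (\<gamma> t)"
  using nondegenerate_point by (simp add: nondegenerate_singular_point_def)

lemma open_chart_dom: "c \<in> M \<Longrightarrow> open (I \<inter> \<gamma> -` fst c)"
  by (rule continuous_open_preimage[OF cont_\<gamma> openI M.chart_open(1)])

lemma open_cdom: "c \<in> M \<Longrightarrow> d \<in> N \<Longrightarrow> open (cdom c d)"
proof -
  assume c: "c \<in> M" and d: "d \<in> N"
  have "cdom c d = I \<inter> \<gamma> -` (fst c \<inter> f -` fst d)" by (auto simp: cdom_def)
  then show ?thesis
    using continuous_open_preimage[OF cont_\<gamma> openI open_Int[OF M.chart_open(1)[OF c] open_preimage_f[OF N.chart_open(1)[OF d]]]]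
    by simp
qed

lemma Cc_differentiable: "c \<in> M \<Longrightarrow> t \<in> I \<Longrightarrow> \<gamma> t \<in> fst c \<Longrightarrow> Cc c differentiable (at t)"
  by (rule smooth_on_differentiable[OF smooth_Cc open_chart_dom]) auto

lemma velocity_chart: "c \<in> M \<Longrightarrow> t \<in> I \<Longrightarrow> \<gamma> t \<in> fst c \<Longrightarrow> velocity M \<gamma> t c = dir 1 (Cc c) t"
  by (simp add: velocity_def vector_derivative_dir Cc_differentiable)

lemma velocity_tangent: assumes t: "t \<in> I" shows "velocity M \<gamma> t \<in> tangent_space M (\<gamma> t)"
proof (rule M.tangentI)
  fix c c' assume c: "c \<in> M" "c' \<in> M" "\<gamma> t \<in> fst c" "\<gamma> t \<in> fst c'"
  have S: "open (I \<inter> \<gamma> -` (fst c \<inter> fst c'))"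
    by (rule continuous_open_preimage[OF cont_\<gamma> openI open_Int[OF M.chart_open(1) M.chart_open(1)]]) (rule c)+
  have "dir 1 (Cc c') t = dir 1 (\<lambda>s. transition c c' (Cc c s)) t"
    by (rule dir_cong_open[OF S _ _ Cc_differentiable[OF c(2) t c(4)]])
      (use c t in \<open>auto simp: M.transition_apply\<close>)
  also have "\<dots> = dir (dir 1 (Cc c) t) (transition c c') (Cc c t)"
    by (rule dir_compose[OF Cc_differentiable[OF c(1) t c(3)]]) (simp add: M.transition_differentiable[OF c])
  finally show "velocity M \<gamma> t c' = dir (velocity M \<gamma> t c) (transition c c') (snd c (\<gamma> t))"
    unfolding velocity_chart[OF c(1) t c(3)] velocity_chart[OF c(2) t c(4)] by simp
qed (auto simp: velocity_def)

lemma Cc_velocity_nonzero: "c \<in> M \<Longrightarrow> t \<in> I \<Longrightarrow> \<gamma> t \<in> fst c \<Longrightarrow> velocity M \<gamma> t c \<noteq> 0"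
  using M.tangent_eq_0[OF velocity_tangent] velocity_nonzero by blast

lemma lam_Cc: "c \<in> M \<Longrightarrow> d \<in> N \<Longrightarrow> s \<in> cdom c d \<Longrightarrow> lamc c d (Cc c s) = 0"
  using singular_point_chart[of c "\<gamma> s" d] singular_\<gamma>[of s] by (auto simp: cdom_def)

lemma dir_velocity_lam:
  assumes c: "c \<in> M" and d: "d \<in> N" and t: "t \<in> cdom c d"
  shows "dir (velocity M \<gamma> t c) (lamc c d) (snd c (\<gamma> t)) = 0"
proof -
  have t': "t \<in> I" "\<gamma> t \<in> fst c" "f (\<gamma> t) \<in> fst d" using t by (auto simp: cdom_def)
  have "(Cc c has_vector_derivative velocity M \<gamma> t c) (at t)"
    using Cc_differentiable[OF c t'(1,2)] t' c by (simp add: velocity_def vector_derivative_works[symmetric])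
  moreover have "\<forall>\<^sub>F s in nhds t. lamc c d (Cc c s) = 0"
    using open_cdom[OF c d] t lam_Cc[OF c d] unfolding eventually_nhds by blast
  ultimately show ?thesis
    using local_front.singular_curve_tangent[OF local_front_chart[OF c d]] in_Oc[OF t'(2,3)] by fastforce
qed

text \<open>In the normal form \<open>(u\<^sup>2, u\<^sup>3, v)\<close> all singular points have \<open>u = 0\<close> and null direction \<open>\<partial>\<^sub>u\<close>, whereas the
  velocity of the singular curve has no \<open>u\<close>-component.\<close>

lemma cuspidal_edge_transversal:
  assumes t: "t \<in> I" and edge: "cuspidal_edge M N f (\<gamma> t)"
    and X: "null_vector M N f (\<gamma> t) X" and c: "c \<in> M" "\<gamma> t \<in> fst c"
  shows "det2 (velocity M \<gamma> t c) (X c) \<noteq> 0"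
proof
  assume dep: "det2 (velocity M \<gamma> t c) (X c) = 0"
  obtain e d S T \<phi> V W \<Psi> where e: "e \<in> M" "\<gamma> t \<in> fst e" and d: "d \<in> N" "f (\<gamma> t) \<in> fst d"
    and \<phi>: "diffeo_on S T \<phi>" "S \<subseteq> snd e ` fst e" "snd e (\<gamma> t) \<in> S" "\<phi> (snd e (\<gamma> t)) = (0 :: real^2)"
    and \<Psi>: "diffeo_on V W \<Psi>" "V \<subseteq> snd d ` fst d"
    and normal_form: "\<And>x. x \<in> S \<Longrightarrow> f (param e x) \<in> fst d \<and> snd d (f (param e x)) \<in> V \<and>
       \<Psi> (snd d (f (param e x))) = standard_cuspidal_edge (\<phi> x)"
    using edge unfolding cuspidal_edge_def by blast
  have S: "open S" "smooth_on S \<phi>" and T: "open T" "smooth_on T (inv_into S \<phi>)" "bij_betw \<phi> S T"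
    and V: "open V" "smooth_on V \<Psi>"
    using \<phi>(1) \<Psi>(1) by (auto simp: diffeo_on_def)
  have dphi: "\<phi> differentiable (at x)" if "x \<in> S" for x by (rule smooth_on_differentiable[OF S(2,1) that])
  have inj: "v = 0" if x: "x \<in> S" and v: "dir v \<phi> x = 0" for x v
  proof -
    have \<phi>x: "\<phi> x \<in> T" using T(3) x by (auto simp: bij_betw_def)
    have di: "inv_into S \<phi> differentiable (at (\<phi> x))" by (rule smooth_on_differentiable[OF T(2,1) \<phi>x])
    have "dir v (\<lambda>x. x) x = dir v (\<lambda>x. inv_into S \<phi> (\<phi> x)) x"
      by (rule dir_cong_open[OF S(1) x]) (use T(3) in \<open>auto simp: bij_betw_def\<close>)
    also have "\<dots> = dir (dir v \<phi> x) (inv_into S \<phi>) (\<phi> x)" by (rule dir_compose[OF dphi[OF x] di])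
    also have "\<dots> = 0" using v dir_zero[OF di] by simp
    finally show ?thesis by simp
  qed
  have SO: "S \<subseteq> Oc e d"
  proof
    fix x assume x: "x \<in> S"
    then obtain q where "q \<in> fst e" "x = snd e q" using \<phi>(2) by blast
    then show "x \<in> Oc e d" using normal_form[OF x] e(1) by (auto simp: M.param_snd)
  qed
  \<comment> \<open>The derivative of the normal form at a point with first coordinate u, in
    direction (a,b), is (2ua, 3uua, b). It vanishes on the image (a,b) of v under the differential
    of \<phi>, so b = 0 and ua = 0; by injectivity a = 0 would mean v = 0.\<close>
  have null: "dir v \<phi> x $ 2 = 0 \<and> \<phi> x $ 1 = 0 \<or> v = 0 " if x: "x \<in> S" and v: "dir v (Fc e d) x = 0" for x v
  proof (cases "v = 0")
    case False
    have dF: "Fc e d differentiable (at x)"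
      using smooth_on_differentiable[OF smooth_Fc[OF e(1) d(1)] Oc_open[OF e(1) d(1)]] SO x by blast
    have d\<Psi>: "\<Psi> differentiable (at (Fc e d x))"
      using smooth_on_differentiable[OF V(2,1)] normal_form[OF x] by simp
    have dst: "dir u standard_cuspidal_edge z = vector [2 * z $ 1 * u $ 1, 3 * (z $ 1)\<^sup>2 * u $ 1, u $ 2]" for u z
      by (rule dir_eqI[OF dir_standard_cuspidal_edge])
    have diffst: "standard_cuspidal_edge differentiable (at z)" for z
      using dir_standard_cuspidal_edge unfolding differentiable_def by blast
    have "dir (dir v \<phi> x) standard_cuspidal_edge (\<phi> x) = dir v (\<lambda>x. standard_cuspidal_edge (\<phi> x)) x"
      by (rule dir_compose[OF dphi[OF x] diffst, symmetric])
    also have "\<dots> = dir v (\<lambda>x. \<Psi> (Fc e d x)) x"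
    proof (rule dir_cong_open[OF S(1) x])
      show "(\<lambda>x. standard_cuspidal_edge (\<phi> x)) differentiable at x"
        using differentiable_compose[of standard_cuspidal_edge \<phi> x UNIV] diffst dphi[OF x] by simp
    qed (use normal_form in simp)
    also have "\<dots> = dir (dir v (Fc e d) x) \<Psi> (Fc e d x)" by (rule dir_compose[OF dF d\<Psi>])
    also have "\<dots> = 0" unfolding v using dir_zero[OF d\<Psi>] by simp
    finally have z: "\<phi> x $ 1 * dir v \<phi> x $ 1 = 0" "dir v \<phi> x $ 2 = 0"
      unfolding dst by (auto simp: vec_eq_iff forall_3)
    then have "dir v \<phi> x $ 1 \<noteq> 0" using inj[OF x, of v] False by (auto simp: vec_eq_iff forall_2)
    then show ?thesis using z by simp
  qed simp
  let ?x = "snd e (\<gamma> t)" and ?T = "velocity M \<gamma> t e"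
  have dC: "Cc e differentiable (at t)" by (rule Cc_differentiable[OF e(1) t e(2)])
  have T1: "dir ?T \<phi> ?x $ 1 = 0"
  proof -
    let ?R = "(I \<inter> \<gamma> -` fst e) \<inter> Cc e -` S"
    have R: "open ?R" "t \<in> ?R"
      using continuous_open_preimage[OF smooth_on_continuous[OF smooth_Cc[OF e(1)]] open_chart_dom[OF e(1)] S(1)] t e \<phi>(3) by auto
    have z: "\<phi> (Cc e s) $ 1 = 0" if s: "s \<in> ?R" for s
    proof -
      have "f (\<gamma> s) \<in> fst d" using normal_form[of "Cc e s"] s e(1) by (auto simp: M.param_snd)
      then have "lamc e d (Cc e s) = 0" using lam_Cc[OF e(1) d(1), of s] s by (auto simp: cdom_def)
      then obtain v where "v \<noteq> 0" "dir v (Fc e d) (Cc e s) = 0"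
        using local_front.lam_eq_0[OF local_front_chart[OF e(1) d(1)]] SO s by blast
      then show ?thesis using null[of "Cc e s" v] s by auto
    qed
    have d\<phi>C: "(\<lambda>s. \<phi> (Cc e s)) differentiable (at t)"
      using differentiable_compose[of \<phi> "Cc e" t UNIV] dC dphi[OF \<phi>(3)] by simp
    have "dir 1 (\<lambda>s. \<phi> (Cc e s) $ 1) t = dir 1 (\<lambda>s. 0) t"
    proof (rule dir_cong_open[OF R z])
      show "(\<lambda>s. \<phi> (Cc e s) $ 1) differentiable at t"
        using bounded_linear.has_derivative[OF bounded_linear_vec_nth] d\<phi>C unfolding differentiable_def by blast
    qed
    then have "dir 1 (\<lambda>s. \<phi> (Cc e s)) t $ 1 = 0"
      using dir_bounded_linear[OF bounded_linear_vec_nth d\<phi>C, of 1 1] by simp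
    then show ?thesis
      using dir_compose[OF dC, of \<phi> 1] dphi[OF \<phi>(3)] velocity_chart[OF e(1) t e(2)] by simp
  qed
  have XT: "X \<in> tangent_space M (\<gamma> t)" "X e \<noteq> 0" "dir (X e) (Fc e d) ?x = 0" and Xc: "X c \<noteq> 0"
    using X null_vector_chart[OF e d, of X] M.tangent_eq_0[OF _ c, of X] by (auto simp: null_vector_def)
  \<comment> \<open>If the velocity were a multiple of the null vector, its image under the
    differential of \<phi> would have neither component, against injectivity.\<close>
  obtain r where r: "velocity M \<gamma> t c = r *\<^sub>R X c" using det2_eq_0[OF Xc dep] by blast
  have "?T = r *\<^sub>R X e"
    using M.tangent_change[OF velocity_tangent[OF t] c(1) e(1) c(2) e(2)] M.tangent_change[OF XT(1) c(1) e(1) c(2) e(2)] r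
      dir_scale[OF M.transition_differentiable[OF c(1) e(1) c(2) e(2)]] by simp
  then have "dir ?T \<phi> ?x = r *\<^sub>R dir (X e) \<phi> ?x"
    using dir_scale[OF dphi[OF \<phi>(3)]] by simp
  then have "dir ?T \<phi> ?x $ 2 = 0" using null[OF \<phi>(3) XT(3)] XT(2) by simp
  then have "dir ?T \<phi> ?x = 0" using T1 by (simp add: vec_eq_iff forall_2)
  then show False using inj[OF \<phi>(3)] Cc_velocity_nonzero[OF e(1) t e(2)] by blast
qed

lemma image_velocity:
  assumes c: "c \<in> M" and d: "d \<in> N" and s: "s \<in> cdom c d"
  shows "velocity N (f \<circ> \<gamma>) s d = dir (dir 1 (Cc c) s) (Fc c d) (Cc c s)"
proof -
  have s': "s \<in> I" "\<gamma> s \<in> fst c" "f (\<gamma> s) \<in> fst d" using s by (auto simp: cdom_def)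
  have dF: "Fc c d differentiable (at (Cc c s))" using Fc_differentiable[OF c d s'(2,3)] by simp
  note dC = Cc_differentiable[OF c s'(1,2)]
  have "vector_derivative (snd d \<circ> (f \<circ> \<gamma>)) (at s) = dir 1 (\<lambda>s. Fc c d (Cc c s)) s"
  proof (rule vector_derivative_cong_open[OF open_cdom[OF c d] s])
    show "Fc c d (Cc c u) = (snd d \<circ> (f \<circ> \<gamma>)) u" if "u \<in> cdom c d" for u
      using that c by (simp add: cdom_def M.param_snd)
    show "(\<lambda>s. Fc c d (Cc c s)) differentiable at s"
      using differentiable_compose[of "Fc c d" "Cc c" s UNIV] dF dC by simp
  qed
  also have "\<dots> = dir (dir 1 (Cc c) s) (Fc c d) (Cc c s)"
    by (rule dir_compose[OF dC dF])
  finally have "vector_derivative (snd d \<circ> (f \<circ> \<gamma>)) (at s) = dir (dir 1 (Cc c) s) (Fc c d) (Cc c s)" .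
  moreover have "velocity N (f \<circ> \<gamma>) s d = vector_derivative (snd d \<circ> (f \<circ> \<gamma>)) (at s)"
    using d s' by (simp add: velocity_def)
  ultimately show ?thesis by (rule trans[rotated])
qed

text \<open>Splits off the image of the coordinate acceleration; this is the form in which
  \<open>cuspidal_edge_inequality\<close> takes the numerator of the singular curvature.\<close>

lemma image_acceleration:
  assumes c: "c \<in> M" and d: "d \<in> N" and t: "t \<in> cdom c d"
  shows "cov_deriv_along_curve N g (f \<circ> \<gamma>) (velocity N (f \<circ> \<gamma>)) t d =
    map_into.cov (Gc d) (Fc c d) (dir (velocity M \<gamma> t c) (Fc c d)) (snd c (\<gamma> t)) (velocity M \<gamma> t c)
    + dir (dir 1 (dir 1 (Cc c)) t) (Fc c d) (snd c (\<gamma> t))"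
proof -
  have t': "t \<in> I" "\<gamma> t \<in> fst c" "f (\<gamma> t) \<in> fst d" using t by (auto simp: cdom_def)
  have T: "velocity M \<gamma> t c = dir 1 (Cc c) t" by (rule velocity_chart[OF c t'(1,2)])
  have dC: "Cc c differentiable (at t)" by (rule Cc_differentiable[OF c t'(1,2)])
  have dC': "dir 1 (Cc c) differentiable (at t)"
    by (rule smooth_on_differentiable[OF smooth_on_dir[OF smooth_Cc[OF c] open_chart_dom[OF c]] open_chart_dom[OF c]]) (use t' in simp)
  have CO: "Cc c ` cdom c d \<subseteq> Oc c d" by (auto simp: cdom_def)
  note dd = dir_dir_compose[OF open_cdom[OF c d] t Oc_open[OF c d] CO dC dC' smooth_Fc[OF c d]]
  have "vector_derivative (\<lambda>s. velocity N (f \<circ> \<gamma>) s d) (at t) = dir 1 (\<lambda>s. dir (dir 1 (Cc c) s) (Fc c d) (Cc c s)) t"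
    by (rule vector_derivative_cong_open[OF open_cdom[OF c d] t image_velocity[OF c d, symmetric] dd(2)])
  then show ?thesis
    unfolding cov_deriv_along_curve_def conn_term_Gam dd(1) image_velocity[OF c d t]
      map_into.cov_def[OF local_front.axioms(1)[OF local_front_chart[OF c d]]] T
    using d t' c by (simp add: M.param_snd)
qed

section \<open>Consequences of a lower bound on the extrinsic curvature\<close>

lemma singular_front_at:
  fixes t defines "c \<equiv> chart_at M (\<gamma> t)"
  assumes t: "t \<in> I" and d: "d \<in> N" "f (\<gamma> t) \<in> fst d"
    and \<eta>: "\<eta> \<noteq> 0" "dir \<eta> (Fc c d) (snd c (\<gamma> t)) = 0"
  shows "singular_front (Gc d) (Vc d) (Fc c d) (Oc c d) (nc c d) (snd c (\<gamma> t)) \<eta>"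
proof -
  have c: "c \<in> M" "\<gamma> t \<in> fst c" using M.chart_at_in by (auto simp: c_def)
  have "\<exists>X. d_area_density M N g f \<nu> (\<gamma> t) X \<noteq> 0"
    using nondegenerate_point[OF t] unfolding nondegenerate_singular_point_def by blast
  then have "\<exists>X. dir X (lamc c d) (snd c (\<gamma> t)) \<noteq> 0"
    unfolding d_area_density_chart[OF d] c_def by blast
  then show ?thesis
    by (intro singular_front.intro singular_front_axioms.intro local_front_chart c d in_Oc \<eta>)
qed

text \<open>At regular points this is the bound on \<open>K_ext\<close> times
  \<open>lam\<^sup>2\<close>; at singular points both sides are zero. The inequality thus holds on a
  full neighbourhood, as the minimum argument requires.\<close>

lemma lower_bound_chart:
  assumes c: "c \<in> M" and d: "d \<in> N" and U: "open U"
    and K: "\<And>q. q \<in> U \<Longrightarrow> \<not> singular_point M N f q \<Longrightarrow> K_ext M N g f \<nu> q \<ge> \<delta>"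
    and x: "x \<in> snd c ` (fst c \<inter> (f -` fst d \<inter> U))"
  shows "Dc c d x \<ge> \<delta> * (lamc c d x)\<^sup>2"
proof -
  obtain q where q: "q \<in> fst c" "f q \<in> fst d" "q \<in> U" "x = snd c q" using x by blast
  show ?thesis
  proof (cases "singular_point M N f q")
    case True
    then have "lamc c d x = 0" unfolding q(4) singular_point_chart[OF c q(1) d q(2)] .
    then show ?thesis
      using local_front.D_singular[OF local_front_chart[OF c d]] in_Oc[OF q(1,2)] q(4) by simp
  next
    case False
    then show ?thesis
      unfolding q(4) K_ext_chart[OF c q(1) d q(2) False, symmetric]
      by (intro mult_right_mono K q) auto
  qed
qed

lemma II_vanishes_at:
  assumes t: "t \<in> I" and U: "open U" "\<gamma> t \<in> U"
    and K: "\<And>q. q \<in> U \<Longrightarrow> \<not> singular_point M N f q \<Longrightarrow> K_ext M N g f \<nu> q \<ge> \<delta>"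
    and X: "X \<in> tangent_space M (\<gamma> t)" and Y: "Y \<in> tangent_space M (\<gamma> t)"
  shows "second_fundamental_form M N g f \<nu> (\<gamma> t) X Y = 0"
proof -
  let ?c = "chart_at M (\<gamma> t)" and ?d = "chart_at N (f (\<gamma> t))"
  note c = M.chart_at_in[of "\<gamma> t"] and d = N.chart_at_in[of "f (\<gamma> t)"]
  obtain Z where "null_vector M N f (\<gamma> t) Z" using singular_\<gamma>[OF t] unfolding singular_point_def by blast
  then have Z: "Z ?c \<noteq> 0" "dir (Z ?c) (Fc ?c ?d) (snd ?c (\<gamma> t)) = 0" unfolding null_vector_chart[OF c d] by auto
  interpret singular_front "Gc ?d" "Vc ?d" "Fc ?c ?d" "Oc ?c ?d" "nc ?c ?d" "snd ?c (\<gamma> t)" "Z ?c"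
    by (rule singular_front_at[OF t d Z])
  have "II (snd ?c (\<gamma> t)) (X ?c) (Y ?c) = 0"
  proof (rule II_vanishes_of_lower_bound)
    show "open (snd ?c ` (fst ?c \<inter> (f -` fst ?d \<inter> U)))"
      by (intro M.chart_image_open c open_Int open_preimage_f N.chart_open d U)
    show "snd ?c (\<gamma> t) \<in> snd ?c ` (fst ?c \<inter> (f -` fst ?d \<inter> U))" using c d U by blast
    show "snd ?c ` (fst ?c \<inter> (f -` fst ?d \<inter> U)) \<subseteq> Oc ?c ?d" by blast
  qed (rule lower_bound_chart[OF c(1) d(1) U(1) K])
  then show ?thesis unfolding second_fundamental_form_chart[OF X Y c d] .
qed

text \<open>The factor sgn(d lam(\<eta>)) can be written as d lam(\<eta>) over its absolute value,
  so the singular curvature has the sign of the product estimated in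
  \<open>cuspidal_edge_inequality\<close>.\<close>

lemma singular_curvature_sign:
  assumes t: "t \<in> I" and edge: "cuspidal_edge M N f (\<gamma> t)" and U: "open U" "\<gamma> t \<in> U" and \<delta>: "\<delta> \<ge> 0"
    and K: "\<And>q. q \<in> U \<Longrightarrow> \<not> singular_point M N f q \<Longrightarrow> K_ext M N g f \<nu> q \<ge> \<delta>"
  shows "singular_curvature M N g f \<nu> \<gamma> t \<le> 0" and "\<delta> > 0 \<Longrightarrow> singular_curvature M N g f \<nu> \<gamma> t < 0"
proof -
  let ?c = "chart_at M (\<gamma> t)" and ?d = "chart_at N (f (\<gamma> t))"
  let ?x = "snd ?c (\<gamma> t)" and ?T = "velocity M \<gamma> t ?c"
  note c = M.chart_at_in[of "\<gamma> t"] and d = N.chart_at_in[of "f (\<gamma> t)"]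
  have td: "t \<in> cdom ?c ?d" using t c d by (simp add: cdom_def)
  let ?P = "\<lambda>\<eta>. null_vector M N f (\<gamma> t) \<eta> \<and> det (vector [?T, \<eta> ?c] :: real^2^2) > 0"
  \<comment> \<open>The choice in \<open>singular_curvature\<close> is meaningful only if a
    positively oriented null vector exists; transversality makes the determinant nonzero, and
    negating the vector corrects its sign.\<close>
  have "\<exists>\<eta>. ?P \<eta>"
  proof -
    obtain Z where Z: "null_vector M N f (\<gamma> t) Z" using singular_\<gamma>[OF t] unfolding singular_point_def by blast
    have ne: "det2 ?T (Z ?c) \<noteq> 0" by (rule cuspidal_edge_transversal[OF t edge Z c])
    show ?thesis
    proof (cases "det2 ?T (Z ?c) > 0")
      case True
      then show ?thesis using Z unfolding det_vector2 by blast
    next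
      case False
      have "dir (- Z ?c) (Fc ?c ?d) ?x = 0"
        using Z dir_neg[OF Fc_differentiable[OF c(1) d(1) c(2) d(2)]]
        unfolding null_vector_chart[OF c d] by simp
      then have "null_vector M N f (\<gamma> t) (M.tvector ?c (- Z ?c) (\<gamma> t))"
        using Z unfolding null_vector_chart[OF c d] by (simp add: M.tvector_tangent[OF c] M.tvector_self[OF c])
      moreover have "det2 ?T (M.tvector ?c (- Z ?c) (\<gamma> t) ?c) > 0"
        using False ne unfolding M.tvector_self[OF c] by (simp add: det2_def)
      ultimately show ?thesis unfolding det_vector2 by blast
    qed
  qed
  define \<eta> where "\<eta> = (SOME \<eta>. ?P \<eta>)"
  have eta: "null_vector M N f (\<gamma> t) \<eta>" "det2 ?T (\<eta> ?c) > 0"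
    using someI_ex[OF \<open>\<exists>\<eta>. ?P \<eta>\<close>] unfolding \<eta>_def det_vector2 by blast+
  have Z: "\<eta> ?c \<noteq> 0" "dir (\<eta> ?c) (Fc ?c ?d) ?x = 0" using eta(1) unfolding null_vector_chart[OF c d] by auto
  interpret singular_front "Gc ?d" "Vc ?d" "Fc ?c ?d" "Oc ?c ?d" "nc ?c ?d" ?x "\<eta> ?c"
    by (rule singular_front_at[OF t d Z])
  let ?v = "velocity N (f \<circ> \<gamma>)"
  let ?a = "cov_deriv_along_curve N g (f \<circ> \<gamma>) ?v"
  let ?T' = "dir 1 (dir 1 (Cc ?c)) t"
  let ?N = "mu (Gc ?d) (Fc ?c ?d ?x) (dir ?T (Fc ?c ?d) ?x) (cov (dir ?T (Fc ?c ?d)) ?x ?T + dir ?T' (Fc ?c ?d) ?x) (nc ?c ?d ?x)"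
  have v: "?v t ?d = dir ?T (Fc ?c ?d) ?x"
    using image_velocity[OF c(1) d(1) td] velocity_chart[OF c(1) t c(2)] by simp
  have a: "?a t ?d = cov (dir ?T (Fc ?c ?d)) ?x ?T + dir ?T' (Fc ?c ?d) ?x"
    by (rule image_acceleration[OF c(1) d(1) td])
  have dne: "det2 ?T (\<eta> ?c) \<noteq> 0" using eta(2) by simp
  have v_nz: "?v t ?d \<noteq> 0" unfolding v by (rule tangent_nonzero[OF dne])
  let ?L = "sqrt (ginner N g (f (\<gamma> t)) (?v t) (?v t))"
  have "ginner N g (f (\<gamma> t)) (?v t) (?v t) = ip (Gc ?d) (snd ?d (f (\<gamma> t))) (?v t ?d) (?v t ?d)"
    unfolding ginner_def Let_def ip_def Gc_snd[OF d] ..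
  then have L: "?L > 0" using ip_pos[OF _ v_nz] d by simp
  have vol: "volume_form N g (f (\<gamma> t)) (?v t) (?a t) (\<nu> (\<gamma> t)) = ?N"
    unfolding volume_form_def Let_def mu_def v a Fc_snd[OF c] M.param_snd[OF c] Gc_snd[OF d] ..
  let ?l = "dir (\<eta> ?c) (lamc ?c ?d) ?x"
  have sc: "singular_curvature M N g f \<nu> \<gamma> t = sgn ?l * (?N / ?L ^ 3)"
    unfolding singular_curvature_def Let_def \<eta>_def[symmetric] vol d_area_density_chart[OF d] ..
  have Tl: "dir ?T (lamc ?c ?d) ?x = 0" by (rule dir_velocity_lam[OF c(1) d(1) td])
  \<comment> \<open>T and \<eta> span all directions and the differential of \<open>lam\<close>
    vanishes on T, so by non-degeneracy it cannot vanish on \<eta>.\<close>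
  have l: "?l \<noteq> 0"
  proof
    assume "?l = 0"
    then have "dir (r *\<^sub>R ?T + s *\<^sub>R \<eta> ?c) (lamc ?c ?d) ?x = 0" for r s
      using Tl dir_plus[OF differentiable_lam[OF p]]
        dir_scale[OF differentiable_lam[OF p]] by simp
    then have "dir X (lamc ?c ?d) ?x = 0" for X
      by (subst det2_0D[OF dne, of X]) blast
    then show False using nondegenerate by blast
  qed
  have ineq: "?N * ?l \<le> - \<delta> * det2 ?T (\<eta> ?c) * (\<kappa> ?T * ?l)\<^sup>2"
  proof (rule cuspidal_edge_inequality)
    show "open (snd ?c ` (fst ?c \<inter> (f -` fst ?d \<inter> U)))"
      by (intro M.chart_image_open c open_Int open_preimage_f N.chart_open d U)
    show "?x \<in> snd ?c ` (fst ?c \<inter> (f -` fst ?d \<inter> U))" using c d U by blast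
    show "snd ?c ` (fst ?c \<inter> (f -` fst ?d \<inter> U)) \<subseteq> Oc ?c ?d" by blast
  qed (use eta Tl lower_bound_chart[OF c(1) d(1) U(1) K] in auto)
  have pos: "det2 ?T (\<eta> ?c) * (\<kappa> ?T * ?l)\<^sup>2 > 0"
    using eta(2) kappa_nonzero[OF dne] l by simp
  have form: "singular_curvature M N g f \<nu> \<gamma> t = (?N * ?l) / (\<bar>?l\<bar> * ?L ^ 3)"
    unfolding sc using l by (simp add: sgn_if)
  have den: "\<bar>?l\<bar> * ?L ^ 3 > 0" using l L by simp
  have nonneg: "\<delta> * (det2 ?T (\<eta> ?c) * (\<kappa> ?T * ?l)\<^sup>2) \<ge> 0" using \<delta> pos by simp
  then have "?N * ?l \<le> 0" using ineq by (simp add: mult.assoc)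
  then show "singular_curvature M N g f \<nu> \<gamma> t \<le> 0"
    unfolding form using den by (intro divide_nonpos_pos)
  assume "\<delta> > 0"
  then have "\<delta> * (det2 ?T (\<eta> ?c) * (\<kappa> ?T * ?l)\<^sup>2) > 0" using pos by (rule mult_pos_pos)
  then have "?N * ?l < 0" using ineq by (simp add: mult.assoc)
  then show "singular_curvature M N g f \<nu> \<gamma> t < 0"
    unfolding form using den by (intro divide_neg_pos)
qed

section \<open>Boundedness of the Gaussian curvature\<close>

lemma curvature_difference_near:
  "\<exists>U C. open U \<and> q\<^sub>0 \<in> U \<and> (\<forall>q\<in>U. \<not> singular_point M N f q \<longrightarrow> \<bar>K_gauss M N g f q - K_ext M N g f \<nu> q\<bar> \<le> C)"
proof -
  let ?d = "chart_at N (f q\<^sub>0)"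
  note d = N.chart_at_in[of "f q\<^sub>0"]
  have "snd ?d (f q\<^sub>0) \<in> Vc ?d" using d by blast
  then obtain r where r: "r > 0" "cball (snd ?d (f q\<^sub>0)) r \<subseteq> Vc ?d"
    using N.chart_open(2)[OF d(1)] open_contains_cball by blast
  obtain C where C: "\<And>q. f q \<in> fst ?d \<Longrightarrow> snd ?d (f q) \<in> cball (snd ?d (f q\<^sub>0)) r \<Longrightarrow> \<not> singular_point M N f q
    \<Longrightarrow> \<bar>K_gauss M N g f q - K_ext M N g f \<nu> q\<bar> \<le> C"
    using curvature_difference_bound[OF d(1) compact_cball r(2)] by blast
  let ?U = "f -` (fst ?d \<inter> snd ?d -` ball (snd ?d (f q\<^sub>0)) r)"
  have "open ?U" by (intro open_preimage_f N.chart_preimage_open d open_ball)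
  moreover have "q\<^sub>0 \<in> ?U" using d r by simp
  moreover have "\<forall>q\<in>?U. \<not> singular_point M N f q \<longrightarrow> \<bar>K_gauss M N g f q - K_ext M N g f \<nu> q\<bar> \<le> C"
    using C by simp
  ultimately show ?thesis by blast
qed

text \<open>Two-sided boundedness of K is used only through the lower bound - C - C' on
  \<open>K_ext\<close>; that this constant may be negative is harmless in
  \<open>II_vanishes_at\<close>.\<close>

lemma II_vanishes_of_bounded:
  assumes t: "t \<in> I" and U: "open U" "\<gamma> t \<in> U"
    and K: "\<And>q. q \<in> U \<Longrightarrow> \<not> singular_point M N f q \<Longrightarrow> \<bar>K_gauss M N g f q\<bar> \<le> C"
    and X: "X \<in> tangent_space M (\<gamma> t)" and Y: "Y \<in> tangent_space M (\<gamma> t)"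
  shows "second_fundamental_form M N g f \<nu> (\<gamma> t) X Y = 0"
proof -
  obtain W C' where W: "open W" "\<gamma> t \<in> W"
    "\<And>q. q \<in> W \<Longrightarrow> \<not> singular_point M N f q \<Longrightarrow> \<bar>K_gauss M N g f q - K_ext M N g f \<nu> q\<bar> \<le> C'"
    using curvature_difference_near[of "\<gamma> t"] by blast
  show ?thesis
  proof (rule II_vanishes_at[OF t _ _ _ X Y])
    show "open (U \<inter> W)" "\<gamma> t \<in> U \<inter> W" using U W by auto
    show "K_ext M N g f \<nu> q \<ge> - C - C'" if "q \<in> U \<inter> W" "\<not> singular_point M N f q" for q
      using K[of q] W(3)[of q] that by fastforce
  qed
qed

lemma bounded_near:
  assumes h: "\<And>s X Y. s \<in> I \<Longrightarrow> X \<in> tangent_space M (\<gamma> s) \<Longrightarrow> Y \<in> tangent_space M (\<gamma> s)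
      \<Longrightarrow> second_fundamental_form M N g f \<nu> (\<gamma> s) X Y = 0"
    and t: "t \<in> I"
  shows "\<exists>U C. open U \<and> \<gamma> t \<in> U \<and> (\<forall>q\<in>U. \<not> singular_point M N f q \<longrightarrow> \<bar>K_gauss M N g f q\<bar> \<le> C)"
proof -
  let ?c = "chart_at M (\<gamma> t)" and ?d = "chart_at N (f (\<gamma> t))"
  note c = M.chart_at_in[of "\<gamma> t"] and d = N.chart_at_in[of "f (\<gamma> t)"]
  interpret local_front "Gc ?d" "Vc ?d" "Fc ?c ?d" "Oc ?c ?d" "nc ?c ?d" by (rule local_front_chart[OF c(1) d(1)])
  have td: "t \<in> cdom ?c ?d" using t c d by (simp add: cdom_def)
  \<comment> \<open>A closed parameter interval on which the curve stays in both charts, as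
    \<open>D_bound_near_curve\<close> needs the vanishing of \<open>lam\<close> and
    \<open>II\<close> there.\<close>
  obtain r where r: "r > 0" "cball t r \<subseteq> cdom ?c ?d"
    using open_cdom[OF c(1) d(1)] td open_contains_cball by blast
  have r': "s \<in> cdom ?c ?d" if "\<bar>s - t\<bar> \<le> r" for s
    using r(2) that by (auto simp: dist_real_def abs_minus_commute)
  have "\<exists>X. d_area_density M N g f \<nu> (\<gamma> t) X \<noteq> 0"
    using nondegenerate_point[OF t] unfolding nondegenerate_singular_point_def by blast
  then obtain e where e: "dir e (lamc ?c ?d) (Cc ?c t) \<noteq> 0"
    unfolding d_area_density_chart[OF d] by auto
  have "\<exists>W C. open W \<and> Cc ?c t \<in> W \<and> W \<subseteq> Oc ?c ?d \<and> (\<forall>x\<in>W. \<bar>Dc ?c ?d x\<bar> \<le> C * (lamc ?c ?d x)\<^sup>2)"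
  proof (rule D_bound_near_curve[where c="Cc ?c" and ?t0.0=t and T="velocity M \<gamma> t ?c" and d=r and e\<^sub>0=e])
    show "(Cc ?c has_vector_derivative velocity M \<gamma> t ?c) (at t)"
      using Cc_differentiable[OF c(1) t c(2)] c by (simp add: velocity_def vector_derivative_works[symmetric])
    show "velocity M \<gamma> t ?c \<noteq> 0" by (rule Cc_velocity_nonzero[OF c(1) t c(2)])
    show "Cc ?c t \<in> Oc ?c ?d" using in_Oc[OF c(2) d(2)] by simp
    show "r > 0" by (rule r)
    show "continuous_on {t - r..t + r} (Cc ?c)"
      by (rule continuous_on_subset[OF smooth_on_continuous[OF smooth_Cc[OF c(1)]]])
        (use r' in \<open>force simp: cdom_def abs_le_iff\<close>)
    show "dir e (lamc ?c ?d) (Cc ?c t) \<noteq> 0" by (rule e)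
    fix s assume s: "\<bar>s - t\<bar> \<le> r"
    have sd: "s \<in> I" "\<gamma> s \<in> fst ?c" "f (\<gamma> s) \<in> fst ?d" using r'[OF s] by (auto simp: cdom_def)
    have "IIc ?c ?d (Cc ?c s) a b = 0" for a b
      using second_fundamental_form_chart[OF M.tvector_tangent M.tvector_tangent c(1) sd(2) d(1) sd(3), of ?c ?c a b]
        h[OF sd(1) M.tvector_tangent M.tvector_tangent, of ?c ?c a b] c(1) sd(2)
      by (simp add: M.tvector_self)
    then show "lamc ?c ?d (Cc ?c s) = 0 \<and> (\<forall>a b. IIc ?c ?d (Cc ?c s) a b = 0)"
      using lam_Cc[OF c(1) d(1) r'[OF s]] by blast
  qed
  then obtain W C where W: "open W" "Cc ?c t \<in> W" "W \<subseteq> Oc ?c ?d"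
    "\<And>x. x \<in> W \<Longrightarrow> \<bar>Dc ?c ?d x\<bar> \<le> C * (lamc ?c ?d x)\<^sup>2" by blast
  obtain W' C' where W': "open W'" "\<gamma> t \<in> W'"
    "\<And>q. q \<in> W' \<Longrightarrow> \<not> singular_point M N f q \<Longrightarrow> \<bar>K_gauss M N g f q - K_ext M N g f \<nu> q\<bar> \<le> C'"
    using curvature_difference_near[of "\<gamma> t"] by blast
  let ?U = "(fst ?c \<inter> snd ?c -` W) \<inter> f -` fst ?d \<inter> W'"
  have "open ?U"
    by (intro open_Int M.chart_preimage_open c W W' open_preimage_f N.chart_open d)
  moreover have "\<gamma> t \<in> ?U" using c d W W' by simp
  moreover have "\<bar>K_gauss M N g f q\<bar> \<le> C + C'" if q: "q \<in> ?U" and reg: "\<not> singular_point M N f q" for q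
  proof -
    have q': "q \<in> fst ?c" "f q \<in> fst ?d" "snd ?c q \<in> W" "q \<in> W'" using q by auto
    have "(lamc ?c ?d (snd ?c q))\<^sup>2 > 0" using reg unfolding singular_point_chart[OF c(1) q'(1) d(1) q'(2)] by simp
    moreover have "\<bar>K_ext M N g f \<nu> q\<bar> * (lamc ?c ?d (snd ?c q))\<^sup>2 \<le> C * (lamc ?c ?d (snd ?c q))\<^sup>2"
      using W(4)[OF q'(3)] unfolding K_ext_chart[OF c(1) q'(1) d(1) q'(2) reg, symmetric] by (simp add: abs_mult)
    ultimately have "\<bar>K_ext M N g f \<nu> q\<bar> \<le> C" by (simp add: mult_le_cancel_right)
    then show ?thesis using W'(3)[OF q'(4) reg] by linarith
  qed
  ultimately show ?thesis by blast
qed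

lemma bounded_near_compact:
  assumes h: "\<And>s X Y. s \<in> I \<Longrightarrow> X \<in> tangent_space M (\<gamma> s) \<Longrightarrow> Y \<in> tangent_space M (\<gamma> s)
      \<Longrightarrow> second_fundamental_form M N g f \<nu> (\<gamma> s) X Y = 0"
    and J: "compact J" "J \<subseteq> I"
  shows "\<exists>U C. open U \<and> \<gamma> ` J \<subseteq> U \<and> (\<forall>q\<in>U. \<not> singular_point M N f q \<longrightarrow> \<bar>K_gauss M N g f q\<bar> \<le> C)"
proof -
  have "\<forall>t\<in>J. \<exists>U C. open U \<and> \<gamma> t \<in> U \<and> (\<forall>q\<in>U. \<not> singular_point M N f q \<longrightarrow> \<bar>K_gauss M N g f q\<bar> \<le> C)"
    using bounded_near[OF h] J(2) by blast
  then obtain U C where U: "\<And>t. t \<in> J \<Longrightarrow> open (U t) \<and> \<gamma> t \<in> U t \<and>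
      (\<forall>q\<in>U t. \<not> singular_point M N f q \<longrightarrow> \<bar>K_gauss M N g f q\<bar> \<le> C t)" by metis
  have "compact (\<gamma> ` J)"
    by (rule compact_continuous_image[OF continuous_on_subset[OF cont_\<gamma> J(2)] J(1)])
  then obtain J' where J': "J' \<subseteq> J" "finite J'" "\<gamma> ` J \<subseteq> (\<Union>t\<in>J'. U t)"
    by (rule compactE_image[of _ J U]) (use U in auto)
  \<comment> \<open>The sum of the absolute local bounds dominates each of them and, unlike a
    maximum, needs no separate case for empty \<open>J'\<close>.\<close>
  have "\<bar>K_gauss M N g f q\<bar> \<le> (\<Sum>t\<in>J'. \<bar>C t\<bar>)" if q: "q \<in> (\<Union>t\<in>J'. U t)" "\<not> singular_point M N f q" for q
  proof -
    obtain t where t: "t \<in> J'" "q \<in> U t" using q by blast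
    then have "\<bar>K_gauss M N g f q\<bar> \<le> C t" using U[of t] J'(1) q(2) by blast
    also have "\<dots> \<le> \<bar>C t\<bar>" by simp
    also have "\<dots> \<le> (\<Sum>t\<in>J'. \<bar>C t\<bar>)" by (rule member_le_sum[OF t(1) _ J'(2)]) simp
    finally show ?thesis .
  qed
  moreover have "open (\<Union>t\<in>J'. U t)" using U J'(1) by blast
  ultimately show ?thesis using J'(3) by blast
qed

end

theorem theorem3p1:
  fixes M :: "('m::{t2_space,second_countable_topology}, 2) chart set"
    and N :: "('n::{t2_space,second_countable_topology}, 3) chart set"
    and g :: "('n, 3) metric"
    and f :: "'m \<Rightarrow> 'n"
    and \<nu> :: "'m \<Rightarrow> ('n, 3) tvec"
    and p :: 'm
    and I :: "real set"
    and \<gamma> :: "real \<Rightarrow> 'm"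
  assumes "oriented_atlas M"
    and "oriented_atlas N"
    and "riemannian_metric N g"
    and "front M N g f \<nu>"
    and "singular_point M N f p"
    and "open I" and "is_interval I" and "0 \<in> I"
    and "nondegenerate_singular_curve M N g f \<nu> I \<gamma>"
    and "\<gamma> 0 = p"
  shows
    "((\<forall>J. compact J \<and> J \<subseteq> I \<longrightarrow>
          (\<exists>U C. open U \<and> \<gamma> ` J \<subseteq> U \<and>
             (\<forall>q\<in>U. \<not> singular_point M N f q \<longrightarrow> \<bar>K_gauss M N g f q\<bar> \<le> C)))
       \<longleftrightarrow>
      (\<forall>t\<in>I. \<forall>X\<in>tangent_space M (\<gamma> t). \<forall>Y\<in>tangent_space M (\<gamma> t).
          second_fundamental_form M N g f \<nu> (\<gamma> t) X Y = 0))
     \<and>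
     (\<forall>U. open U \<and> p \<in> U \<and>
          (\<forall>q\<in>U - \<gamma> ` I. \<not> singular_point M N f q \<longrightarrow> K_ext M N g f \<nu> q \<ge> 0)
        \<longrightarrow> (\<forall>t\<in>I. \<gamma> t \<in> U \<and> cuspidal_edge M N f (\<gamma> t)
               \<longrightarrow> singular_curvature M N g f \<nu> \<gamma> t \<le> 0))
     \<and>
     (\<forall>U \<delta>. open U \<and> p \<in> U \<and> \<delta> > 0 \<and>
          (\<forall>q\<in>U - \<gamma> ` I. \<not> singular_point M N f q \<longrightarrow> K_ext M N g f \<nu> q \<ge> \<delta>)
        \<longrightarrow> (cuspidal_edge M N f p \<longrightarrow> singular_curvature M N g f \<nu> \<gamma> 0 < 0))
     \<and>
     (euclidean_3space N g \<longrightarrow>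
       (\<forall>U. open U \<and> p \<in> U \<and>
          (\<forall>q\<in>U - \<gamma> ` I. \<not> singular_point M N f q \<longrightarrow> K_gauss M N g f q \<ge> 0)
        \<longrightarrow> (\<forall>t\<in>I. \<gamma> t \<in> U \<and> cuspidal_edge M N f (\<gamma> t)
               \<longrightarrow> singular_curvature M N g f \<nu> \<gamma> t \<le> 0)))"
proof -
  interpret singular_curve M N g f \<nu> I \<gamma>
    using assms by unfold_locales (auto simp: oriented_atlas_def)
  have sing: "singular_point M N f q" if "q \<in> \<gamma> ` I" for q using singular_\<gamma> that by blast
  have 1: "(\<forall>J. compact J \<and> J \<subseteq> I \<longrightarrow>
          (\<exists>U C. open U \<and> \<gamma> ` J \<subseteq> U \<and>
             (\<forall>q\<in>U. \<not> singular_point M N f q \<longrightarrow> \<bar>K_gauss M N g f q\<bar> \<le> C)))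
       \<longleftrightarrow>
      (\<forall>t\<in>I. \<forall>X\<in>tangent_space M (\<gamma> t). \<forall>Y\<in>tangent_space M (\<gamma> t).
          second_fundamental_form M N g f \<nu> (\<gamma> t) X Y = 0)" (is "?L = ?R")
  proof
    assume L: ?L
    show ?R
    proof (intro ballI)
      fix t X Y assume t: "t \<in> I" and XY: "X \<in> tangent_space M (\<gamma> t)" "Y \<in> tangent_space M (\<gamma> t)"
      \<comment> \<open>The vanishing of \<open>II\<close> is a pointwise matter, so the compact set
        can be taken as a single parameter.\<close>
      have "\<exists>U C. open U \<and> \<gamma> ` {t} \<subseteq> U \<and> (\<forall>q\<in>U. \<not> singular_point M N f q \<longrightarrow> \<bar>K_gauss M N g f q\<bar> \<le> C)"
        using L t compact_sing[of t] by blast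
      then obtain U C where "open U" "\<gamma> t \<in> U" "\<And>q. q \<in> U \<Longrightarrow> \<not> singular_point M N f q \<Longrightarrow> \<bar>K_gauss M N g f q\<bar> \<le> C"
        by blast
      then show "second_fundamental_form M N g f \<nu> (\<gamma> t) X Y = 0"
        by (rule II_vanishes_of_bounded[OF t _ _ _ XY])
    qed
  next
    assume R: ?R
    show ?L
    proof (intro allI impI, elim conjE)
      fix J assume J: "compact J" "J \<subseteq> I"
      show "\<exists>U C. open U \<and> \<gamma> ` J \<subseteq> U \<and> (\<forall>q\<in>U. \<not> singular_point M N f q \<longrightarrow> \<bar>K_gauss M N g f q\<bar> \<le> C)"
        by (rule bounded_near_compact[OF R[rule_format] J])
    qed
  qed
  \<comment> \<open>Points on the curve are singular, so removing the curve from U discards no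
    regular point.\<close>
  have lift: "K_ext M N g f \<nu> q \<ge> \<delta>"
    if "\<forall>q\<in>U - \<gamma> ` I. \<not> singular_point M N f q \<longrightarrow> K_ext M N g f \<nu> q \<ge> \<delta>"
      "q \<in> U" "\<not> singular_point M N f q" for U \<delta> q
    using that sing by blast
  have 2: "singular_curvature M N g f \<nu> \<gamma> t \<le> 0"
    if U: "open U" and K: "\<forall>q\<in>U - \<gamma> ` I. \<not> singular_point M N f q \<longrightarrow> K_ext M N g f \<nu> q \<ge> 0"
      and t: "t \<in> I" "\<gamma> t \<in> U" "cuspidal_edge M N f (\<gamma> t)" for U t
    by (rule singular_curvature_sign(1)[OF t(1,3) U t(2) order_refl lift[OF K]])
  have 3: "singular_curvature M N g f \<nu> \<gamma> 0 < 0"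
    if U: "open U" "p \<in> U" and \<delta>: "\<delta> > 0"
      and K: "\<forall>q\<in>U - \<gamma> ` I. \<not> singular_point M N f q \<longrightarrow> K_ext M N g f \<nu> q \<ge> \<delta>"
      and edge: "cuspidal_edge M N f p" for U \<delta>
    by (rule singular_curvature_sign(2)[OF assms(8) _ U(1) _ less_imp_le[OF \<delta>] lift[OF K] \<delta>])
      (simp_all add: assms(10) U(2) edge)
  have 4: "singular_curvature M N g f \<nu> \<gamma> t \<le> 0"
    if flat: "euclidean_3space N g" and U: "open U"
      and K: "\<forall>q\<in>U - \<gamma> ` I. \<not> singular_point M N f q \<longrightarrow> K_gauss M N g f q \<ge> 0"
      and t: "t \<in> I" "\<gamma> t \<in> U" "cuspidal_edge M N f (\<gamma> t)" for U t
  proof (rule 2[OF U _ t], intro ballI impI)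
    fix q assume q: "q \<in> U - \<gamma> ` I" and reg: "\<not> singular_point M N f q"
    show "K_ext M N g f \<nu> q \<ge> 0"
      unfolding curvature_flat[OF flat reg, symmetric] using K q reg by blast
  qed
  show ?thesis
  proof (intro conjI)
    show "(\<forall>J. compact J \<and> J \<subseteq> I \<longrightarrow>
          (\<exists>U C. open U \<and> \<gamma> ` J \<subseteq> U \<and>
             (\<forall>q\<in>U. \<not> singular_point M N f q \<longrightarrow> \<bar>K_gauss M N g f q\<bar> \<le> C)))
       \<longleftrightarrow>
      (\<forall>t\<in>I. \<forall>X\<in>tangent_space M (\<gamma> t). \<forall>Y\<in>tangent_space M (\<gamma> t).
          second_fundamental_form M N g f \<nu> (\<gamma> t) X Y = 0)" by (rule 1)
  next
    show "\<forall>U. open U \<and> p \<in> U \<and>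
          (\<forall>q\<in>U - \<gamma> ` I. \<not> singular_point M N f q \<longrightarrow> K_ext M N g f \<nu> q \<ge> 0)
        \<longrightarrow> (\<forall>t\<in>I. \<gamma> t \<in> U \<and> cuspidal_edge M N f (\<gamma> t)
               \<longrightarrow> singular_curvature M N g f \<nu> \<gamma> t \<le> 0)"
      by (intro allI impI ballI, elim conjE) (rule 2)
  next
    show "\<forall>U \<delta>. open U \<and> p \<in> U \<and> \<delta> > 0 \<and>
          (\<forall>q\<in>U - \<gamma> ` I. \<not> singular_point M N f q \<longrightarrow> K_ext M N g f \<nu> q \<ge> \<delta>)
        \<longrightarrow> (cuspidal_edge M N f p \<longrightarrow> singular_curvature M N g f \<nu> \<gamma> 0 < 0)"
      by (intro allI impI, elim conjE) (rule 3)
  next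
    show "euclidean_3space N g \<longrightarrow>
       (\<forall>U. open U \<and> p \<in> U \<and>
          (\<forall>q\<in>U - \<gamma> ` I. \<not> singular_point M N f q \<longrightarrow> K_gauss M N g f q \<ge> 0)
        \<longrightarrow> (\<forall>t\<in>I. \<gamma> t \<in> U \<and> cuspidal_edge M N f (\<gamma> t)
               \<longrightarrow> singular_curvature M N g f \<nu> \<gamma> t \<le> 0))"
      by (intro allI impI ballI, elim conjE) (rule 4)
  qed
qed

end
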